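(* Let $(M,\omega)$ be a compact symplectic manifold of dimension $2n$, with Poisson bracket $\{\cdot,\cdot\}$ generated by $\omega$, and let $\mathrm{Dens}$ be the space of smooth volume forms on $M$ with total integral $1$, equipped with the Poisson bracket $\{\cdot,\cdot\}_{\mathrm{Dens}}$. Then the Poisson bracket $\{\cdot,\cdot\}_{\mathrm{Dens}}$ admits infinitely many functionally independent Casimirs. Namely, for any function $h:\mathbb{R}\to\mathbb{R}$, the functional on $\mathrm{Dens}$ defined by $$C_h(d\nu):=\int_M h\Big(\frac{d\nu}{\omega^n}\Big)\,\omega^n$$ is a Casimir, i.e. it is constant on the symplectic leaves of the bracket $\{\cdot,\cdot\}_{\mathrm{Dens}}$ in $\mathrm{Dens}$.
   Context: $\mathrm{Dens}$ is the set of smooth volume forms on $M$ with total integral $1$, regarded as an infinite-dimensional smooth manifold. For $d\nu\in\mathrm{Dens}$, $\frac{d\nu}{\omega^n}$ denotes the smooth function $\theta$ on $M$ with $d\nu=\theta\,\omega^n$. Each $f\in C^\infty(M)$ defines a linear functional $F_f(d\nu):=\int_M f\,d\nu$ on $\mathrm{Dens}$. The Poisson bracket on $\mathrm{Dens}$ is determined on these linear functionals by $\{F_f,F_g\}_{\mathrm{Dens}}(d\nu):=F_{\{f,g\}}(d\nu)=\int_M\{f,g\}\,d\nu$. The symplectic leaves of $\{\cdot,\cdot\}_{\mathrm{Dens}}$ are the orbits in $\mathrm{Dens}$ of the natural action on densities of the group of Hamiltonian diffeomorphisms of $M$ (the group generated by flows of Hamiltonian vector fields on $M$). A Casimir is a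 function constant on symplectic leaves. *)

theory Defs
  imports "HOL-Analysis.Analysis" "HOL-Combinatorics.Permutations"
begin

section \<open>Smooth maps between open subsets of normed spaces\<close>

primrec Ck_on :: "nat \<Rightarrow> ('b::real_normed_vector \<Rightarrow> 'c::real_normed_vector) \<Rightarrow> 'b set \<Rightarrow> bool" where
  "Ck_on 0 f S \<longleftrightarrow> continuous_on S f"
| "Ck_on (Suc k) f S \<longleftrightarrow> (\<forall>x\<in>S. f differentiable (at x)) \<and>
     (\<forall>v. Ck_on k (\<lambda>x. frechet_derivative f (at x) v) S)"

definition smooth_on :: "('b::real_normed_vector \<Rightarrow> 'c::real_normed_vector) \<Rightarrow> 'b set \<Rightarrow> bool" where
  "smooth_on f S \<longleftrightarrow> (\<forall>k. Ck_on k f S)"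

primrec iter_deriv :: "('b::real_normed_vector \<Rightarrow> 'c::real_normed_vector) \<Rightarrow> 'b list \<Rightarrow> 'b \<Rightarrow> 'c" where
  "iter_deriv f [] = f"
| "iter_deriv f (v # vs) = (\<lambda>x. frechet_derivative (iter_deriv f vs) (at x) v)"


section \<open>Smooth manifolds\<close>

text \<open>The manifold is the whole Hausdorff second countable space \<open>'a\<close> (in particular it is
  nonempty), with a smooth structure given by an atlas \<open>A\<close>, not necessarily maximal.
  A chart is a pair of its domain and its coordinate map, whose values outside of the domain
  are irrelevant.\<close>

type_synonym ('a, 'e) chart = "'a set \<times> ('a \<Rightarrow> 'e)"

abbreviation chart_dom :: "('a, 'e) chart \<Rightarrow> 'a set" where
  "chart_dom c \<equiv> fst c"

abbreviation coords :: "('a, 'e) chart \<Rightarrow> 'a \<Rightarrow> 'e" where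
  "coords c \<equiv> snd c"

definition chart_img :: "('a, 'e) chart \<Rightarrow> 'e set" where
  "chart_img c = coords c ` chart_dom c"

definition chart_inv :: "('a, 'e) chart \<Rightarrow> 'e \<Rightarrow> 'a" where
  "chart_inv c = inv_into (chart_dom c) (coords c)"

definition is_chart :: "('a::topological_space, 'e::real_normed_vector) chart \<Rightarrow> bool" where
  "is_chart c \<longleftrightarrow> open (chart_dom c) \<and> open (chart_img c) \<and>
     homeomorphism (chart_dom c) (chart_img c) (coords c) (chart_inv c)"

definition smooth_atlas ::
    "('a::{t2_space,second_countable_topology}, 'e::euclidean_space) chart set \<Rightarrow> bool" where
  "smooth_atlas A \<longleftrightarrow> (\<forall>c\<in>A. is_chart c) \<and> (\<Union>c\<in>A. chart_dom c) = UNIV \<and>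
     (\<forall>c\<in>A. \<forall>d\<in>A. smooth_on (coords d \<circ> chart_inv c) (coords c ` (chart_dom c \<inter> chart_dom d)))"

definition chart_at :: "('a, 'e) chart set \<Rightarrow> 'a \<Rightarrow> ('a, 'e) chart" where
  "chart_at A p = (SOME c. c \<in> A \<and> p \<in> chart_dom c)"

definition smooth_fun ::
    "('a, 'e::real_normed_vector) chart set \<Rightarrow> ('a \<Rightarrow> real) \<Rightarrow> bool" where
  "smooth_fun A f \<longleftrightarrow> (\<forall>c\<in>A. smooth_on (f \<circ> chart_inv c) (chart_img c))"


section \<open>Tangent vectors\<close>

text \<open>A tangent vector at \<open>p\<close> is the family of its coordinate representations in all charts
  around \<open>p\<close>, related to each other by the derivatives of the transition maps
  (and extended by zero to all other pairs).\<close>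

type_synonym ('a, 'e) tvec = "('a, 'e) chart \<Rightarrow> 'e"

definition trans_deriv ::
    "('a, 'e::real_normed_vector) chart \<Rightarrow> ('a, 'e) chart \<Rightarrow> 'a \<Rightarrow> 'e \<Rightarrow> 'e" where
  "trans_deriv c d p = frechet_derivative (coords d \<circ> chart_inv c) (at (coords c p))"

definition tangent_space ::
    "('a, 'e::real_normed_vector) chart set \<Rightarrow> 'a \<Rightarrow> ('a, 'e) tvec set" where
  "tangent_space A p =
     {v. (\<forall>c. \<not> (c \<in> A \<and> p \<in> chart_dom c) \<longrightarrow> v c = 0) \<and>
         (\<forall>c\<in>A. \<forall>d\<in>A. p \<in> chart_dom c \<and> p \<in> chart_dom d \<longrightarrow> v d = trans_deriv c d p (v c))}"

text \<open>The tangent vector at \<open>p\<close> whose representation in the chart \<open>c\<close> is \<open>e\<close>.\<close>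

definition coord_vec ::
    "('a, 'e::real_normed_vector) chart set \<Rightarrow> ('a, 'e) chart \<Rightarrow> 'a \<Rightarrow> 'e \<Rightarrow> ('a, 'e) tvec" where
  "coord_vec A c p e = (\<lambda>d. if d \<in> A \<and> p \<in> chart_dom d then trans_deriv c d p e else 0)"

definition tvec_comb :: "real \<Rightarrow> ('a, 'e::real_vector) tvec \<Rightarrow> real \<Rightarrow> ('a, 'e) tvec \<Rightarrow> ('a, 'e) tvec" where
  "tvec_comb a u b w = (\<lambda>c. a *\<^sub>R u c + b *\<^sub>R w c)"

definition differential ::
    "('a, 'e::real_normed_vector) chart set \<Rightarrow> ('a \<Rightarrow> real) \<Rightarrow> 'a \<Rightarrow> ('a, 'e) tvec \<Rightarrow> real" where
  "differential A f p v =
     (let c = chart_at A p in frechet_derivative (f \<circ> chart_inv c) (at (coords c p)) (v c))"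

definition tangent_map ::
    "('a, 'e::real_normed_vector) chart set \<Rightarrow> ('a \<Rightarrow> 'a) \<Rightarrow> 'a \<Rightarrow> ('a, 'e) tvec \<Rightarrow> ('a, 'e) tvec" where
  "tangent_map A F p v =
     (let c = chart_at A p in
      (\<lambda>d. if d \<in> A \<and> F p \<in> chart_dom d
           then frechet_derivative (coords d \<circ> F \<circ> chart_inv c) (at (coords c p)) (v c) else 0))"


section \<open>Differential forms\<close>

text \<open>The arguments of a form of degree \<open>k\<close> at a point are lists of \<open>k\<close> tangent vectors at that
  point; on all other lists it is zero.\<close>

type_synonym ('a, 'e) form = "'a \<Rightarrow> ('a, 'e) tvec list \<Rightarrow> real"

definition tangent_lists ::
    "('a, 'e::real_normed_vector) chart set \<Rightarrow> nat \<Rightarrow> 'a \<Rightarrow> ('a, 'e) tvec list set" where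
  "tangent_lists A k p = {vs. length vs = k \<and> set vs \<subseteq> tangent_space A p}"

definition alternating ::
    "('a, 'e::real_normed_vector) chart set \<Rightarrow> nat \<Rightarrow> 'a \<Rightarrow> (('a, 'e) tvec list \<Rightarrow> real) \<Rightarrow> bool" where
  "alternating A k p \<alpha> \<longleftrightarrow>
     (\<forall>vs\<in>tangent_lists A k p. \<forall>i<k. \<forall>u\<in>tangent_space A p. \<forall>w\<in>tangent_space A p. \<forall>a b.
        \<alpha> (vs[i := tvec_comb a u b w]) = a * \<alpha> (vs[i := u]) + b * \<alpha> (vs[i := w])) \<and>
     (\<forall>vs\<in>tangent_lists A k p. \<forall>i j. i < j \<and> j < k \<and> vs ! i = vs ! j \<longrightarrow> \<alpha> vs = 0) \<and>
     (\<forall>vs. vs \<notin> tangent_lists A k p \<longrightarrow> \<alpha> vs = 0)"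

definition component ::
    "('a, 'e::real_normed_vector) chart set \<Rightarrow> ('a, 'e) chart \<Rightarrow> ('a, 'e) form \<Rightarrow> 'e list \<Rightarrow> 'e \<Rightarrow> real" where
  "component A c \<eta> es x = \<eta> (chart_inv c x) (map (coord_vec A c (chart_inv c x)) es)"

definition smooth_form ::
    "('a, 'e::real_normed_vector) chart set \<Rightarrow> nat \<Rightarrow> ('a, 'e) form \<Rightarrow> bool" where
  "smooth_form A k \<eta> \<longleftrightarrow> (\<forall>p. alternating A k p (\<eta> p)) \<and>
     (\<forall>c\<in>A. \<forall>es. length es = k \<longrightarrow> smooth_on (component A c \<eta> es) (chart_img c))"

text \<open>Vanishing of the exterior derivative of a 2-form, evaluated on constant coordinate fields.\<close>

definition closed_2form ::
    "('a, 'e::real_normed_vector) chart set \<Rightarrow> ('a, 'e) form \<Rightarrow> bool" where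
  "closed_2form A \<omega> \<longleftrightarrow> (\<forall>c\<in>A. \<forall>x\<in>chart_img c. \<forall>u v w.
       frechet_derivative (component A c \<omega> [v, w]) (at x) u
     - frechet_derivative (component A c \<omega> [u, w]) (at x) v
     + frechet_derivative (component A c \<omega> [u, v]) (at x) w = 0)"

definition nondegenerate ::
    "('a, 'e::real_normed_vector) chart set \<Rightarrow> ('a, 'e) form \<Rightarrow> bool" where
  "nondegenerate A \<omega> \<longleftrightarrow> (\<forall>p. \<forall>u\<in>tangent_space A p.
     (\<forall>v\<in>tangent_space A p. \<omega> p [u, v] = 0) \<longrightarrow> u = (\<lambda>_. 0))"

definition symplectic_form ::
    "('a, 'e::real_normed_vector) chart set \<Rightarrow> ('a, 'e) form \<Rightarrow> bool" where
  "symplectic_form A \<omega> \<longleftrightarrow> smooth_form A 2 \<omega> \<and> closed_2form A \<omega> \<and> nondegenerate A \<omega>"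

text \<open>The \<open>n\<close>-fold wedge product of a 2-form with itself, with the convention that
  \<open>(\<alpha> \<and> \<beta>)(v\<^sub>1, \<dots>, v\<^sub>k\<^sub>+\<^sub>l)\<close> carries the factor \<open>1 / (k! l!)\<close> in front of the sum over all permutations.\<close>

definition wedge_power ::
    "('a, 'e::real_normed_vector) chart set \<Rightarrow> ('a, 'e) form \<Rightarrow> nat \<Rightarrow> ('a, 'e) form" where
  "wedge_power A \<omega> n p vs =
     (if vs \<in> tangent_lists A (2 * n) p
      then (\<Sum>\<sigma> | \<sigma> permutes {..<2 * n}.
              of_int (sign \<sigma>) * (\<Prod>i<n. \<omega> p [vs ! \<sigma> (2 * i), vs ! \<sigma> (2 * i + 1)])) / 2 ^ n
      else 0)"

definition pullback ::
    "('a, 'e::real_normed_vector) chart set \<Rightarrow> nat \<Rightarrow> ('a \<Rightarrow> 'a) \<Rightarrow> ('a, 'e) form \<Rightarrow> ('a, 'e) form" where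
  "pullback A k F \<eta> p vs =
     (if vs \<in> tangent_lists A k p then \<eta> (F p) (map (tangent_map A F p) vs) else 0)"

text \<open>The function \<open>\<theta>\<close> with \<open>\<nu> = \<theta> \<mu>\<close>, for top degree forms with \<open>\<mu>\<close> nowhere zero.\<close>

definition ratio :: "('a, 'e) form \<Rightarrow> ('a, 'e) form \<Rightarrow> 'a \<Rightarrow> real" where
  "ratio \<nu> \<mu> = (THE \<theta>. \<forall>p vs. \<nu> p vs = \<theta> p * \<mu> p vs)"


section \<open>Integration of top degree forms\<close>

definition coord_frame :: "(real ^ 'k::{finite,wellorder}) list" where
  "coord_frame = map (\<lambda>i. axis i 1) (sorted_list_of_set (UNIV :: 'k set))"

text \<open>For a nowhere vanishing top degree form \<open>\<mu>\<close>, the Borel measure of integration against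
  \<open>\<mu>\<close>, where the manifold carries the orientation defined by \<open>\<mu>\<close> itself. It is the unique
  Borel measure that has in each chart the density given by the absolute value of the
  component of \<open>\<mu>\<close>.\<close>

definition vol_measure ::
    "('a::topological_space, real ^ 'k::{finite,wellorder}) chart set \<Rightarrow>
     ('a, real ^ 'k::_) form \<Rightarrow> 'a measure" where
  "vol_measure A \<mu> = (THE m. sets m = sets borel \<and>
     (\<forall>c\<in>A. \<forall>B\<in>sets borel. B \<subseteq> chart_dom c \<longrightarrow>
        emeasure m B =
          (\<integral>\<^sup>+ x \<in> coords c ` B. ennreal \<bar>component A c \<mu> coord_frame x\<bar> \<partial>lborel)))"

definition form_integral ::
    "('a::topological_space, real ^ 'k::{finite,wellorder}) chart set \<Rightarrow>
     ('a, real ^ 'k::_) form \<Rightarrow> ('a, real ^ 'k::_) form \<Rightarrow> real" where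
  "form_integral A \<mu> \<eta> = integral\<^sup>L (vol_measure A \<mu>) (ratio \<eta> \<mu>)"


section \<open>Hamiltonian vector fields, Poisson bracket, Hamiltonian diffeomorphisms\<close>

text \<open>Sign convention: \<open>\<omega>(X\<^sub>f, \<cdot>) = df\<close> and \<open>{f, g} = \<omega>(X\<^sub>f, X\<^sub>g)\<close>.\<close>

definition ham_field ::
    "('a, 'e::real_normed_vector) chart set \<Rightarrow> ('a, 'e) form \<Rightarrow> ('a \<Rightarrow> real) \<Rightarrow> 'a \<Rightarrow> ('a, 'e) tvec" where
  "ham_field A \<omega> f p = (THE u. u \<in> tangent_space A p \<and>
     (\<forall>v\<in>tangent_space A p. \<omega> p [u, v] = differential A f p v))"

definition poisson_bracket ::
    "('a, 'e::real_normed_vector) chart set \<Rightarrow> ('a, 'e) form \<Rightarrow>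
     ('a \<Rightarrow> real) \<Rightarrow> ('a \<Rightarrow> real) \<Rightarrow> 'a \<Rightarrow> real" where
  "poisson_bracket A \<omega> f g p = \<omega> p [ham_field A \<omega> f p, ham_field A \<omega> g p]"

definition is_flow ::
    "('a::topological_space, 'e::real_normed_vector) chart set \<Rightarrow>
     ('a \<Rightarrow> ('a, 'e) tvec) \<Rightarrow> (real \<Rightarrow> 'a \<Rightarrow> 'a) \<Rightarrow> bool" where
  "is_flow A X \<phi> \<longleftrightarrow>
     (\<forall>p. \<phi> 0 p = p) \<and> (\<forall>s t p. \<phi> (s + t) p = \<phi> s (\<phi> t p)) \<and>
     continuous_on UNIV (\<lambda>(t, p). \<phi> t p) \<and>
     (\<forall>c\<in>A. \<forall>d\<in>A. smooth_on (\<lambda>(t, x). coords d (\<phi> t (chart_inv c x)))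
        {(t, x). x \<in> chart_img c \<and> \<phi> t (chart_inv c x) \<in> chart_dom d}) \<and>
     (\<forall>t p. \<forall>c\<in>A. \<phi> t p \<in> chart_dom c \<longrightarrow>
        ((\<lambda>s. coords c (\<phi> s p)) has_vector_derivative X (\<phi> t p) c) (at t))"

inductive_set ham_group ::
    "('a::topological_space, 'e::real_normed_vector) chart set \<Rightarrow> ('a, 'e) form \<Rightarrow> ('a \<Rightarrow> 'a) set"
  for A :: "('a, 'e) chart set" and \<omega> :: "('a, 'e) form" where
  flow: "smooth_fun A f \<Longrightarrow> is_flow A (ham_field A \<omega> f) \<phi> \<Longrightarrow> \<phi> t \<in> ham_group A \<omega>"
| identity: "id \<in> ham_group A \<omega>"
| comp: "F \<in> ham_group A \<omega> \<Longrightarrow> G \<in> ham_group A \<omega> \<Longrightarrow> F \<circ> G \<in> ham_group A \<omega>"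
| inverse: "F \<in> ham_group A \<omega> \<Longrightarrow> inv F \<in> ham_group A \<omega>"


section \<open>The Poisson manifold of normalised volume forms\<close>

definition volume_form ::
    "('a, 'e::real_normed_vector) chart set \<Rightarrow> nat \<Rightarrow> ('a, 'e) form \<Rightarrow> bool" where
  "volume_form A k \<nu> \<longleftrightarrow> smooth_form A k \<nu> \<and> (\<forall>p. \<exists>vs. \<nu> p vs \<noteq> 0)"

context
  fixes A :: "('a::topological_space, real ^ 'k::{finite,wellorder}) chart set"
    and \<omega> :: "('a, real ^ 'k::_) form" and n :: nat
begin

definition Dens :: "('a, real ^ 'k::_) form set" where
  "Dens = {\<nu>. volume_form A (2 * n) \<nu> \<and> form_integral A (wedge_power A \<omega> n) \<nu> = 1}"

definition linear_functional :: "('a \<Rightarrow> real) \<Rightarrow> ('a, real ^ 'k::_) form \<Rightarrow> real" where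
  "linear_functional f \<nu> = form_integral A (wedge_power A \<omega> n) (\<lambda>p vs. f p * \<nu> p vs)"

text \<open>The generating function of a linear functional, uniquely determined by its values on
  \<open>Dens\<close>, and the bracket on linear functionals, which determines the Poisson
  structure on \<open>Dens\<close>.\<close>

definition generating_fun :: "(('a, real ^ 'k::_) form \<Rightarrow> real) \<Rightarrow> 'a \<Rightarrow> real" where
  "generating_fun F = (THE f. smooth_fun A f \<and> (\<forall>\<nu>\<in>Dens. F \<nu> = linear_functional f \<nu>))"

definition dens_bracket ::
    "(('a, real ^ 'k::_) form \<Rightarrow> real) \<Rightarrow> (('a, real ^ 'k::_) form \<Rightarrow> real) \<Rightarrow>
     ('a, real ^ 'k::_) form \<Rightarrow> real" where
  "dens_bracket F G =
     linear_functional (poisson_bracket A \<omega> (generating_fun F) (generating_fun G))"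

text \<open>The symplectic leaf of this bracket through \<open>\<nu>\<close>: the orbit of \<open>\<nu>\<close> under the
  push-forward action of the group of Hamiltonian diffeomorphisms.\<close>

definition symplectic_leaf :: "('a, real ^ 'k::_) form \<Rightarrow> ('a, real ^ 'k::_) form set" where
  "symplectic_leaf \<nu> = {pullback A (2 * n) (inv F) \<nu> | F. F \<in> ham_group A \<omega>}"

definition casimir :: "(('a, real ^ 'k::_) form \<Rightarrow> 'c) \<Rightarrow> bool" where
  "casimir C \<longleftrightarrow> (\<forall>\<nu>\<in>Dens. \<forall>\<nu>'\<in>symplectic_leaf \<nu>. C \<nu>' = C \<nu>)"

definition C_integrable :: "(real \<Rightarrow> real) \<Rightarrow> ('a, real ^ 'k::_) form \<Rightarrow> bool" where
  "C_integrable h \<nu> \<longleftrightarrow>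
     integrable (vol_measure A (wedge_power A \<omega> n)) (\<lambda>p. h (ratio \<nu> (wedge_power A \<omega> n) p))"

definition C_functional :: "(real \<Rightarrow> real) \<Rightarrow> ('a, real ^ 'k::_) form \<Rightarrow> real" where
  "C_functional h \<nu> =
     (LINT p|vol_measure A (wedge_power A \<omega> n). h (ratio \<nu> (wedge_power A \<omega> n) p))"


subsection \<open>Functional independence\<close>

text \<open>The \<open>C\<^sup>\<infinity>\<close> topology: uniform convergence on compact subsets of charts of all
  iterated partial derivatives of all components.\<close>

definition dens_topology :: "('a, real ^ 'k::_) form topology" where
  "dens_topology = topology_generated_by
     {{\<nu>\<in>Dens. \<forall>x\<in>K. \<bar>iter_deriv (component A c \<nu> es) vs x
                    - iter_deriv (component A c \<nu>\<^sub>0 es) vs x\<bar> < \<epsilon>}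
      | \<nu>\<^sub>0 c es vs K \<epsilon>.
        \<nu>\<^sub>0 \<in> Dens \<and> c \<in> A \<and> length es = 2 * n \<and> compact K \<and> K \<subseteq> chart_img c \<and> 0 < \<epsilon>}"

text \<open>The tangent space of \<open>Dens\<close> at every point.\<close>

definition dens_tangent :: "('a, real ^ 'k::_) form set" where
  "dens_tangent = {\<xi>. smooth_form A (2 * n) \<xi> \<and> form_integral A (wedge_power A \<omega> n) \<xi> = 0}"

definition has_dens_differential ::
    "(('a, real ^ 'k::_) form \<Rightarrow> real) \<Rightarrow> (('a, real ^ 'k::_) form \<Rightarrow> real) \<Rightarrow>
     ('a, real ^ 'k::_) form \<Rightarrow> bool" where
  "has_dens_differential C D \<nu> \<longleftrightarrow>
     (\<forall>\<xi>\<in>dens_tangent. \<forall>\<zeta>\<in>dens_tangent. \<forall>a b.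
        D (\<lambda>p vs. a * \<xi> p vs + b * \<zeta> p vs) = a * D \<xi> + b * D \<zeta>) \<and>
     (\<forall>\<xi>\<in>dens_tangent.
        ((\<lambda>t. C (\<lambda>p vs. \<nu> p vs + t * \<xi> p vs)) has_real_derivative D \<xi>) (at 0))"

text \<open>A family of functionals is functionally independent if for each finite subfamily the
  differentials are linearly independent on an open dense subset of \<open>Dens\<close>.\<close>

definition functionally_independent ::
    "('i \<Rightarrow> ('a, real ^ 'k::_) form \<Rightarrow> real) \<Rightarrow> 'i set \<Rightarrow> bool" where
  "functionally_independent C I \<longleftrightarrow>
     (\<forall>J. finite J \<and> J \<subseteq> I \<longrightarrow>
        (\<exists>U. openin dens_topology U \<and> dens_topology closure_of U = Dens \<and>
           (\<forall>\<nu>\<in>U. \<exists>D. (\<forall>j\<in>J. has_dens_differential (C j) (D j) \<nu>) \<and>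
              (\<forall>a. (\<forall>\<xi>\<in>dens_tangent. (\<Sum>j\<in>J. a j * D j \<xi>) = 0) \<longrightarrow> (\<forall>j\<in>J. a j = 0)))))"

end

end

theory Submission
  imports Defs
begin

text \<open>A Hamiltonian flow preserves \<open>\<omega>\<close>: in charts, the derivative of \<open>\<omega>(T\<phi>\<^sub>t u, T\<phi>\<^sub>t w)\<close> in \<open>t\<close>
  vanishes by the closedness of \<open>\<omega>\<close> and the symmetry of the second derivatives of the Hamiltonian.
  Hence every Hamiltonian diffeomorphism \<open>G\<close> preserves \<open>\<omega>\<^sup>n\<close> and the measure defined by it, and
  \<open>G\<^sup>*(\<theta> \<omega>\<^sup>n) = (\<theta> \<circ> G) \<omega>\<^sup>n\<close>, so that \<open>\<integral> h(\<theta>) \<omega>\<^sup>n\<close> is constant on orbits; \<open>h\<close> need not be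
  measurable because \<open>G\<close> is an isomorphism of measure spaces.

  The functionals for the powers \<open>h(x) = x\<^sup>j\<^sup>+\<^sup>2\<close> are functionally independent: if their
  differentials at \<open>\<theta> \<omega>\<^sup>n\<close> satisfy a linear relation, then a nonzero polynomial in \<open>\<theta>\<close> is constant, so
  \<open>\<theta>\<close> takes at most as many values as the degree allows. The densities with more values than that form
  an open set, which is dense because a bump function can be added to \<open>\<theta>\<close>.\<close>

section \<open>Calculus of smooth maps\<close>

text \<open>Three objects of the argument, \<open>ham_field\<close>, \<open>ratio\<close> and
  \<open>vol_measure\<close>, are given by description operators. Nothing can be said of them before
  unique existence is known, and this shapes the first half of the development. For
  \<open>ham_field\<close> it is nondegeneracy in finite dimension. For \<open>ratio\<close> it is
  the uniqueness of the determinant together with the nonvanishing of the top power of \<omega>,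
  which is read off in a symplectic basis, where the permutation sum has no negative terms. For
  \<open>vol_measure\<close> it is the change of variables formula, which makes the chart densities
  agree on the overlaps of a finite cover. The same formula, for a diffeomorphism that preserves the
  form instead of a change of charts, gives the invariance of the measure. The exponents of the
  Casimirs start at two because the integrals of \<theta> to the powers zero and one are constant on
  the normalised densities, so that their differentials vanish.\<close>

lemma frechet_derivative_cong_open:
  assumes "open S" "x \<in> S" "\<And>y. y \<in> S \<Longrightarrow> f y = g y"
  shows "frechet_derivative f (at x) = frechet_derivative g (at x)"
proof -
  \<comment> \<open>Both functions have the same derivatives, so the choice operator behind
    \<open>frechet_derivative\<close> returns the same map even where neither function is
    differentiable.\<close>
  have "(f has_derivative F) (at x) \<longleftrightarrow> (g has_derivative F) (at x)" for F
    using assms has_derivative_transform_within_open[of f F x UNIV S g]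
      has_derivative_transform_within_open[of g F x UNIV S f] by auto
  then show ?thesis
    unfolding frechet_derivative_def by presburger
qed

lemma differentiable_cong_open:
  assumes "open S" "x \<in> S" "\<And>y. y \<in> S \<Longrightarrow> f y = g y" "f differentiable (at x)"
  shows "g differentiable (at x)"
  using assms has_derivative_transform_within_open[of f _ x UNIV S g]
  unfolding differentiable_def by blast

lemma Ck_on_cong:
  assumes "open S" "\<And>y. y \<in> S \<Longrightarrow> f y = g y" "Ck_on k f S"
  shows "Ck_on k g S"
  using assms(2,3)
proof (induction k arbitrary: f g)
  case 0
  then show ?case by (auto cong: continuous_on_cong)
next
  case (Suc k)
  show ?case
  proof (simp, intro conjI ballI allI)
    fix x assume "x \<in> S"
    then show "g differentiable (at x)"
      using differentiable_cong_open[OF assms(1) _ Suc.prems(1), of x] Suc.prems(2) by simp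
  next
    fix v
    show "Ck_on k (\<lambda>x. frechet_derivative g (at x) v) S"
      by (rule Suc.IH[of "\<lambda>x. frechet_derivative f (at x) v"])
        (use Suc.prems frechet_derivative_cong_open[OF assms(1), of _ f g] in \<open>simp_all\<close>)
  qed
qed

lemma smooth_on_cong:
  assumes "open S" "\<And>y. y \<in> S \<Longrightarrow> f y = g y" "smooth_on f S"
  shows "smooth_on g S"
  using assms Ck_on_cong unfolding smooth_on_def by metis

text \<open>\<open>Ck_on\<close> asks for derivatives at full neighbourhoods, so openness matters
  only for the continuity at the bottom of the recursion.\<close>

lemma Ck_on_Un:
  "open S \<Longrightarrow> open T \<Longrightarrow> Ck_on k f S \<Longrightarrow> Ck_on k f T \<Longrightarrow> Ck_on k f (S \<union> T)"
  by (induction k arbitrary: f) (auto intro: continuous_on_open_Un)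

lemma smooth_on_Un:
  "open S \<Longrightarrow> open T \<Longrightarrow> smooth_on f S \<Longrightarrow> smooth_on f T \<Longrightarrow> smooth_on f (S \<union> T)"
  using Ck_on_Un unfolding smooth_on_def by metis

lemma Ck_on_continuous: "Ck_on k f S \<Longrightarrow> continuous_on S f"
  by (cases k) (auto intro!: differentiable_imp_continuous_on
      simp: differentiable_on_def differentiable_at_withinI)

lemma Ck_on_Suc_lower: "Ck_on (Suc k) f S \<Longrightarrow> Ck_on k f S"
proof (induction k arbitrary: f)
  case 0
  then show ?case using Ck_on_continuous[of "Suc 0"] by auto
next
  case (Suc k)
  show ?case using Suc.prems Suc.IH by simp
qed

lemma smooth_on_continuous: "smooth_on f S \<Longrightarrow> continuous_on S f"
  using Ck_on_continuous unfolding smooth_on_def by metis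

lemma smooth_on_differentiable: "smooth_on f S \<Longrightarrow> x \<in> S \<Longrightarrow> f differentiable (at x)"
  unfolding smooth_on_def using Ck_on.simps(2)[of 0] by blast

lemma smooth_on_derivative: "smooth_on f S \<Longrightarrow> smooth_on (\<lambda>x. frechet_derivative f (at x) v) S"
  unfolding smooth_on_def using Ck_on.simps(2) by blast

lemma Ck_on_const: "Ck_on k (\<lambda>_. c) S"
  by (induction k arbitrary: c) auto

lemma smooth_on_const: "smooth_on (\<lambda>_. c) S"
  unfolding smooth_on_def by (simp add: Ck_on_const)

lemma frechet_derivative_plus_eq:
  assumes "f differentiable (at x)" "g differentiable (at x)"
  shows "frechet_derivative (\<lambda>x. f x + g x) (at x) v =
    frechet_derivative f (at x) v + frechet_derivative g (at x) v"
  by (simp add: frechet_derivative_at[OF has_derivative_add[OF assms[unfolded frechet_derivative_works]], symmetric])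

lemma Ck_on_add:
  assumes "open S"
  shows "Ck_on k f S \<Longrightarrow> Ck_on k g S \<Longrightarrow> Ck_on k (\<lambda>x. f x + g x) S"
proof (induction k arbitrary: f g)
  case 0
  then show ?case by (auto intro: continuous_intros)
next
  case (Suc k)
  show ?case
  proof (simp, intro conjI ballI allI)
    fix x assume "x \<in> S"
    then show "(\<lambda>x. f x + g x) differentiable (at x)"
      using Suc.prems by auto
  next
    fix v
    show "Ck_on k (\<lambda>x. frechet_derivative (\<lambda>x. f x + g x) (at x) v) S"
      by (rule Ck_on_cong[OF assms _ Suc.IH[of "\<lambda>x. frechet_derivative f (at x) v"
              "\<lambda>x. frechet_derivative g (at x) v"]])
        (use Suc.prems in \<open>auto simp: frechet_derivative_plus_eq\<close>)
  qed
qed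

lemma frechet_derivative_prod_eq:
  assumes "bounded_bilinear pr" "f differentiable (at x)" "g differentiable (at x)"
  shows "(\<lambda>x. pr (f x) (g x)) differentiable (at x)"
    and "frechet_derivative (\<lambda>x. pr (f x) (g x)) (at x) v =
      pr (f x) (frechet_derivative g (at x) v) + pr (frechet_derivative f (at x) v) (g x)"
proof -
  have "((\<lambda>x. pr (f x) (g x)) has_derivative
     (\<lambda>v. pr (f x) (frechet_derivative g (at x) v) + pr (frechet_derivative f (at x) v) (g x))) (at x)"
    using assms by (intro bounded_bilinear.FDERIV) (auto simp: frechet_derivative_works)
  then show "(\<lambda>x. pr (f x) (g x)) differentiable (at x)"
    "frechet_derivative (\<lambda>x. pr (f x) (g x)) (at x) v =
      pr (f x) (frechet_derivative g (at x) v) + pr (frechet_derivative f (at x) v) (g x)"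
    by (auto simp: differentiable_def frechet_derivative_at[symmetric])
qed

text \<open>One Leibniz rule serves the product of reals and the inner product. Each summand of the
  derivative keeps one undifferentiated factor, whose order is lowered to fit the induction.\<close>

lemma Ck_on_bilinear:
  assumes "open S" "bounded_bilinear pr"
  shows "Ck_on k f S \<Longrightarrow> Ck_on k g S \<Longrightarrow> Ck_on k (\<lambda>x. pr (f x) (g x)) S"
proof (induction k arbitrary: f g)
  case 0
  then show ?case using bounded_bilinear.continuous_on[OF assms(2)] by auto
next
  case (Suc k)
  show ?case
  proof (simp, intro conjI ballI allI)
    fix x assume "x \<in> S"
    then show "(\<lambda>x. pr (f x) (g x)) differentiable (at x)"
      using Suc.prems by (intro frechet_derivative_prod_eq(1)[OF assms(2)]) simp_all
  next
    fix v
    have "Ck_on k (\<lambda>x. pr (f x) (frechet_derivative g (at x) v) + pr (frechet_derivative f (at x) v) (g x)) S"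
      using Suc.prems Ck_on_Suc_lower[OF Suc.prems(1)] Ck_on_Suc_lower[OF Suc.prems(2)]
      by (intro Ck_on_add[OF assms(1)] Suc.IH) auto
    then show "Ck_on k (\<lambda>x. frechet_derivative (\<lambda>x. pr (f x) (g x)) (at x) v) S"
      by (rule Ck_on_cong[OF assms(1), rotated])
        (use Suc.prems in \<open>auto simp: frechet_derivative_prod_eq(2)[OF assms(2)]\<close>)
  qed
qed

text \<open>The derivative of the reciprocal is a product of the derivative of \<open>f\<close> with
  the reciprocal itself, so the induction closes with the product rule.\<close>

lemma Ck_on_inverse:
  fixes f :: "'b::real_normed_vector \<Rightarrow> real"
  assumes "open S" "\<And>x. x \<in> S \<Longrightarrow> f x \<noteq> 0"
  shows "Ck_on k f S \<Longrightarrow> Ck_on k (\<lambda>x. inverse (f x)) S"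
proof (induction k)
  case 0
  then show ?case using assms(2) by (auto intro!: continuous_intros)
next
  case (Suc k)
  have d: "((\<lambda>x. inverse (f x)) has_derivative
    (\<lambda>v. - (inverse (f x) * frechet_derivative f (at x) v * inverse (f x)))) (at x)" if "x \<in> S" for x
    using that assms(2) Suc.prems by (intro Deriv.has_derivative_inverse) (auto simp: frechet_derivative_works)
  show ?case
  proof (simp, intro conjI ballI allI)
    fix x assume "x \<in> S"
    then show "(\<lambda>x. inverse (f x)) differentiable (at x)"
      using d differentiableI by blast
  next
    fix v
    have i: "Ck_on k (\<lambda>x. inverse (f x)) S"
      using Suc Ck_on_Suc_lower by blast
    have "Ck_on k (\<lambda>x. - 1 * (inverse (f x) * frechet_derivative f (at x) v * inverse (f x))) S"
      using Suc.prems i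
      by (intro Ck_on_bilinear[OF assms(1) bounded_bilinear_mult] Ck_on_const) auto
    then show "Ck_on k (\<lambda>x. frechet_derivative (\<lambda>x. inverse (f x)) (at x) v) S"
      by (rule Ck_on_cong[OF assms(1), rotated])
        (simp add: frechet_derivative_at[OF d, symmetric])
  qed
qed

lemma smooth_on_add:
  "open S \<Longrightarrow> smooth_on f S \<Longrightarrow> smooth_on g S \<Longrightarrow> smooth_on (\<lambda>x. f x + g x) S"
  unfolding smooth_on_def by (simp add: Ck_on_add)

lemma smooth_on_mult:
  fixes f g :: "'b::real_normed_vector \<Rightarrow> real"
  shows "open S \<Longrightarrow> smooth_on f S \<Longrightarrow> smooth_on g S \<Longrightarrow> smooth_on (\<lambda>x. f x * g x) S"
  unfolding smooth_on_def by (simp add: Ck_on_bilinear[OF _ bounded_bilinear_mult])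

lemma smooth_on_inner:
  "open S \<Longrightarrow> smooth_on f S \<Longrightarrow> smooth_on g S \<Longrightarrow> smooth_on (\<lambda>x. f x \<bullet> g x) S"
  unfolding smooth_on_def by (simp add: Ck_on_bilinear[OF _ bounded_bilinear_inner])

lemma smooth_on_inverse:
  fixes f :: "'b::real_normed_vector \<Rightarrow> real"
  shows "open S \<Longrightarrow> (\<And>x. x \<in> S \<Longrightarrow> f x \<noteq> 0) \<Longrightarrow> smooth_on f S \<Longrightarrow> smooth_on (\<lambda>x. inverse (f x)) S"
  unfolding smooth_on_def by (simp add: Ck_on_inverse)

lemma smooth_on_sum:
  "open S \<Longrightarrow> (\<And>i. i \<in> I \<Longrightarrow> smooth_on (f i) S) \<Longrightarrow> smooth_on (\<lambda>x. \<Sum>i\<in>I. f i x) S"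
  by (induction I rule: infinite_finite_induct) (auto intro: smooth_on_add smooth_on_const)

lemma smooth_on_prod:
  fixes f :: "'i \<Rightarrow> 'b::real_normed_vector \<Rightarrow> real"
  shows "open S \<Longrightarrow> (\<And>i. i \<in> I \<Longrightarrow> smooth_on (f i) S) \<Longrightarrow> smooth_on (\<lambda>x. \<Prod>i\<in>I. f i x) S"
  by (induction I rule: infinite_finite_induct) (auto intro: smooth_on_mult smooth_on_const)

section \<open>The flat function behind the bump functions\<close>

text \<open>The classical function exp(-1/y), extended by zero, is the case \<open>k = 0\<close>.
  The powers of \<open>1 / y\<close> are included to make the family closed under differentiation up
  to linear combinations.\<close>

definition flat :: "nat \<Rightarrow> real \<Rightarrow> real" where
  "flat k y = (if 0 < y then (1 / y) ^ k / exp (1 / y) else 0)"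

lemma flat_tendsto_0: "(flat k \<longlongrightarrow> 0) (at 0)"
proof -
  have "((\<lambda>y. (1 / y) ^ k / exp (1 / y)) \<longlongrightarrow> (0::real)) (at_right 0)"
    using filterlim_compose[OF tendsto_power_div_exp_0[of k] filterlim_inverse_at_top_right]
    by (simp add: inverse_eq_divide)
  then have r: "(flat k \<longlongrightarrow> 0) (at_right 0)"
    by (rule Lim_transform_eventually) (auto simp: flat_def eventually_at_filter)
  have l: "(flat k \<longlongrightarrow> 0) (at_left 0)"
    by (rule Lim_transform_eventually[OF tendsto_const]) (auto simp: flat_def eventually_at_filter)
  show ?thesis
    using l r filterlim_split_at by blast
qed

lemma has_real_derivative_flat:
  "(flat k has_real_derivative flat (k + 2) y - k * flat (k + 1) y) (at y)"
proof -
  consider "y > 0" | "y < 0" | "y = 0" by linarith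
  then show ?thesis
  proof cases
    case 1
    have "((\<lambda>y. (1 / y) ^ k / exp (1 / y)) has_real_derivative flat (k + 2) y - k * flat (k + 1) y) (at y)"
      using 1 by (auto intro!: derivative_eq_intros simp: flat_def field_simps power2_eq_square)
        (cases k, auto simp: field_simps)
    moreover have ev: "eventually (\<lambda>y. flat k y = (1 / y) ^ k / exp (1 / y)) (nhds y)"
      using eventually_nhds_in_open[of "{0<..}" y] 1 by (auto elim!: eventually_mono simp: flat_def)
    ultimately show ?thesis using DERIV_cong_ev[OF refl ev refl] by simp
  next
    case 2
    have ev: "eventually (\<lambda>y. flat k y = 0) (nhds y)"
      using eventually_nhds_in_open[of "{..<0}" y] 2 by (auto elim!: eventually_mono simp: flat_def)
    moreover have "((\<lambda>y. 0) has_real_derivative flat (k + 2) y - k * flat (k + 1) y) (at y)"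
      using 2 by (auto simp: flat_def)
    ultimately show ?thesis using DERIV_cong_ev[OF refl ev refl] by simp
  next
    case 3
    \<comment> \<open>At zero the difference quotient of \<open>flat k\<close> is
      \<open>flat (Suc k)\<close>, which tends to zero from both sides.\<close>
    have L: "((\<lambda>h. (flat k (0 + h) - flat k 0) / h) \<longlongrightarrow> 0) (at 0)"
      by (rule Lim_transform_eventually[OF flat_tendsto_0[of "Suc k"]])
        (simp add: flat_def eventually_at_filter)
    have z: "flat (k + 2) 0 - k * flat (k + 1) 0 = 0"
      by (simp add: flat_def)
    show ?thesis unfolding 3 z DERIV_def by (rule L)
  qed
qed

lemma Ck_on_flat:
  assumes "open S"
  shows "Ck_on m s S \<Longrightarrow> Ck_on m (\<lambda>x. flat k (s x)) S"
proof (induction m arbitrary: k)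
  case 0
  have "continuous_on UNIV (flat k)"
    using has_real_derivative_flat DERIV_continuous continuous_at_imp_continuous_on by blast
  then show ?case using 0 by (auto intro: continuous_on_compose2)
next
  case (Suc m)
  have d: "((\<lambda>x. flat k (s x)) has_derivative
     (\<lambda>v. frechet_derivative s (at x) v * (flat (k + 2) (s x) - k * flat (k + 1) (s x)))) (at x)" if "x \<in> S" for x
    using DERIV_compose_FDERIV[OF has_real_derivative_flat, of s "frechet_derivative s (at x)" x UNIV k] that Suc.prems
    by (auto simp: frechet_derivative_works)
  show ?case
  proof (simp, intro conjI ballI allI)
    fix x assume "x \<in> S"
    then show "(\<lambda>x. flat k (s x)) differentiable (at x)"
      using d differentiableI by blast
  next
    fix v
    have s: "Ck_on m s S" using Suc.prems Ck_on_Suc_lower by blast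
    have "Ck_on m (\<lambda>x. frechet_derivative s (at x) v * (flat (k + 2) (s x) + (- k) * flat (k + 1) (s x))) S"
      using Suc.prems s Suc.IH
      by (intro Ck_on_bilinear[OF assms(1) bounded_bilinear_mult] Ck_on_add[OF assms(1)] Ck_on_const) auto
    then show "Ck_on m (\<lambda>x. frechet_derivative (\<lambda>x. flat k (s x)) (at x) v) S"
      by (rule Ck_on_cong[OF assms(1), rotated])
        (simp add: frechet_derivative_at[OF d, symmetric])
  qed
qed

lemma has_vector_derivative_compose_curve:
  assumes "f differentiable (at (X t))" "(X has_vector_derivative X') (at t)"
  shows "((\<lambda>s. f (X s)) has_vector_derivative frechet_derivative f (at (X t)) X') (at t)"
  using vector_derivative_diff_chain_within[OF assms(2)
      has_derivative_at_withinI[OF assms(1)[unfolded frechet_derivative_works]]]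
  by (simp add: o_def)

section \<open>Symmetry of second derivatives\<close>

text \<open>The mean value theorem is used twice: in the direction \<open>v\<close> for the
  increment of \<open>f\<close> along \<open>h *\<^sub>R u\<close>, then in the direction
  \<open>u\<close> for the derivative along \<open>v\<close>.\<close>

lemma second_difference:
  fixes f :: "'b::real_normed_vector \<Rightarrow> real"
  assumes "0 < h" "h * (norm u + norm v) < r"
    and f1: "\<And>y. y \<in> ball x r \<Longrightarrow> f differentiable (at y)"
    and f2: "\<And>y. y \<in> ball x r \<Longrightarrow> (\<lambda>z. frechet_derivative f (at z) v) differentiable (at y)"
  obtains p where "p \<in> ball x r"
    "f (x + h *\<^sub>R u + h *\<^sub>R v) - f (x + h *\<^sub>R u) - f (x + h *\<^sub>R v) + f x =
       h\<^sup>2 * frechet_derivative (\<lambda>z. frechet_derivative f (at z) v) (at p) u"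
proof -
  have inb: "x + a *\<^sub>R u + b *\<^sub>R v \<in> ball x r" if "0 \<le> a" "a \<le> h" "0 \<le> b" "b \<le> h" for a b
  proof -
    have "norm (a *\<^sub>R u + b *\<^sub>R v) \<le> a * norm u + b * norm v"
      using that norm_triangle_ineq[of "a *\<^sub>R u" "b *\<^sub>R v"] by simp
    also have "\<dots> \<le> h * norm u + h * norm v"
      using that by (intro add_mono mult_right_mono) auto
    finally show ?thesis
      using assms(2) norm_minus_cancel[of "a *\<^sub>R u + b *\<^sub>R v"]
      by (simp add: dist_norm algebra_simps)
  qed
  let ?D = "\<lambda>z. frechet_derivative f (at z) v"
  have l: "((\<lambda>s. f (a + s *\<^sub>R v)) has_real_derivative ?D (a + s *\<^sub>R v)) (at s)"
    if "a + s *\<^sub>R v \<in> ball x r" for a s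
    unfolding has_real_derivative_iff_has_vector_derivative
    by (rule has_vector_derivative_compose_curve) (use that f1 in \<open>auto intro!: derivative_eq_intros\<close>)
  have "\<exists>s. 0 < s \<and> s < h \<and>
     (f (x + h *\<^sub>R u + h *\<^sub>R v) - f (x + h *\<^sub>R v)) - (f (x + h *\<^sub>R u + 0 *\<^sub>R v) - f (x + 0 *\<^sub>R v)) =
     (h - 0) * (?D (x + h *\<^sub>R u + s *\<^sub>R v) - ?D (x + s *\<^sub>R v))"
    using inb[of 0] inb[of h] assms(1)
    by (intro MVT2[of 0 h "\<lambda>s. f (x + h *\<^sub>R u + s *\<^sub>R v) - f (x + s *\<^sub>R v)"] DERIV_diff l) auto
  then obtain s where s: "0 < s" "s < h"
    "f (x + h *\<^sub>R u + h *\<^sub>R v) - f (x + h *\<^sub>R u) - f (x + h *\<^sub>R v) + f x =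
     h * (?D (x + h *\<^sub>R u + s *\<^sub>R v) - ?D (x + s *\<^sub>R v))"
    by (auto simp: algebra_simps)
  have l2: "((\<lambda>t. ?D (x + s *\<^sub>R v + t *\<^sub>R u)) has_real_derivative
      frechet_derivative ?D (at (x + s *\<^sub>R v + t *\<^sub>R u)) u) (at t)"
    if "x + s *\<^sub>R v + t *\<^sub>R u \<in> ball x r" for t
    unfolding has_real_derivative_iff_has_vector_derivative
    by (rule has_vector_derivative_compose_curve) (use that f2 in \<open>auto intro!: derivative_eq_intros\<close>)
  have "\<exists>t. 0 < t \<and> t < h \<and> ?D (x + s *\<^sub>R v + h *\<^sub>R u) - ?D (x + s *\<^sub>R v + 0 *\<^sub>R u) =
     (h - 0) * frechet_derivative ?D (at (x + s *\<^sub>R v + t *\<^sub>R u)) u"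
    using inb[of _ s] assms(1) s(1,2)
    by (intro MVT2[of 0 h "\<lambda>t. ?D (x + s *\<^sub>R v + t *\<^sub>R u)"] l2) (auto simp: add_ac)
  then obtain t where t: "0 < t" "t < h" "?D (x + s *\<^sub>R v + h *\<^sub>R u) - ?D (x + s *\<^sub>R v) =
     h * frechet_derivative ?D (at (x + s *\<^sub>R v + t *\<^sub>R u)) u"
    by auto
  show ?thesis
  proof (rule that)
    show "x + s *\<^sub>R v + t *\<^sub>R u \<in> ball x r"
      using inb[of t s] s t by (simp add: add_ac)
    show "f (x + h *\<^sub>R u + h *\<^sub>R v) - f (x + h *\<^sub>R u) - f (x + h *\<^sub>R v) + f x =
       h\<^sup>2 * frechet_derivative ?D (at (x + s *\<^sub>R v + t *\<^sub>R u)) u"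
      using s(3) t(3) by (simp add: power2_eq_square add_ac mult.assoc)
  qed
qed

text \<open>The second difference is symmetric in \<open>u\<close> and \<open>v\<close>, so the two
  mixed derivatives agree at two points arbitrarily close to \<open>x\<close>. Continuity carries
  the equality to \<open>x\<close>.\<close>

lemma frechet_derivative_commute_real:
  fixes f :: "'b::real_normed_vector \<Rightarrow> real"
  assumes "open S" "x \<in> S" "Ck_on (Suc (Suc 0)) f S"
  shows "frechet_derivative (\<lambda>z. frechet_derivative f (at z) u) (at x) v =
    frechet_derivative (\<lambda>z. frechet_derivative f (at z) v) (at x) u" (is "?A x = ?B x")
proof (rule ccontr)
  \<comment> \<open>Half of the assumed gap: equal values within \<open>e\<close> of both limits
    leave no room for a gap of \<open>2 * e\<close>.\<close>
  define e where "e = \<bar>?A x - ?B x\<bar> / 2"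
  assume "?A x \<noteq> ?B x"
  then have e: "e > 0" by (simp add: e_def)
  obtain r0 where r0: "r0 > 0" "ball x r0 \<subseteq> S"
    using assms openE by blast
  have "continuous_on S ?A" "continuous_on S ?B"
    using assms(3) by simp_all
  then have cont: "isCont ?A x" "isCont ?B x"
    using assms(1,2) continuous_on_eq_continuous_at by blast+
  obtain r1 where r1: "r1 > 0" "\<And>y. dist y x < r1 \<Longrightarrow> dist (?A y) (?A x) < e"
    using cont(1) e unfolding continuous_at_eps_delta by blast
  obtain r2 where r2: "r2 > 0" "\<And>y. dist y x < r2 \<Longrightarrow> dist (?B y) (?B x) < e"
    using cont(2) e unfolding continuous_at_eps_delta by blast
  define r where "r = min r0 (min r1 r2)"
  have r: "r > 0" using r0 r1 r2 by (simp add: r_def)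
  \<comment> \<open>The added one keeps the denominator positive for zero vectors and makes the
    bound by \<open>r\<close> strict.\<close>
  define h where "h = r / (norm u + norm v + 1)"
  have h: "h > 0" using r add_nonneg_pos[of "norm u + norm v" 1] by (simp add: h_def)
  have "h * (norm u + norm v) < h * (norm u + norm v + 1)" using h by simp
  also have "\<dots> = r"
    using add_nonneg_pos[of "norm u + norm v" 1] by (simp add: h_def)
  finally have hr: "h * (norm u + norm v) < r" "h * (norm v + norm u) < r"
    by (auto simp: add.commute)
  have f: "f differentiable (at y)" "(\<lambda>z. frechet_derivative f (at z) w) differentiable (at y)"
    if "y \<in> ball x r" for y w
    using that r0(2) assms(3) by (auto simp: r_def)
  obtain p where p: "p \<in> ball x r" "f (x + h *\<^sub>R u + h *\<^sub>R v) - f (x + h *\<^sub>R u) - f (x + h *\<^sub>R v) + f x = h\<^sup>2 * ?B p"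
    using second_difference[OF h hr(1) f] .
  obtain q where q: "q \<in> ball x r" "f (x + h *\<^sub>R v + h *\<^sub>R u) - f (x + h *\<^sub>R v) - f (x + h *\<^sub>R u) + f x = h\<^sup>2 * ?A q"
    using second_difference[OF h hr(2) f] .
  have "h\<^sup>2 * ?B p = h\<^sup>2 * ?A q"
    using p(2) q(2) by (simp add: algebra_simps)
  then have "?B p = ?A q" using h by simp
  moreover have "dist (?B p) (?B x) < e" "dist (?A q) (?A x) < e"
    using p(1) q(1) r1(2)[of q] r2(2)[of p] by (auto simp: r_def dist_commute)
  ultimately show False by (simp add: e_def dist_real_def) argo
qed

lemma frechet_derivative_inner_eq:
  assumes "f differentiable (at x)"
  shows "frechet_derivative (\<lambda>x. f x \<bullet> b) (at x) v = frechet_derivative f (at x) v \<bullet> b"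
  using frechet_derivative_prod_eq(2)[OF bounded_bilinear_inner assms, of "\<lambda>_. b" v] by simp

lemma frechet_derivative_commute:
  fixes f :: "'b::real_normed_vector \<Rightarrow> 'c::euclidean_space"
  assumes "open S" "x \<in> S" "Ck_on (Suc (Suc 0)) f S"
  shows "frechet_derivative (\<lambda>z. frechet_derivative f (at z) u) (at x) v =
    frechet_derivative (\<lambda>z. frechet_derivative f (at z) v) (at x) u"
proof (rule euclidean_eqI)
  fix b :: 'c assume "b \<in> Basis"
  have C: "Ck_on (Suc (Suc 0)) (\<lambda>x. f x \<bullet> b) S"
    using Ck_on_bilinear[OF assms(1) bounded_bilinear_inner assms(3) Ck_on_const] .
  have *: "frechet_derivative (\<lambda>z. frechet_derivative (\<lambda>x. f x \<bullet> b) (at z) u) (at x) v =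
     frechet_derivative (\<lambda>z. frechet_derivative f (at z) u) (at x) v \<bullet> b" for u v
  proof -
    have "frechet_derivative (\<lambda>z. frechet_derivative (\<lambda>x. f x \<bullet> b) (at z) u) (at x) =
       frechet_derivative (\<lambda>z. frechet_derivative f (at z) u \<bullet> b) (at x)"
      by (rule frechet_derivative_cong_open[OF assms(1,2)])
        (use assms(3) in \<open>auto simp: frechet_derivative_inner_eq\<close>)
    then show ?thesis
      using assms(2,3) by (simp add: frechet_derivative_inner_eq)
  qed
  show "frechet_derivative (\<lambda>z. frechet_derivative f (at z) u) (at x) v \<bullet> b =
    frechet_derivative (\<lambda>z. frechet_derivative f (at z) v) (at x) u \<bullet> b"
    using frechet_derivative_commute_real[OF assms(1,2) C, of u v] unfolding * .
qed

section \<open>Differentiating a bilinear form along a curve\<close>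

lemma bilinear_euclidean_expansion:
  fixes B :: "'b::euclidean_space \<Rightarrow> 'b \<Rightarrow> real"
  assumes "bilinear B"
  shows "B a b = (\<Sum>i\<in>Basis. \<Sum>j\<in>Basis. (a \<bullet> i) * (b \<bullet> j) * B i j)"
proof -
  have "B a b = B (\<Sum>i\<in>Basis. (a \<bullet> i) *\<^sub>R i) (\<Sum>j\<in>Basis. (b \<bullet> j) *\<^sub>R j)"
    by (simp add: euclidean_representation)
  also have "\<dots> = (\<Sum>(i,j)\<in>Basis \<times> Basis. B ((a \<bullet> i) *\<^sub>R i) ((b \<bullet> j) *\<^sub>R j))"
    by (rule bilinear_sum[OF assms])
  finally show ?thesis
    using assms by (simp add: sum.cartesian_product bilinear_lmul bilinear_rmul mult.assoc)
qed

text \<open>This is the product rule for three dependences on time: two moving vectors and the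
  moving base point. Expansion in the basis reduces it to products of real functions.\<close>

lemma has_real_derivative_bilinear_along_curve:
  fixes \<Omega> :: "'b::euclidean_space \<Rightarrow> 'b \<Rightarrow> 'b \<Rightarrow> real"
  assumes S: "open S" "X t \<in> S"
    and bil: "\<And>x. x \<in> S \<Longrightarrow> bilinear (\<Omega> x)"
    and diff: "\<And>a b. (\<lambda>x. \<Omega> x a b) differentiable (at (X t))"
    and X: "(X has_vector_derivative X') (at t)"
    and U: "(U has_vector_derivative U') (at t)"
    and W: "(W has_vector_derivative W') (at t)"
  shows "((\<lambda>s. \<Omega> (X s) (U s) (W s)) has_real_derivative
     \<Omega> (X t) U' (W t) + \<Omega> (X t) (U t) W' +
     frechet_derivative (\<lambda>x. \<Omega> x (U t) (W t)) (at (X t)) X') (at t)"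
proof -
  note exp = bilinear_euclidean_expansion[OF bil]
  define F where "F a b = frechet_derivative (\<lambda>x. \<Omega> x a b) (at (X t)) X'" for a b
  \<comment> \<open>Bilinearity is available on \<open>S\<close> only; by continuity the curve stays
    there near \<open>t\<close>, which is enough for a derivative.\<close>
  have "isCont X t"
    using X has_vector_derivative_continuous by blast
  then have ev: "eventually (\<lambda>s. X s \<in> S) (nhds t)"
    using S topological_tendstoD unfolding isCont_def tendsto_at_iff_tendsto_nhds by blast
  have d: "((\<lambda>s. \<Omega> (X s) i j) has_real_derivative F i j) (at t)" for i j
    unfolding F_def has_real_derivative_iff_has_vector_derivative
    by (rule has_vector_derivative_compose_curve[OF diff X])
  have comp: "((\<lambda>s. V s \<bullet> i) has_real_derivative V' \<bullet> i) (at t)" if "(V has_vector_derivative V') (at t)" for V V' i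
    unfolding has_real_derivative_iff_has_vector_derivative
    by (rule bounded_linear.has_vector_derivative[OF bounded_linear_inner_left that])
  \<comment> \<open>The derivative of the form in the base point expands in the basis like the form
    itself. This is needed to put the last term back together.\<close>
  have eF: "F a b = (\<Sum>i\<in>Basis. \<Sum>j\<in>Basis. (a \<bullet> i) * (b \<bullet> j) * F i j)" for a b
  proof -
    have "((\<lambda>s. \<Sum>i\<in>Basis. \<Sum>j\<in>Basis. (a \<bullet> i) * (b \<bullet> j) * \<Omega> (X s) i j) has_real_derivative
      (\<Sum>i\<in>Basis. \<Sum>j\<in>Basis. (a \<bullet> i) * (b \<bullet> j) * F i j)) (at t)"
      by (intro DERIV_sum DERIV_cmult d)
    moreover have "((\<lambda>s. \<Sum>i\<in>Basis. \<Sum>j\<in>Basis. (a \<bullet> i) * (b \<bullet> j) * \<Omega> (X s) i j) has_real_derivative F a b) (at t)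
      \<longleftrightarrow> ((\<lambda>s. \<Omega> (X s) a b) has_real_derivative F a b) (at t)"
      by (rule DERIV_cong_ev) (use ev exp[symmetric] in \<open>auto elim!: eventually_mono\<close>)
    ultimately show ?thesis
      using d DERIV_unique by blast
  qed
  have "((\<lambda>s. \<Sum>i\<in>Basis. \<Sum>j\<in>Basis. (U s \<bullet> i) * (W s \<bullet> j) * \<Omega> (X s) i j) has_real_derivative
     (\<Sum>i\<in>Basis. \<Sum>j\<in>Basis. ((U' \<bullet> i) * (W t \<bullet> j) + (W' \<bullet> j) * (U t \<bullet> i)) * \<Omega> (X t) i j
         + F i j * ((U t \<bullet> i) * (W t \<bullet> j)))) (at t)"
    by (intro DERIV_sum DERIV_mult d comp U W)
  also have "(\<Sum>i\<in>Basis. \<Sum>j\<in>Basis. ((U' \<bullet> i) * (W t \<bullet> j) + (W' \<bullet> j) * (U t \<bullet> i)) * \<Omega> (X t) i j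
         + F i j * ((U t \<bullet> i) * (W t \<bullet> j))) = \<Omega> (X t) U' (W t) + \<Omega> (X t) (U t) W' + F (U t) (W t)"
    unfolding exp[OF S(2), of U'] exp[OF S(2), of _ W'] eF[of "U t"]
    by (simp add: sum.distrib[symmetric] algebra_simps)
  finally have "((\<lambda>s. \<Sum>i\<in>Basis. \<Sum>j\<in>Basis. (U s \<bullet> i) * (W s \<bullet> j) * \<Omega> (X s) i j) has_real_derivative
     \<Omega> (X t) U' (W t) + \<Omega> (X t) (U t) W' + F (U t) (W t)) (at t)" .
  moreover have "((\<lambda>s. \<Sum>i\<in>Basis. \<Sum>j\<in>Basis. (U s \<bullet> i) * (W s \<bullet> j) * \<Omega> (X s) i j) has_real_derivative D) (at t)
      \<longleftrightarrow> ((\<lambda>s. \<Omega> (X s) (U s) (W s)) has_real_derivative D) (at t)" for D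
    by (rule DERIV_cong_ev) (use ev exp[symmetric] in \<open>auto elim!: eventually_mono\<close>)
  ultimately show ?thesis
    unfolding F_def by blast
qed

section \<open>Determinants and Pfaffian sums\<close>

text \<open>The alternating multilinear functions of the rows. The arguments are matrices instead of
  lists of vectors so that induction over row operations applies.\<close>

definition alternating_rows :: "(real ^ 'n ^ 'n::finite \<Rightarrow> real) \<Rightarrow> bool" where
  "alternating_rows G \<longleftrightarrow>
     (\<forall>M i a x b y. G (\<chi> k. if k = i then a *\<^sub>R x + b *\<^sub>R y else M $ k) =
        a * G (\<chi> k. if k = i then x else M $ k) + b * G (\<chi> k. if k = i then y else M $ k)) \<and>
     (\<forall>M i j. i \<noteq> j \<and> M $ i = M $ j \<longrightarrow> G M = 0)"

lemma alternating_rowsD: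
  assumes "alternating_rows G"
  shows "G (\<chi> k. if k = i then a *\<^sub>R x + b *\<^sub>R y else M $ k) =
        a * G (\<chi> k. if k = i then x else M $ k) + b * G (\<chi> k. if k = i then y else M $ k)"
    and "i \<noteq> j \<Longrightarrow> M $ i = M $ j \<Longrightarrow> G M = 0"
  using assms unfolding alternating_rows_def by blast+

text \<open>Polarisation: the value with the sum of the two rows in both places is zero, and two of
  its four terms vanish as well.\<close>

lemma alternating_rows_swap:
  assumes "alternating_rows G" "i \<noteq> j"
  shows "G (\<chi> k. M $ Transposition.transpose i j k) = - G M"
proof -
  define R where "R x y = (\<chi> k. if k = i then x else if k = j then y else M $ k)" for x y
  have L1: "G (R (a *\<^sub>R x + b *\<^sub>R y) z) = a * G (R x z) + b * G (R y z)" for a b x y z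
  proof -
    have "R u z = (\<chi> k. if k = i then u else (R 0 z) $ k)" for u
      by (auto simp: R_def vec_eq_iff)
    then show ?thesis using alternating_rowsD(1)[OF assms(1), of i a x b y "R 0 z"] by simp
  qed
  have L2: "G (R z (a *\<^sub>R x + b *\<^sub>R y)) = a * G (R z x) + b * G (R z y)" for a b x y z
  proof -
    have "R z u = (\<chi> k. if k = j then u else (R z 0) $ k)" for u
      using assms(2) by (auto simp: R_def vec_eq_iff)
    then show ?thesis using alternating_rowsD(1)[OF assms(1), of j a x b y "R z 0"] by simp
  qed
  have Z: "G (R x x) = 0" for x
    by (rule alternating_rowsD(2)[OF assms(1,2)]) (use assms(2) in \<open>auto simp: R_def\<close>)
  have "0 = G (R (1 *\<^sub>R M $ i + 1 *\<^sub>R M $ j) (1 *\<^sub>R M $ i + 1 *\<^sub>R M $ j))"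
    using Z by simp
  also have "\<dots> = G (R (M $ i) (M $ j)) + G (R (M $ j) (M $ i))"
    unfolding L1 L2 by (simp add: Z)
  finally have "G (R (M $ j) (M $ i)) = - G (R (M $ i) (M $ j))" by simp
  moreover have "R (M $ i) (M $ j) = M"
    by (auto simp: R_def vec_eq_iff)
  moreover have "R (M $ j) (M $ i) = (\<chi> k. M $ Transposition.transpose i j k)"
    by (auto simp: R_def vec_eq_iff Transposition.transpose_def)
  ultimately show ?thesis by simp
qed

lemma alternating_rows_eq_det:
  fixes M :: "real ^ 'n ^ 'n::finite"
  assumes "alternating_rows G"
  shows "G M = det M * G (mat 1)"
proof -
  \<comment> \<open>\<open>G\<close> is quantified inside the induction because the case of a column
    swap applies the hypothesis to \<open>G\<close> composed with that swap.\<close>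
  have "\<forall>G. alternating_rows G \<longrightarrow> G M = det M * G (mat 1)"
  proof (induction M rule: induct_matrix_row_operations)
    case (1 M i)
    have "G M = 0" if "alternating_rows G" for G :: "real ^ 'n ^ 'n \<Rightarrow> real"
    proof -
      have "M = (\<chi> k. if k = i then 0 *\<^sub>R 0 + 0 *\<^sub>R 0 else M $ k)"
        using 1 by (auto simp: vec_eq_iff row_def)
      then show ?thesis
        using alternating_rowsD(1)[OF that, of i 0 0 0 0 M] by simp
    qed
    then show ?case using 1 by (simp add: det_zero_row)
  next
    case (2 M)
    show ?case
    proof (intro allI impI)
      fix G :: "real ^ 'n ^ 'n \<Rightarrow> real" assume G: "alternating_rows G"
      \<comment> \<open>The rows of the identity are replaced one at a time by rows of the diagonal
        matrix; each replacement releases one diagonal entry.\<close>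
      have "G (\<chi> k. if k \<in> K then M $ k else axis k 1) = (\<Prod>k\<in>K. M $ k $ k) * G (mat 1)" for K :: "'n set"
      proof (induction K rule: infinite_finite_induct)
        case (infinite A)
        then show ?case by simp
      next
        case empty
        have "(\<chi> k. axis k 1) = (mat 1 :: real ^ 'n ^ 'n)"
          by (auto simp: vec_eq_iff mat_def axis_def)
        then show ?case by simp
      next
        case (insert i K)
        let ?N = "\<chi> k. if k \<in> K then M $ k else axis k 1"
        have "((M $ i $ i) *\<^sub>R axis i 1) $ j = M $ i $ j" for j
          using 2[of i j] by (cases "i = j") (simp_all add: axis_def)
        then have e: "(M $ i $ i) *\<^sub>R axis i 1 = M $ i"
          by (simp add: vec_eq_iff)
        have "(\<chi> k. if k \<in> insert i K then M $ k else axis k 1) =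
            (\<chi> k. if k = i then (M $ i $ i) *\<^sub>R axis i 1 + 0 *\<^sub>R 0 else ?N $ k)"
          unfolding e by (rule arg_cong[where f = vec_lambda]) auto
        also have "G \<dots> = (M $ i $ i) * G (\<chi> k. if k = i then axis i 1 else ?N $ k)"
          unfolding alternating_rowsD(1)[OF G] by simp
        also have "(\<chi> k. if k = i then axis i 1 else ?N $ k) = ?N"
          using insert(2) by (auto simp: vec_eq_iff)
        finally show ?case using insert by simp
      qed
      from this[of UNIV] show "G M = det M * G (mat 1)"
        using det_diagonal[of M] 2 by simp
    qed
  next
    case (3 M m n)
    show ?case
    proof (intro allI impI)
      fix G :: "real ^ 'n ^ 'n \<Rightarrow> real" assume G: "alternating_rows G"
      let ?C = "\<lambda>M::real^'n^'n. (\<chi> i j. M $ i $ Transposition.transpose m n j)"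
      define G' where "G' M = G (?C M)" for M
      have "alternating_rows G'"
        unfolding alternating_rows_def
      proof (intro conjI allI impI)
        fix M i a x b y
        let ?c = "\<lambda>x::real^'n. \<chi> j. x $ Transposition.transpose m n j"
        have *: "?C (\<chi> k. if k = i then u else M $ k) = (\<chi> k. if k = i then ?c u else ?C M $ k)" for u
          by (auto simp: vec_eq_iff)
        have c: "?c (a *\<^sub>R x + b *\<^sub>R y) = a *\<^sub>R ?c x + b *\<^sub>R ?c y"
          by (simp add: vec_eq_iff)
        show "G' (\<chi> k. if k = i then a *\<^sub>R x + b *\<^sub>R y else M $ k) =
          a * G' (\<chi> k. if k = i then x else M $ k) + b * G' (\<chi> k. if k = i then y else M $ k)"
          unfolding G'_def * c by (rule alternating_rowsD(1)[OF G])
      next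
        fix M :: "real^'n^'n" and i j assume "i \<noteq> j \<and> M $ i = M $ j"
        then show "G' M = 0"
          unfolding G'_def by (intro alternating_rowsD(2)[OF G, of i j]) auto
      qed
      then have "G' M = det M * G' (mat 1)" using 3 by blast
      \<comment> \<open>On the identity matrix a swap of columns is a swap of rows, and
        \<open>G\<close> changes its sign under the latter.\<close>
      moreover have "?C (mat 1) = (\<chi> k. mat 1 $ Transposition.transpose m n k)"
        by (auto simp: vec_eq_iff mat_def Transposition.transpose_def)
      then have "G' (mat 1) = - G (mat 1)"
        unfolding G'_def using alternating_rows_swap[OF G \<open>m \<noteq> n\<close>, of "mat 1"] by simp
      moreover have "det (?C M) = - det M"
        using det_permute_columns[OF permutes_swap_id[of m UNIV n], of M] \<open>m \<noteq> n\<close>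
        by (simp add: sign_swap_id)
      ultimately show "G (?C M) = det (?C M) * G (mat 1)"
        by (simp add: G'_def)
    qed
  next
    case (4 M m n c)
    show ?case
    proof (intro allI impI)
      fix G :: "real ^ 'n ^ 'n \<Rightarrow> real" assume G: "alternating_rows G"
      have "(\<chi> i. if i = m then row m M + c *\<^sub>R row n M else row i M) =
        (\<chi> i. if i = m then 1 *\<^sub>R M $ m + c *\<^sub>R M $ n else M $ i)"
        by (auto simp: vec_eq_iff row_def)
      also have "G \<dots> = G (\<chi> i. if i = m then M $ m else M $ i) + c * G (\<chi> i. if i = m then M $ n else M $ i)"
        unfolding alternating_rowsD(1)[OF G] by simp
      also have "(\<chi> i. if i = m then M $ m else M $ i) = M"
        by (auto simp: vec_eq_iff)
      also have "G (\<chi> i. if i = m then M $ n else M $ i) = 0"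
        using \<open>m \<noteq> n\<close> by (intro alternating_rowsD(2)[OF G, of m n]) auto
      finally show "G (\<chi> i. if i = m then row m M + c *\<^sub>R row n M else row i M) =
        det (\<chi> i. if i = m then row m M + c *\<^sub>R row n M else row i M) * G (mat 1)"
        using 4 G det_row_operation[OF \<open>m \<noteq> n\<close>, of M c] by (simp add: scalar_mult_eq_scaleR cong: if_cong)
    qed
  qed
  then show ?thesis using assms by blast
qed

section \<open>Pfaffian sums\<close>

text \<open>For antisymmetric \<open>B\<close> the sum of these terms over all permutations is the
  Pfaffian times \<open>2 ^ n * fact n\<close>.\<close>

definition pfaffian_term :: "nat \<Rightarrow> (nat \<Rightarrow> nat \<Rightarrow> real) \<Rightarrow> (nat \<Rightarrow> nat) \<Rightarrow> real" where
  "pfaffian_term n B \<sigma> = of_int (sign \<sigma>) * (\<Prod>i<n. B (\<sigma> (2 * i)) (\<sigma> (2 * i + 1)))"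

text \<open>The sign of the transposition cancels the sign that the antisymmetry of \<open>B\<close>
  produces in a single factor.\<close>

lemma pfaffian_term_swap_within:
  assumes "\<sigma> permutes {..<2 * n}" "i < n"
    and "\<And>a b. a < 2 * n \<Longrightarrow> b < 2 * n \<Longrightarrow> B a b = - B b a"
  shows "pfaffian_term n B (\<sigma> \<circ> Transposition.transpose (2 * i) (2 * i + 1)) = pfaffian_term n B \<sigma>"
proof -
  let ?\<tau> = "Transposition.transpose (2 * i) (2 * i + 1)"
  have "sign (\<sigma> \<circ> ?\<tau>) = - sign \<sigma>"
    using permutation_permutes[of \<sigma>] assms(1)
    by (subst sign_compose) (auto simp: permutation_swap_id sign_swap_id)
  moreover have lt: "\<sigma> (2 * i) < 2 * n" "\<sigma> (2 * i + 1) < 2 * n"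
    using assms(2) permutes_in_image[OF assms(1)] by (auto simp: lessThan_iff)
  have "(\<Prod>j<n. B ((\<sigma> \<circ> ?\<tau>) (2 * j)) ((\<sigma> \<circ> ?\<tau>) (2 * j + 1))) =
     (\<Prod>j<n. (if j = i then - 1 else 1) * B (\<sigma> (2 * j)) (\<sigma> (2 * j + 1)))"
  proof (rule prod.cong)
    fix j
    show "B ((\<sigma> \<circ> ?\<tau>) (2 * j)) ((\<sigma> \<circ> ?\<tau>) (2 * j + 1)) =
      (if j = i then - 1 else 1) * B (\<sigma> (2 * j)) (\<sigma> (2 * j + 1))"
    proof (cases "j = i")
      case True
      then show ?thesis using assms(3)[OF lt(2) lt(1)] by simp
    next
      case False
      then have "2 * j \<noteq> 2 * i" "2 * j \<noteq> 2 * i + 1" "2 * j + 1 \<noteq> 2 * i" "2 * j + 1 \<noteq> 2 * i + 1"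
        by presburger+
      then show ?thesis using False by (simp add: Transposition.transpose_def)
    qed
  qed simp
  moreover have "(\<Prod>j<n. if j = i then - 1 else (1::real)) = -1"
    using assms(2) by simp
  ultimately show ?thesis
    unfolding pfaffian_term_def prod.distrib by simp
qed

text \<open>A block swap consists of two transpositions, so it is even, and it merely reindexes the
  product.\<close>

lemma pfaffian_term_swap_blocks:
  assumes "\<sigma> permutes {..<2 * n}" "i < n" "k < n" "i \<noteq> k"
  shows "pfaffian_term n B (\<sigma> \<circ> (Transposition.transpose (2 * i) (2 * k) \<circ>
    Transposition.transpose (2 * i + 1) (2 * k + 1))) = pfaffian_term n B \<sigma>"
proof -
  let ?\<tau> = "Transposition.transpose (2 * i) (2 * k) \<circ> Transposition.transpose (2 * i + 1) (2 * k + 1)"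
  have "sign ?\<tau> = 1"
    using assms(4) by (subst sign_compose) (auto simp: permutation_swap_id sign_swap_id)
  moreover have "permutation ?\<tau>"
    by (intro permutation_compose permutation_swap_id)
  ultimately have "sign (\<sigma> \<circ> ?\<tau>) = sign \<sigma>"
    using permutation_permutes[of \<sigma>] assms(1)
    by (subst sign_compose) auto
  moreover have "(\<Prod>j<n. B ((\<sigma> \<circ> ?\<tau>) (2 * j)) ((\<sigma> \<circ> ?\<tau>) (2 * j + 1))) =
     (\<Prod>j<n. ((\<lambda>j. B (\<sigma> (2 * j)) (\<sigma> (2 * j + 1))) \<circ> Transposition.transpose i k) j)"
  proof (rule prod.cong)
    fix j
    have "?\<tau> (2 * j) = 2 * Transposition.transpose i k j"
      by (auto simp: Transposition.transpose_def)
    moreover have "?\<tau> (2 * j + 1) = 2 * Transposition.transpose i k j + 1"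
      by (auto simp: Transposition.transpose_def)
    ultimately show "B ((\<sigma> \<circ> ?\<tau>) (2 * j)) ((\<sigma> \<circ> ?\<tau>) (2 * j + 1)) =
      ((\<lambda>j. B (\<sigma> (2 * j)) (\<sigma> (2 * j + 1))) \<circ> Transposition.transpose i k) j"
      by simp
  qed simp
  moreover have "\<dots> = (\<Prod>j<n. B (\<sigma> (2 * j)) (\<sigma> (2 * j + 1)))"
    by (rule prod.permute[symmetric]) (use assms in \<open>auto intro: permutes_swap_id\<close>)
  ultimately show ?thesis
    unfolding pfaffian_term_def by simp
qed

text \<open>Swaps inside a block \<open>{2 i, 2 i + 1}\<close> and swaps of whole blocks do not change a term; they
  carry every permutation with a nonzero term to the identity.\<close>

lemma pfaffian_term_nonneg:
  assumes anti: "\<And>a b. a < 2 * n \<Longrightarrow> b < 2 * n \<Longrightarrow> B a b = - B b a"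
    and one: "\<And>i. i < n \<Longrightarrow> B (2 * i) (2 * i + 1) = 1"
    and block: "\<And>a b. a < 2 * n \<Longrightarrow> b < 2 * n \<Longrightarrow> B a b \<noteq> 0 \<Longrightarrow> a div 2 = b div 2"
    and "\<sigma> permutes {..<2 * n}"
  shows "0 \<le> pfaffian_term n B \<sigma>"
proof -
  \<comment> \<open>\<open>d\<close> counts the blocks not yet in place: the permutation is the
    identity below \<open>2 * (n - d)\<close>, and each step settles one more block.\<close>
  have "0 \<le> pfaffian_term n B \<sigma>"
    if "d \<le> n" "\<sigma> permutes {..<2 * n}" "\<And>j. j < 2 * (n - d) \<Longrightarrow> \<sigma> j = j" for d \<sigma>
    using that
  proof (induction d arbitrary: \<sigma>)
    case 0
    then have "\<sigma> = id"
      using permutes_not_in[of \<sigma> "{..<2 * n}"] by (intro ext) (metis diff_zero id_apply lessThan_iff)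
    then show ?case by (simp add: pfaffian_term_def one[simplified])
  next
    case (Suc d)
    define k where "k = n - Suc d"
    have k: "k < n" "n - d = Suc k" using Suc.prems(1) by (auto simp: k_def)
    \<comment> \<open>\<open>a\<close> is the position of the value \<open>2 * k\<close>. It becomes
      the even position of its block as \<open>\<sigma>1\<close>, and the block then moves to the
      front of the unsettled ones as \<open>\<sigma>2\<close>.\<close>
    obtain a where a: "\<sigma> a = 2 * k"
      using permutes_surj[OF Suc.prems(2)] by (metis surjD)
    have an: "a < 2 * n"
      using permutes_in_image[OF Suc.prems(2), of a] a k by simp
    have ak: "2 * k \<le> a"
      using Suc.prems(3)[of a] a unfolding k_def[symmetric] by (cases "a < 2 * k") auto
    define i where "i = a div 2"
    have i: "i < n" "k \<le> i" using an ak by (auto simp: i_def)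
    define \<sigma>1 where "\<sigma>1 = (if even a then \<sigma> else \<sigma> \<circ> Transposition.transpose (2 * i) (2 * i + 1))"
    have s1: "\<sigma>1 permutes {..<2 * n}" "pfaffian_term n B \<sigma>1 = pfaffian_term n B \<sigma>"
      using Suc.prems(2) i(1) pfaffian_term_swap_within[OF Suc.prems(2) i(1) anti]
      by (auto simp: \<sigma>1_def intro!: permutes_compose permutes_swap_id)
    have s1': "\<sigma>1 (2 * i) = 2 * k" "\<And>j. j < 2 * k \<Longrightarrow> \<sigma>1 j = j"
    proof -
      have ai: "even a \<Longrightarrow> 2 * i = a" "odd a \<Longrightarrow> 2 * i + 1 = a"
        by (auto simp: i_def)
      show "\<sigma>1 (2 * i) = 2 * k"
        using a ai by (auto simp: \<sigma>1_def)
      fix j assume j: "j < 2 * k"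
      then have "j \<noteq> 2 * i" "j \<noteq> 2 * i + 1" using i(2) by auto
      then show "\<sigma>1 j = j"
        using j Suc.prems(3) unfolding k_def[symmetric] by (auto simp: \<sigma>1_def)
    qed
    define \<sigma>2 where "\<sigma>2 = (if i = k then \<sigma>1 else \<sigma>1 \<circ> (Transposition.transpose (2 * i) (2 * k) \<circ>
        Transposition.transpose (2 * i + 1) (2 * k + 1)))"
    have s2: "\<sigma>2 permutes {..<2 * n}" "pfaffian_term n B \<sigma>2 = pfaffian_term n B \<sigma>"
      using s1 i(1) k pfaffian_term_swap_blocks[OF s1(1) i(1) k(1)]
      by (auto simp: \<sigma>2_def intro!: permutes_compose permutes_swap_id)
    have s2': "\<sigma>2 (2 * k) = 2 * k" "\<And>j. j < 2 * k \<Longrightarrow> \<sigma>2 j = j"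
      using s1' i(2) by (auto simp: \<sigma>2_def Transposition.transpose_def)
    have "0 \<le> pfaffian_term n B \<sigma>2"
    \<comment> \<open>If this factor is zero, so is the term. Otherwise \<open>block\<close> forces
      both values into one block, and injectivity fixes \<open>2 * k + 1\<close> as well.\<close>
    proof (cases "B (\<sigma>2 (2 * k)) (\<sigma>2 (2 * k + 1)) = 0")
      case True
      then have "(\<Prod>i<n. B (\<sigma>2 (2 * i)) (\<sigma>2 (2 * i + 1))) = 0"
        using k(1) by (intro prod_zero) auto
      then show ?thesis unfolding pfaffian_term_def by (simp only: mult_zero_right order_refl)
    next
      case False
      have lt: "\<sigma>2 (2 * k) < 2 * n" "\<sigma>2 (2 * k + 1) < 2 * n"
        using k(1) permutes_in_image[OF s2(1)] by (auto simp: lessThan_iff)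
      have "\<sigma>2 (2 * k + 1) div 2 = k"
        using block[OF lt False] s2'(1) by simp
      moreover have "\<sigma>2 (2 * k + 1) \<noteq> 2 * k"
        using s2'(1) permutes_inj[OF s2(1)] by (metis add_eq_self_zero inj_eq zero_neq_one)
      ultimately have e: "\<sigma>2 (2 * k + 1) = 2 * k + 1"
        by presburger
      show ?thesis
      proof (rule Suc.IH)
        fix j assume "j < 2 * (n - d)"
        then have "j < 2 * k \<or> j = 2 * k \<or> j = 2 * k + 1" using k(2) by auto
        then show "\<sigma>2 j = j" using s2' e by blast
      qed (use Suc.prems s2 in auto)
    qed
    then show ?case using s2(2) by simp
  qed
  from this[of n \<sigma>] show ?thesis using assms(4) by simp
qed

text \<open>The identity contributes one and no term is negative. For the values of a symplectic
  form on a symplectic basis this says that its top power does not vanish.\<close>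

lemma pfaffian_sum_pos:
  assumes anti: "\<And>a b. a < 2 * n \<Longrightarrow> b < 2 * n \<Longrightarrow> B a b = - B b a"
    and one: "\<And>i. i < n \<Longrightarrow> B (2 * i) (2 * i + 1) = 1"
    and block: "\<And>a b. a < 2 * n \<Longrightarrow> b < 2 * n \<Longrightarrow> B a b \<noteq> 0 \<Longrightarrow> a div 2 = b div 2"
  shows "0 < (\<Sum>\<sigma> | \<sigma> permutes {..<2 * n}. pfaffian_term n B \<sigma>)"
proof (rule sum_pos2[where i = id])
  show "finite {\<sigma>. \<sigma> permutes {..<2 * n}}" by (simp add: finite_permutations)
  show "id \<in> {\<sigma>. \<sigma> permutes {..<2 * n}}" by (simp add: permutes_id)
  show "0 < pfaffian_term n B id" by (simp add: pfaffian_term_def one[simplified])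
  show "0 \<le> pfaffian_term n B \<sigma>" if "\<sigma> \<in> {\<sigma>. \<sigma> permutes {..<2 * n}}" for \<sigma>
    using pfaffian_term_nonneg[OF assms] that by blast
qed

section \<open>Symplectic bases\<close>

text \<open>The block diagonal matrix of the standard symplectic form. Partners are placed at
  \<open>2 * i\<close> and \<open>2 * i + 1\<close> to match the pairing of arguments in
  \<open>wedge_power\<close>.\<close>

definition standard_symplectic :: "nat \<Rightarrow> nat \<Rightarrow> real" where
  "standard_symplectic i j =
     (if i div 2 = j div 2 then if i < j then 1 else if j < i then - 1 else 0 else 0)"

text \<open>Gram-Schmidt for an alternating form, two vectors at a time: \<open>w\<close> pairs to
  zero with all earlier vectors, and nondegeneracy gives it a partner, which is then corrected to
  pair to zero with the earlier vectors too.\<close>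

lemma symplectic_basis_exists:
  fixes B :: "'e::euclidean_space \<Rightarrow> 'e \<Rightarrow> real"
  assumes bil: "bilinear B" and alt: "\<And>x. B x x = 0"
    and nondeg: "\<And>x. (\<And>y. B x y = 0) \<Longrightarrow> x = 0"
    and k: "2 * k \<le> DIM('e)"
  shows "\<exists>v::nat \<Rightarrow> 'e. \<forall>i<2 * k. \<forall>j<2 * k. B (v i) (v j) = standard_symplectic i j"
  using k
proof (induction k)
  case 0
  then show ?case by simp
next
  case (Suc k)
  have anti: "B x y = - B y x" for x y
    using alt[of "x + y"] alt[of x] alt[of y] bilinear_ladd[OF bil] bilinear_radd[OF bil] by simp
  obtain v where v: "\<And>i j. i < 2 * k \<Longrightarrow> j < 2 * k \<Longrightarrow> B (v i) (v j) = standard_symplectic i j"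
    using Suc by auto
  \<comment> \<open>The inner product with \<open>b i\<close> is the pairing with
    \<open>v i\<close>, so the conditions on \<open>w\<close> become orthogonality to fewer vectors
    than the dimension.\<close>
  define b where "b i = (\<Sum>e\<in>Basis. B e (v i) *\<^sub>R e)" for i
  have b: "w \<bullet> b i = B w (v i)" for w i
  proof -
    have "B w (v i) = B (\<Sum>e\<in>Basis. (w \<bullet> e) *\<^sub>R e) (v i)"
      by (simp add: euclidean_representation)
    also have "\<dots> = (\<Sum>e\<in>Basis. (w \<bullet> e) * B e (v i))"
      using bil by (simp add: linear_sum[of "\<lambda>x. B x (v i)"] bilinear_def bilinear_lmul[OF bil])
    finally show ?thesis by (simp add: b_def inner_sum_right mult.commute)
  qed
  have "dim (b ` {..<2 * k}) \<le> card (b ` {..<2 * k})"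
    by (rule dim_le_card') simp
  also have "\<dots> \<le> 2 * k" using card_image_le[of "{..<2 * k}" b] by simp
  also have "\<dots> < DIM('e)" using Suc.prems by simp
  finally obtain w where w: "w \<noteq> 0" "\<And>y. y \<in> span (b ` {..<2 * k}) \<Longrightarrow> orthogonal w y"
    using orthogonal_to_subspace_exists by blast
  have wv: "B w (v i) = 0" if "i < 2 * k" for i
    using w(2)[of "b i"] that b by (auto simp: orthogonal_def span_base)
  obtain u0 where u0: "B w u0 \<noteq> 0" using nondeg w(1) by blast
  define u1 where "u1 = u0 /\<^sub>R B w u0"
  have wu1: "B w u1 = 1" using u0 bil by (simp add: u1_def bilinear_rmul)
  \<comment> \<open>The dual family: the partner within each pair, with the sign that makes the
    pairing of \<open>v i\<close> with \<open>v' i\<close> equal to one.\<close>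
  define v' where "v' j = (if even j then v (j + 1) else - v (j - 1))" for j
  have vv': "B (v i) (v' j) = (if i = j then 1 else 0)" if "i < 2 * k" "j < 2 * k" for i j
  proof (cases "even j")
    case True
    then have "j + 1 < 2 * k" using that(2) by presburger
    then have "B (v i) (v' j) = standard_symplectic i (j + 1)"
      using True v that(1) by (simp add: v'_def)
    then show ?thesis using True by (auto simp: standard_symplectic_def elim!: evenE)
  next
    case False
    then have "j - 1 < 2 * k" using that(2) by simp
    then have "B (v i) (v' j) = - standard_symplectic i (j - 1)"
      using False v that(1) by (simp add: v'_def bilinear_rneg[OF bil])
    then show ?thesis using False by (auto simp: standard_symplectic_def elim!: oddE)
  qed
  have wv': "B w (v' j) = 0" if "j < 2 * k" for j
  proof (cases "even j")
    case True
    then have "j + 1 < 2 * k" using that by presburger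
    then show ?thesis using True wv by (simp add: v'_def)
  next
    case False
    then show ?thesis using wv that by (simp add: v'_def bilinear_rneg[OF bil])
  qed
  \<comment> \<open>The correction removes the pairings with all \<open>v i\<close>. It consists of
    the \<open>v' j\<close>, which pair to zero with \<open>w\<close>, so the pairing of
    \<open>w\<close> with \<open>u\<close> remains one.\<close>
  define u where "u = u1 - (\<Sum>j<2 * k. B (v j) u1 *\<^sub>R v' j)"
  have Bu: "B x u = B x u1 - (\<Sum>j<2 * k. B (v j) u1 * B x (v' j))" for x
    using bil by (simp add: u_def bilinear_def linear_diff linear_sum linear_cmul)
  have vu: "B (v i) u = 0" if "i < 2 * k" for i
    using that by (simp add: Bu vv' if_distrib if_distribR cong: if_cong)
  have wu: "B w u = 1" by (simp add: Bu wu1 wv')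
  define v2 where "v2 i = (if i < 2 * k then v i else if i = 2 * k then w else u)" for i
  have main: "B (v2 i) (v2 j) = standard_symplectic i j" if "i \<le> j" "j < 2 * Suc k" for i j
  proof -
    have "j < 2 * k \<or> i < 2 * k \<and> j = 2 * k \<or> i < 2 * k \<and> j = 2 * k + 1 \<or>
      i = 2 * k \<and> j = 2 * k \<or> i = 2 * k \<and> j = 2 * k + 1 \<or> i = 2 * k + 1 \<and> j = 2 * k + 1"
      using that by arith
    then show ?thesis
      using v wv vu wu alt anti[of "v i" w] that(1)
      by (elim disjE) (auto simp: v2_def standard_symplectic_def)
  qed
  have "B (v2 i) (v2 j) = standard_symplectic i j" if "i < 2 * Suc k" "j < 2 * Suc k" for i j
  proof (cases "i \<le> j")
    case False
    then show ?thesis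
      using main[of j i] anti[of "v2 i" "v2 j"] that by (auto simp: standard_symplectic_def)
  qed (use main that in auto)
  then show ?case by blast
qed

section \<open>Tangent maps and forms in charts\<close>

text \<open>The Jacobian of \<open>F\<close> in a pair of charts. The case of the identity is
  \<open>trans_deriv\<close>, so one chain rule covers maps and changes of charts.\<close>

definition map_deriv ::
    "('a, 'e::real_normed_vector) chart \<Rightarrow> ('a, 'e) chart \<Rightarrow> ('a \<Rightarrow> 'a) \<Rightarrow> 'a \<Rightarrow> 'e \<Rightarrow> 'e" where
  "map_deriv c d F p = frechet_derivative (coords d \<circ> F \<circ> chart_inv c) (at (coords c p))"

text \<open>First derivatives suffice for tangent maps and Jacobians. Continuity is a clause of its
  own because it makes preimages of chart domains open; off such a preimage the coordinate
  expression takes arbitrary values.\<close>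

definition differentiable_map ::
    "('a::topological_space, 'e::real_normed_vector) chart set \<Rightarrow> ('a \<Rightarrow> 'a) \<Rightarrow> bool" where
  "differentiable_map A F \<longleftrightarrow> continuous_on UNIV F \<and>
     (\<forall>c\<in>A. \<forall>d\<in>A. \<forall>p\<in>chart_dom c. F p \<in> chart_dom d \<longrightarrow>
        (coords d \<circ> F \<circ> chart_inv c) differentiable (at (coords c p)))"

lemma trans_deriv_eq_map_deriv: "trans_deriv c d p = map_deriv c d id p"
  by (simp add: trans_deriv_def map_deriv_def)

locale manifold =
  fixes A :: "('a::{t2_space,second_countable_topology}, 'e::euclidean_space) chart set"
  assumes atlas: "smooth_atlas A"
begin

lemma chart_facts:
  assumes "c \<in> A"
  shows open_dom: "open (chart_dom c)"
    and open_img: "open (chart_img c)"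
    and cont_coords: "continuous_on (chart_dom c) (coords c)"
    and cont_inv: "continuous_on (chart_img c) (chart_inv c)"
    and inv_coords: "\<And>p. p \<in> chart_dom c \<Longrightarrow> chart_inv c (coords c p) = p"
    and coords_inv: "\<And>x. x \<in> chart_img c \<Longrightarrow> coords c (chart_inv c x) = x"
    and inv_in_dom: "\<And>x. x \<in> chart_img c \<Longrightarrow> chart_inv c x \<in> chart_dom c"
    and coords_in_img: "\<And>p. p \<in> chart_dom c \<Longrightarrow> coords c p \<in> chart_img c"
proof -
  have "is_chart c" using assms atlas unfolding smooth_atlas_def by blast
  then show "open (chart_dom c)" "open (chart_img c)"
    "continuous_on (chart_dom c) (coords c)" "continuous_on (chart_img c) (chart_inv c)"
    "\<And>p. p \<in> chart_dom c \<Longrightarrow> chart_inv c (coords c p) = p"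
    "\<And>x. x \<in> chart_img c \<Longrightarrow> coords c (chart_inv c x) = x"
    "\<And>x. x \<in> chart_img c \<Longrightarrow> chart_inv c x \<in> chart_dom c"
    "\<And>p. p \<in> chart_dom c \<Longrightarrow> coords c p \<in> chart_img c"
    unfolding is_chart_def homeomorphism_def by blast+
qed

lemma chart_exists: obtains c where "c \<in> A" "p \<in> chart_dom c"
  using atlas unfolding smooth_atlas_def by blast

lemma chart_at_in: "chart_at A p \<in> A" "p \<in> chart_dom (chart_at A p)"
  unfolding chart_at_def using someI_ex[of "\<lambda>c. c \<in> A \<and> p \<in> chart_dom c"] chart_exists by blast+

lemma chart_inv_vimage:
  assumes "c \<in> A"
  shows "coords c ` (chart_dom c \<inter> U) = {x \<in> chart_img c. chart_inv c x \<in> U}"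
proof (intro equalityI subsetI)
  fix x assume "x \<in> {x \<in> chart_img c. chart_inv c x \<in> U}"
  then show "x \<in> coords c ` (chart_dom c \<inter> U)"
    using coords_inv[OF assms, of x] inv_in_dom[OF assms, of x]
    by (intro image_eqI[of _ _ "chart_inv c x"]) auto
qed (auto simp: inv_coords[OF assms] coords_in_img[OF assms])

lemma open_coords_image:
  assumes "c \<in> A" "open U"
  shows "open (coords c ` (chart_dom c \<inter> U))"
proof -
  have "open (chart_img c \<inter> chart_inv c -` U)"
    using continuous_open_preimage[OF cont_inv open_img] assms by blast
  then show ?thesis
    unfolding chart_inv_vimage[OF assms(1)] by (simp add: Int_def)
qed

lemma smooth_transition:
  "c \<in> A \<Longrightarrow> d \<in> A \<Longrightarrow> smooth_on (coords d \<circ> chart_inv c) (coords c ` (chart_dom c \<inter> chart_dom d))"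
  using atlas unfolding smooth_atlas_def by blast

lemma differentiable_map_id: "differentiable_map A id"
  unfolding differentiable_map_def
proof (intro conjI ballI impI)
  fix c d p assume "c \<in> A" "d \<in> A" "p \<in> chart_dom c" "id p \<in> chart_dom d"
  then show "(coords d \<circ> id \<circ> chart_inv c) differentiable (at (coords c p))"
    using smooth_on_differentiable[OF smooth_transition] by simp
qed (simp add: id_def)

lemma map_deriv_works:
  assumes "differentiable_map A F" "c \<in> A" "d \<in> A" "p \<in> chart_dom c" "F p \<in> chart_dom d"
  shows "((coords d \<circ> F \<circ> chart_inv c) has_derivative map_deriv c d F p) (at (coords c p))"
  using assms unfolding differentiable_map_def map_deriv_def frechet_derivative_works by blast

lemma linear_map_deriv:
  assumes "differentiable_map A F" "c \<in> A" "d \<in> A" "p \<in> chart_dom c" "F p \<in> chart_dom d"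
  shows "linear (map_deriv c d F p)"
  using map_deriv_works[OF assms] has_derivative_linear by blast

text \<open>A chart \<open>d\<close> is inserted between \<open>G\<close> and \<open>H\<close>; the
  two expressions agree on the open set of points that \<open>G\<close> sends into it. The codomain
  of \<open>H\<close> is general, to cover real functions and coordinate maps.\<close>

lemma has_derivative_via_chart:
  fixes H :: "'a \<Rightarrow> 'z::real_normed_vector"
  assumes G: "differentiable_map A G" and c: "c \<in> A" "p \<in> chart_dom c" and d: "d \<in> A" "G p \<in> chart_dom d"
    and H: "((H \<circ> chart_inv d) has_derivative D) (at (coords d (G p)))"
  shows "((H \<circ> G \<circ> chart_inv c) has_derivative D \<circ> map_deriv c d G p) (at (coords c p))"
proof -
  let ?S = "coords c ` (chart_dom c \<inter> G -` chart_dom d)"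
  have "open (G -` chart_dom d)"
    using G open_dom[OF d(1)] unfolding differentiable_map_def
    by (simp add: continuous_on_open_vimage)
  then have S: "open ?S" "coords c p \<in> ?S"
    using open_coords_image[OF c(1)] c d by auto
  have "((H \<circ> chart_inv d) \<circ> (coords d \<circ> G \<circ> chart_inv c) has_derivative D \<circ> map_deriv c d G p) (at (coords c p))"
    using H inv_coords[OF c(1,2)] by (intro diff_chain_at map_deriv_works G c d) simp
  then show ?thesis
  proof (rule has_derivative_transform_within_open[OF _ S])
    fix x assume "x \<in> ?S"
    then show "((H \<circ> chart_inv d) \<circ> (coords d \<circ> G \<circ> chart_inv c)) x = (H \<circ> G \<circ> chart_inv c) x"
      using inv_coords[OF c(1)] inv_coords[OF d(1)] by auto
  qed
qed

lemma differentiable_map_comp: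
  assumes F: "differentiable_map A F" and G: "differentiable_map A G"
  shows "differentiable_map A (F \<circ> G)"
  unfolding differentiable_map_def
proof (intro conjI ballI impI)
  show "continuous_on UNIV (F \<circ> G)"
    using F G unfolding differentiable_map_def
    by (intro continuous_on_compose) (auto intro: continuous_on_subset)
  fix c e p assume *: "c \<in> A" "e \<in> A" "p \<in> chart_dom c" "(F \<circ> G) p \<in> chart_dom e"
  obtain d where d: "d \<in> A" "G p \<in> chart_dom d" by (rule chart_exists)
  have "((coords e \<circ> F) \<circ> G \<circ> chart_inv c has_derivative map_deriv d e F (G p) \<circ> map_deriv c d G p) (at (coords c p))"
    using * d by (intro has_derivative_via_chart[OF G] map_deriv_works F) auto
  then show "(coords e \<circ> (F \<circ> G) \<circ> chart_inv c) differentiable (at (coords c p))"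
    by (auto simp: o_assoc differentiable_def)
qed

lemma map_deriv_chain:
  assumes F: "differentiable_map A F" and G: "differentiable_map A G"
    and "c \<in> A" "p \<in> chart_dom c" "d \<in> A" "G p \<in> chart_dom d" "e \<in> A" "F (G p) \<in> chart_dom e"
  shows "map_deriv d e F (G p) (map_deriv c d G p v) = map_deriv c e (F \<circ> G) p v"
proof -
  have "((coords e \<circ> F) \<circ> G \<circ> chart_inv c has_derivative map_deriv d e F (G p) \<circ> map_deriv c d G p) (at (coords c p))"
    using assms by (intro has_derivative_via_chart[OF G] map_deriv_works F) auto
  then have "map_deriv d e F (G p) \<circ> map_deriv c d G p = map_deriv c e (F \<circ> G) p"
    unfolding map_deriv_def[of c e] by (simp add: o_assoc frechet_derivative_at)
  then show ?thesis by (auto simp: fun_eq_iff)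
qed

lemma trans_deriv_chain:
  assumes "c \<in> A" "d \<in> A" "e \<in> A" "p \<in> chart_dom c" "p \<in> chart_dom d" "p \<in> chart_dom e"
  shows "trans_deriv d e p (trans_deriv c d p v) = trans_deriv c e p v"
  using map_deriv_chain[OF differentiable_map_id differentiable_map_id, of c p d e v] assms
  by (simp add: trans_deriv_eq_map_deriv)

lemma trans_deriv_self:
  assumes "c \<in> A" "p \<in> chart_dom c"
  shows "trans_deriv c c p v = v"
proof -
  have "((\<lambda>x. x) has_derivative (\<lambda>x. x)) (at (coords c p))" by simp
  then have "((coords c \<circ> chart_inv c) has_derivative (\<lambda>x. x)) (at (coords c p))"
    by (rule has_derivative_transform_within_open[OF _ open_img[OF assms(1)] coords_in_img[OF assms]])
      (simp add: coords_inv[OF assms(1)])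
  then show ?thesis
    unfolding trans_deriv_def by (simp add: frechet_derivative_at[symmetric])
qed

lemma linear_trans_deriv:
  assumes "c \<in> A" "d \<in> A" "p \<in> chart_dom c" "p \<in> chart_dom d"
  shows "linear (trans_deriv c d p)"
  using linear_map_deriv[OF differentiable_map_id, of c d p] assms
  by (simp add: trans_deriv_eq_map_deriv)

lemma coord_vec_in_tangent_space:
  assumes "c \<in> A" "p \<in> chart_dom c"
  shows "coord_vec A c p e \<in> tangent_space A p"
  using assms by (auto simp: tangent_space_def coord_vec_def trans_deriv_chain)

lemma coord_vec_apply: "c \<in> A \<Longrightarrow> p \<in> chart_dom c \<Longrightarrow> coord_vec A c p e c = e"
  by (simp add: coord_vec_def trans_deriv_self)

lemma tangent_space_trans:
  "v \<in> tangent_space A p \<Longrightarrow> c \<in> A \<Longrightarrow> d \<in> A \<Longrightarrow> p \<in> chart_dom c \<Longrightarrow> p \<in> chart_dom d \<Longrightarrow>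
    v d = trans_deriv c d p (v c)"
  unfolding tangent_space_def by blast

lemma coord_vec_inverse:
  assumes "c \<in> A" "p \<in> chart_dom c" "v \<in> tangent_space A p"
  shows "coord_vec A c p (v c) = v"
proof
  fix d
  show "coord_vec A c p (v c) d = v d"
  proof (cases "d \<in> A \<and> p \<in> chart_dom d")
    case True
    then show ?thesis
      using tangent_space_trans[OF assms(3,1) _ assms(2), of d] by (simp add: coord_vec_def)
  next
    case False
    then have "v d = 0" using assms(3) unfolding tangent_space_def by blast
    then show ?thesis using False by (auto simp: coord_vec_def)
  qed
qed

lemma coord_vec_comb:
  assumes "c \<in> A" "p \<in> chart_dom c"
  shows "coord_vec A c p (a *\<^sub>R e + b *\<^sub>R f) = tvec_comb a (coord_vec A c p e) b (coord_vec A c p f)"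
proof
  fix d
  show "coord_vec A c p (a *\<^sub>R e + b *\<^sub>R f) d = tvec_comb a (coord_vec A c p e) b (coord_vec A c p f) d"
  proof (cases "d \<in> A \<and> p \<in> chart_dom d")
    case True
    then show ?thesis
      using linear_trans_deriv[OF assms(1) _ assms(2), of d]
      by (simp add: coord_vec_def tvec_comb_def linear_add linear_cmul)
  qed (auto simp: coord_vec_def tvec_comb_def)
qed

text \<open>\<open>tangent_map\<close> is defined through the chart chosen by
  \<open>chart_at\<close>. The chain rule shows that any pair of charts computes it.\<close>

lemma tangent_map_eq_coord_vec:
  assumes F: "differentiable_map A F" and c: "c \<in> A" "p \<in> chart_dom c"
    and d: "d \<in> A" "F p \<in> chart_dom d" and v: "v \<in> tangent_space A p"
  shows "tangent_map A F p v = coord_vec A d (F p) (map_deriv c d F p (v c))"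
proof
  fix e
  let ?c = "chart_at A p"
  show "tangent_map A F p v e = coord_vec A d (F p) (map_deriv c d F p (v c)) e"
  proof (cases "e \<in> A \<and> F p \<in> chart_dom e")
    case True
    have "tangent_map A F p v e = map_deriv ?c e F p (v ?c)"
      using True by (simp add: tangent_map_def Let_def map_deriv_def)
    also have "v ?c = map_deriv c ?c id p (v c)"
      using tangent_space_trans[OF v c(1) _ c(2), of ?c] chart_at_in[of p] by (simp add: trans_deriv_eq_map_deriv)
    also have "map_deriv ?c e F p (map_deriv c ?c id p (v c)) = map_deriv c e F p (v c)"
      using map_deriv_chain[OF F differentiable_map_id, of c p ?c e "v c"] True c chart_at_in[of p] by simp
    also have "\<dots> = map_deriv d e id (F p) (map_deriv c d F p (v c))"
      using map_deriv_chain[OF differentiable_map_id F, of c p d e "v c"] True c d by simp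
    finally show ?thesis
      using True by (simp add: coord_vec_def trans_deriv_eq_map_deriv)
  qed (auto simp: tangent_map_def coord_vec_def Let_def)
qed

lemma tangent_map_in_tangent_space:
  assumes "differentiable_map A F" "v \<in> tangent_space A p"
  shows "tangent_map A F p v \<in> tangent_space A (F p)"
proof -
  obtain c d where "c \<in> A" "p \<in> chart_dom c" "d \<in> A" "F p \<in> chart_dom d"
    using chart_exists by metis
  then show ?thesis
    using tangent_map_eq_coord_vec[OF assms(1), of c p d v] assms(2) coord_vec_in_tangent_space by simp
qed

lemma tangent_map_comp:
  assumes F: "differentiable_map A F" and G: "differentiable_map A G" and v: "v \<in> tangent_space A p"
  shows "tangent_map A (F \<circ> G) p v = tangent_map A F (G p) (tangent_map A G p v)"
proof -
  obtain c d e where *: "c \<in> A" "p \<in> chart_dom c" "d \<in> A" "G p \<in> chart_dom d" "e \<in> A" "F (G p) \<in> chart_dom e"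
    using chart_exists by metis
  have "tangent_map A F (G p) (tangent_map A G p v) =
      coord_vec A e (F (G p)) (map_deriv d e F (G p) (tangent_map A G p v d))"
    using * by (intro tangent_map_eq_coord_vec F tangent_map_in_tangent_space G v) auto
  also have "tangent_map A G p v d = map_deriv c d G p (v c)"
    using tangent_map_eq_coord_vec[OF G *(1-4) v] coord_vec_apply * by simp
  also have "map_deriv d e F (G p) (map_deriv c d G p (v c)) = map_deriv c e (F \<circ> G) p (v c)"
    using * by (intro map_deriv_chain F G) auto
  finally show ?thesis
    using tangent_map_eq_coord_vec[OF differentiable_map_comp[OF F G] *(1,2), of e v] * v by simp
qed

lemma tangent_map_id:
  assumes "v \<in> tangent_space A p"
  shows "tangent_map A id p v = v"
proof -
  obtain c where *: "c \<in> A" "p \<in> chart_dom c" using chart_exists by metis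
  then show ?thesis
    using tangent_map_eq_coord_vec[OF differentiable_map_id, of c p c v] assms trans_deriv_self
    by (simp add: coord_vec_inverse flip: trans_deriv_eq_map_deriv)
qed

lemma differential_in_chart:
  assumes f: "smooth_fun A f" and c: "c \<in> A" "p \<in> chart_dom c" and v: "v \<in> tangent_space A p"
  shows "differential A f p v = frechet_derivative (f \<circ> chart_inv c) (at (coords c p)) (v c)"
proof -
  let ?c = "chart_at A p"
  let ?D = "frechet_derivative (f \<circ> chart_inv ?c) (at (coords ?c p))"
  have "(f \<circ> chart_inv ?c) differentiable (at (coords ?c p))"
    using f chart_at_in[of p] coords_in_img smooth_on_differentiable unfolding smooth_fun_def by blast
  then have "((f \<circ> chart_inv ?c) has_derivative ?D) (at (coords ?c (id p)))"
    by (simp add: frechet_derivative_works)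
  then have "((f \<circ> id \<circ> chart_inv c) has_derivative ?D \<circ> map_deriv c ?c id p) (at (coords c p))"
    using chart_at_in[of p] c by (intro has_derivative_via_chart differentiable_map_id) auto
  from frechet_derivative_at[OF this]
  have "frechet_derivative (f \<circ> chart_inv c) (at (coords c p)) = ?D \<circ> map_deriv c ?c id p"
    by simp
  moreover have "v ?c = map_deriv c ?c id p (v c)"
    using tangent_space_trans[OF v c(1) _ c(2), of ?c] chart_at_in[of p] by (simp add: trans_deriv_eq_map_deriv)
  ultimately show ?thesis
    by (simp add: differential_def Let_def)
qed

lemma map_tangent_lists:
  assumes "differentiable_map A F" "vs \<in> tangent_lists A k p"
  shows "map (tangent_map A F p) vs \<in> tangent_lists A k (F p)"
  using assms tangent_map_in_tangent_space by (auto simp: tangent_lists_def)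

lemma pullback_comp:
  assumes "differentiable_map A F" "differentiable_map A G"
  shows "pullback A k (F \<circ> G) \<eta> = pullback A k G (pullback A k F \<eta>)"
proof (intro ext)
  fix p vs
  show "pullback A k (F \<circ> G) \<eta> p vs = pullback A k G (pullback A k F \<eta>) p vs"
  proof (cases "vs \<in> tangent_lists A k p")
    case True
    then have *: "map (tangent_map A (F \<circ> G) p) vs = map (tangent_map A F (G p)) (map (tangent_map A G p) vs)"
      using tangent_map_comp[OF assms] by (auto simp: tangent_lists_def)
    then show ?thesis
      using True map_tangent_lists[OF assms(2)] by (simp add: pullback_def * del: map_map)
  qed (simp add: pullback_def)
qed

text \<open>That the form is alternating includes its vanishing off the lists of tangent vectors,
  where \<open>pullback\<close> is zero by definition.\<close>

lemma pullback_id: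
  assumes "\<And>p. alternating A k p (\<eta> p)"
  shows "pullback A k id \<eta> = \<eta>"
proof (intro ext)
  fix p vs
  show "pullback A k id \<eta> p vs = \<eta> p vs"
  proof (cases "vs \<in> tangent_lists A k p")
    case True
    then have "map (tangent_map A id p) vs = vs"
      using tangent_map_id by (intro map_idI) (auto simp: tangent_lists_def)
    then show ?thesis using True by (simp add: pullback_def)
  next
    case False
    then show ?thesis using assms[of p] unfolding alternating_def pullback_def by auto
  qed
qed

text \<open>The wedge power is a polynomial in the values of \<omega> on pairs of arguments, and
  each of these values is preserved.\<close>

lemma wedge_power_pullback:
  assumes F: "differentiable_map A F" and \<omega>: "pullback A 2 F \<omega> = \<omega>"
  shows "pullback A (2 * n) F (wedge_power A \<omega> n) = wedge_power A \<omega> n"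
proof (intro ext)
  fix p vs
  show "pullback A (2 * n) F (wedge_power A \<omega> n) p vs = wedge_power A \<omega> n p vs"
  proof (cases "vs \<in> tangent_lists A (2 * n) p")
    case True
    have "\<omega> (F p) [map (tangent_map A F p) vs ! \<sigma> (2 * i), map (tangent_map A F p) vs ! \<sigma> (2 * i + 1)] =
       \<omega> p [vs ! \<sigma> (2 * i), vs ! \<sigma> (2 * i + 1)]" if "\<sigma> permutes {..<2 * n}" "i < n" for \<sigma> i
    proof -
      have lt: "\<sigma> (2 * i) < length vs" "\<sigma> (2 * i + 1) < length vs"
        using that permutes_in_image[OF that(1)] True by (auto simp: tangent_lists_def)
      have "[vs ! \<sigma> (2 * i), vs ! \<sigma> (2 * i + 1)] \<in> tangent_lists A 2 p"
        using lt True nth_mem by (fastforce simp: tangent_lists_def)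
      then have "pullback A 2 F \<omega> p [vs ! \<sigma> (2 * i), vs ! \<sigma> (2 * i + 1)] =
         \<omega> (F p) [tangent_map A F p (vs ! \<sigma> (2 * i)), tangent_map A F p (vs ! \<sigma> (2 * i + 1))]"
        by (simp add: pullback_def)
      then show ?thesis using lt \<omega> by (simp del: One_nat_def Suc_eq_plus1 add_Suc_right)
    qed
    then have "(\<Prod>i<n. \<omega> (F p) [map (tangent_map A F p) vs ! \<sigma> (2 * i), map (tangent_map A F p) vs ! \<sigma> (2 * i + 1)]) =
       (\<Prod>i<n. \<omega> p [vs ! \<sigma> (2 * i), vs ! \<sigma> (2 * i + 1)])" if "\<sigma> permutes {..<2 * n}" for \<sigma>
      using that by (intro prod.cong) auto
    then show ?thesis
      using True map_tangent_lists[OF F True] by (simp add: pullback_def wedge_power_def)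
  qed (simp add: pullback_def wedge_power_def)
qed

end

section \<open>The wedge power as a smooth alternating form\<close>

context manifold
begin

lemma alternating_2D:
  assumes "alternating A 2 p \<alpha>"
  shows "u \<in> tangent_space A p \<Longrightarrow> v \<in> tangent_space A p \<Longrightarrow> w \<in> tangent_space A p \<Longrightarrow>
      \<alpha> [tvec_comb a u b v, w] = a * \<alpha> [u, w] + b * \<alpha> [v, w]"
    and "u \<in> tangent_space A p \<Longrightarrow> v \<in> tangent_space A p \<Longrightarrow> w \<in> tangent_space A p \<Longrightarrow>
      \<alpha> [w, tvec_comb a u b v] = a * \<alpha> [w, u] + b * \<alpha> [w, v]"
    and "u \<in> tangent_space A p \<Longrightarrow> \<alpha> [u, u] = 0"
proof -
  have lin: "\<And>vs i u w a b. vs \<in> tangent_lists A 2 p \<Longrightarrow> i < 2 \<Longrightarrow> u \<in> tangent_space A p \<Longrightarrow> w \<in> tangent_space A p \<Longrightarrow>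
        \<alpha> (vs[i := tvec_comb a u b w]) = a * \<alpha> (vs[i := u]) + b * \<alpha> (vs[i := w])"
    and alt: "\<And>vs i j. vs \<in> tangent_lists A 2 p \<Longrightarrow> i < j \<Longrightarrow> j < 2 \<Longrightarrow> vs ! i = vs ! j \<Longrightarrow> \<alpha> vs = 0"
    using assms unfolding alternating_def by blast+
  have tl: "[u, v] \<in> tangent_lists A 2 p" if "u \<in> tangent_space A p" "v \<in> tangent_space A p" for u v
    using that by (simp add: tangent_lists_def)
  show "\<alpha> [tvec_comb a u b v, w] = a * \<alpha> [u, w] + b * \<alpha> [v, w]"
    if "u \<in> tangent_space A p" "v \<in> tangent_space A p" "w \<in> tangent_space A p"
    using lin[OF tl[of u w], of 0 u v a b] that by simp
  show "\<alpha> [w, tvec_comb a u b v] = a * \<alpha> [w, u] + b * \<alpha> [w, v]"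
    if "u \<in> tangent_space A p" "v \<in> tangent_space A p" "w \<in> tangent_space A p"
    using lin[OF tl[of w u], of 1 u v a b] that by simp
  show "\<alpha> [u, u] = 0" if "u \<in> tangent_space A p"
    using alt[OF tl[of u u], of 0 1] that by simp
qed

lemma bilinear_2form:
  assumes "alternating A 2 p \<alpha>" "c \<in> A" "p \<in> chart_dom c"
  shows "bilinear (\<lambda>a b. \<alpha> [coord_vec A c p a, coord_vec A c p b])"
proof -
  note t = coord_vec_in_tangent_space[OF assms(2,3)]
  note comb = coord_vec_comb[OF assms(2,3)]
  note lin = alternating_2D[OF assms(1)]
  have add: "coord_vec A c p (x + y) = tvec_comb 1 (coord_vec A c p x) 1 (coord_vec A c p y)" for x y
    using comb[of 1 x 1 y] by simp
  have cmul: "coord_vec A c p (r *\<^sub>R x) = tvec_comb r (coord_vec A c p x) 0 (coord_vec A c p x)" for r x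
    using comb[of r x 0 x] by simp
  show ?thesis
    unfolding bilinear_def by (intro conjI allI linearI) (simp_all add: add cmul lin t)
qed

text \<open>Linearity holds term by term, as each slot enters exactly one factor. For two equal
  arguments, composing every permutation with their transposition reverses all signs and keeps the
  set of terms, so the sum is its own negative.\<close>

lemma alternating_wedge_power:
  assumes "alternating A 2 p (\<omega> p)"
  shows "alternating A (2 * n) p (wedge_power A \<omega> n p)"
proof -
  define f where "f vs \<sigma> = of_int (sign \<sigma>) * (\<Prod>i<n. \<omega> p [vs ! \<sigma> (2 * i), vs ! \<sigma> (2 * i + 1)])"
    for vs and \<sigma> :: "nat \<Rightarrow> nat"
  have w: "wedge_power A \<omega> n p vs = (\<Sum>\<sigma> | \<sigma> permutes {..<2 * n}. f vs \<sigma>) / 2 ^ n"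
    if "vs \<in> tangent_lists A (2 * n) p" for vs
    using that by (simp add: wedge_power_def f_def)
  have upd: "vs[i := u] \<in> tangent_lists A (2 * n) p"
    if "vs \<in> tangent_lists A (2 * n) p" "u \<in> tangent_space A p" for vs i u
    using that by (auto simp: tangent_lists_def dest!: set_update_subset_insert[THEN subsetD])
  show ?thesis
    unfolding alternating_def
  proof (intro conjI ballI allI impI)
    fix vs i u w a b
    assume vs: "vs \<in> tangent_lists A (2 * n) p" and i: "i < 2 * n"
      and u: "u \<in> tangent_space A p" and ww: "w \<in> tangent_space A p"
    have len: "length vs = 2 * n" using vs by (simp add: tangent_lists_def)
    have comb: "tvec_comb a u b w \<in> tangent_space A p"
    proof -
      obtain c where c: "c \<in> A" "p \<in> chart_dom c" by (rule chart_exists)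
      show ?thesis
        using coord_vec_comb[OF c, of a "u c" b "w c"] coord_vec_in_tangent_space[OF c]
        by (simp add: coord_vec_inverse[OF c] u ww) (metis coord_vec_in_tangent_space[OF c])
    qed
    have "f (vs[i := tvec_comb a u b w]) \<sigma> = a * f (vs[i := u]) \<sigma> + b * f (vs[i := w]) \<sigma>"
      if s: "\<sigma> permutes {..<2 * n}" for \<sigma>
    proof -
      \<comment> \<open>The slot \<open>i\<close> is used at position \<open>m\<close> only, hence
        in factor \<open>m div 2\<close>; the parity of \<open>m\<close> tells which argument of
        \<omega> it is.\<close>
      obtain m where m: "\<sigma> m = i" using permutes_surj[OF s] by (metis surjD)
      have mn: "m < 2 * n" using permutes_in_image[OF s, of m] m i by simp
      define j where "j = m div 2"
      have j: "j < n" using mn by (simp add: j_def)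
      let ?g = "\<lambda>x k. \<omega> p [vs[i := x] ! \<sigma> (2 * k), vs[i := x] ! \<sigma> (2 * k + 1)]"
      have ne: "\<sigma> l \<noteq> i" if "l \<noteq> m" for l
        using that m permutes_inj[OF s] by (metis injD)
      have other: "?g x k = \<omega> p [vs ! \<sigma> (2 * k), vs ! \<sigma> (2 * k + 1)]" if "k \<noteq> j" for x k
      proof -
        have "2 * k \<noteq> m" "2 * k + 1 \<noteq> m" using that by (auto simp: j_def)
        then show ?thesis
          using ne[of "2 * k"] ne[of "2 * k + 1"] by (simp add: nth_list_update_neq)
      qed
      have lt: "\<sigma> l < length vs" if "l < 2 * n" for l
        using permutes_in_image[OF s, of l] that len by simp
      have mem: "vs ! \<sigma> l \<in> tangent_space A p" if "l < 2 * n" for l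
        using lt[OF that] vs nth_mem by (fastforce simp: tangent_lists_def)
      have main: "?g (tvec_comb a u b w) j = a * ?g u j + b * ?g w j"
      proof (cases "even m")
        case True
        then have e: "2 * j = m" "m + 1 < 2 * n" using mn by (auto simp: j_def)
        show ?thesis
          using alternating_2D(1)[OF assms u ww mem[OF e(2)]] ne[of "m + 1"] m i len by (simp add: e(1))
      next
        case False
        then have "2 * j + 1 = m" by (simp add: j_def)
        then have e: "2 * j + 1 = m" "2 * j < 2 * n" "2 * j \<noteq> m" using mn by auto
        show ?thesis
          unfolding e(1)
          using alternating_2D(2)[OF assms u ww mem[OF e(2)]] ne[OF e(3)] m i len by simp
      qed
      have split: "(\<Prod>k<n. ?g x k) = ?g x j * (\<Prod>k\<in>{..<n} - {j}. \<omega> p [vs ! \<sigma> (2 * k), vs ! \<sigma> (2 * k + 1)])" for x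
        using j other by (simp add: prod.remove[of "{..<n}" j])
      show ?thesis
        unfolding f_def split main by (simp add: algebra_simps)
    qed
    then have "(\<Sum>\<sigma> | \<sigma> permutes {..<2 * n}. f (vs[i := tvec_comb a u b w]) \<sigma>) =
       a * (\<Sum>\<sigma> | \<sigma> permutes {..<2 * n}. f (vs[i := u]) \<sigma>) + b * (\<Sum>\<sigma> | \<sigma> permutes {..<2 * n}. f (vs[i := w]) \<sigma>)"
      by (simp add: sum.distrib sum_distrib_left)
    then show "wedge_power A \<omega> n p (vs[i := tvec_comb a u b w]) =
      a * wedge_power A \<omega> n p (vs[i := u]) + b * wedge_power A \<omega> n p (vs[i := w])"
      by (simp add: w upd vs u ww comb add_divide_distrib)
  next
    fix vs i j
    assume vs: "vs \<in> tangent_lists A (2 * n) p" and ij: "i < j \<and> j < 2 * n \<and> vs ! i = vs ! j"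
    let ?t = "Transposition.transpose i j"
    let ?S = "\<Sum>\<sigma> | \<sigma> permutes {..<2 * n}. f vs \<sigma>"
    have t: "?t permutes {..<2 * n}" using ij by (intro permutes_swap_id) auto
    have "f vs (?t \<circ> \<sigma>) = - f vs \<sigma>" if "\<sigma> permutes {..<2 * n}" for \<sigma>
    proof -
      have "sign (?t \<circ> \<sigma>) = - sign \<sigma>"
        using that ij permutation_permutes[of \<sigma>]
        by (subst sign_compose) (auto simp: permutation_swap_id sign_swap_id)
      moreover have "vs ! ?t l = vs ! l" for l
        using ij by (auto simp: Transposition.transpose_def)
      ultimately show ?thesis by (simp add: f_def)
    qed
    then have "(\<Sum>\<sigma> | \<sigma> permutes {..<2 * n}. f vs (?t \<circ> \<sigma>)) = - ?S"
      by (simp add: sum_negf)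
    moreover have "?S = (\<Sum>\<sigma> | \<sigma> permutes {..<2 * n}. f vs (?t \<circ> \<sigma>))"
      by (rule setum_permutations_compose_left[OF t])
    ultimately have "?S = 0" by simp
    then show "wedge_power A \<omega> n p vs = 0" using w[OF vs] by simp
  next
    fix vs assume "vs \<notin> tangent_lists A (2 * n) p"
    then show "wedge_power A \<omega> n p vs = 0" by (simp add: wedge_power_def)
  qed
qed

lemma component_wedge_power:
  assumes "c \<in> A" "x \<in> chart_img c" "length es = 2 * n"
  shows "component A c (wedge_power A \<omega> n) es x =
    (\<Sum>\<sigma> | \<sigma> permutes {..<2 * n}.
       pfaffian_term n (\<lambda>i j. component A c \<omega> [es ! i, es ! j] x) \<sigma>) / 2 ^ n"
proof -
  have p: "chart_inv c x \<in> chart_dom c" using inv_in_dom assms by blast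
  have tl: "map (coord_vec A c (chart_inv c x)) es \<in> tangent_lists A (2 * n) (chart_inv c x)"
    using coord_vec_in_tangent_space[OF assms(1) p] assms(3) by (auto simp: tangent_lists_def)
  have "\<sigma> l < length es" if "\<sigma> permutes {..<2 * n}" "l < 2 * n" for \<sigma> l
    using permutes_in_image[OF that(1), of l] that assms(3) by simp
  then have "(\<Prod>i<n. \<omega> (chart_inv c x) [map (coord_vec A c (chart_inv c x)) es ! \<sigma> (2 * i),
        map (coord_vec A c (chart_inv c x)) es ! \<sigma> (2 * i + 1)]) =
      (\<Prod>i<n. component A c \<omega> [es ! \<sigma> (2 * i), es ! \<sigma> (2 * i + 1)] x)"
    if "\<sigma> permutes {..<2 * n}" for \<sigma>
    using that by (intro prod.cong) (auto simp: component_def)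
  then show ?thesis
    using tl by (simp add: component_def[of A c "wedge_power A \<omega> n"] wedge_power_def pfaffian_term_def)
qed

lemma smooth_form_wedge_power:
  assumes "smooth_form A 2 \<omega>"
  shows "smooth_form A (2 * n) (wedge_power A \<omega> n)"
  unfolding smooth_form_def
proof (intro conjI allI ballI impI)
  show "alternating A (2 * n) p (wedge_power A \<omega> n p)" for p
    using assms alternating_wedge_power unfolding smooth_form_def by blast
  fix c and es :: "'e list" assume c: "c \<in> A" and es: "length es = 2 * n"
  have "smooth_on (component A c \<omega> [a, b]) (chart_img c)" for a b
    using assms c unfolding smooth_form_def by simp
  then have "smooth_on (\<lambda>x. (\<Sum>\<sigma> | \<sigma> permutes {..<2 * n}.
       of_int (sign \<sigma>) * (\<Prod>i<n. component A c \<omega> [es ! \<sigma> (2 * i), es ! \<sigma> (2 * i + 1)] x)) * (1 / 2 ^ n)) (chart_img c)"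
    using open_img[OF c]
    by (intro smooth_on_mult smooth_on_sum smooth_on_prod smooth_on_const) auto
  then show "smooth_on (component A c (wedge_power A \<omega> n) es) (chart_img c)"
    by (rule smooth_on_cong[OF open_img[OF c], rotated])
      (simp add: component_wedge_power[OF c _ es] pfaffian_term_def)
qed

end

section \<open>Top degree forms and determinants\<close>

locale coordinate_manifold = manifold A
  for A :: "('a::{t2_space,second_countable_topology}, real ^ 'k::{finite,wellorder}) chart set"
begin

abbreviation indices :: "'k list" where
  "indices \<equiv> sorted_list_of_set UNIV"

abbreviation frame :: "('a, (real, 'k) vec) chart \<Rightarrow> 'a \<Rightarrow> ('a, (real, 'k) vec) tvec list" where
  "frame c p \<equiv> map (coord_vec A c p) coord_frame"

text \<open>A full list of tangent vectors is encoded by the matrix of its coordinates, one row per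
  vector in the order of the indices. Alternating forms thereby become alternating functions of
  matrices.\<close>

definition frame_rows :: "('a, (real, 'k) vec) chart \<Rightarrow> 'a \<Rightarrow> ((real, 'k) vec, 'k) vec \<Rightarrow> ('a, (real, 'k) vec) tvec list" where
  "frame_rows c p M = map (\<lambda>i. coord_vec A c p (M $ i)) indices"

lemma frame_eq_frame_rows: "frame c p = frame_rows c p (mat 1)"
proof -
  have "(mat 1 :: ((real, 'k) vec, 'k) vec) $ i = axis i 1" for i
    by (auto simp: vec_eq_iff mat_def axis_def)
  then show ?thesis by (simp add: coord_frame_def frame_rows_def)
qed

lemma frame_rows_in_tangent_lists:
  "c \<in> A \<Longrightarrow> p \<in> chart_dom c \<Longrightarrow> frame_rows c p M \<in> tangent_lists A CARD('k) p"
  using coord_vec_in_tangent_space[of c p] by (auto simp: frame_rows_def tangent_lists_def)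

lemma frame_in_tangent_lists:
  "c \<in> A \<Longrightarrow> p \<in> chart_dom c \<Longrightarrow> frame c p \<in> tangent_lists A CARD('k) p"
  unfolding frame_eq_frame_rows by (rule frame_rows_in_tangent_lists)

lemma index_position: obtains m where "m < CARD('k)" "indices ! m = i"
proof -
  have "i \<in> set indices" by simp
  then show ?thesis using that unfolding in_set_conv_nth by auto
qed

lemma alternating_rows_frame_rows:
  assumes "alternating A CARD('k) p \<alpha>" "c \<in> A" "p \<in> chart_dom c"
  shows "alternating_rows (\<lambda>M. \<alpha> (frame_rows c p M))"
  unfolding alternating_rows_def
proof (intro conjI allI impI)
  note t = coord_vec_in_tangent_space[OF assms(2,3)]
  note tl = frame_rows_in_tangent_lists[OF assms(2,3)]
  fix M :: "((real, 'k) vec, 'k) vec" and i a x b y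
  obtain m where m: "m < CARD('k)" "indices ! m = i" by (rule index_position)
  have upd: "frame_rows c p (\<chi> k. if k = i then u else M $ k) = (frame_rows c p M)[m := coord_vec A c p u]" for u
  proof (rule nth_equalityI)
    fix l assume "l < length (frame_rows c p (\<chi> k. if k = i then u else M $ k))"
    then have l: "l < CARD('k)" by (simp add: frame_rows_def)
    have "indices ! l = i \<longleftrightarrow> l = m"
      using m l nth_eq_iff_index_eq[of indices l m] by auto
    then show "frame_rows c p (\<chi> k. if k = i then u else M $ k) ! l =
      (frame_rows c p M)[m := coord_vec A c p u] ! l"
      using l m by (auto simp: frame_rows_def nth_list_update)
  qed (simp add: frame_rows_def)
  show "\<alpha> (frame_rows c p (\<chi> k. if k = i then a *\<^sub>R x + b *\<^sub>R y else M $ k)) =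
    a * \<alpha> (frame_rows c p (\<chi> k. if k = i then x else M $ k)) + b * \<alpha> (frame_rows c p (\<chi> k. if k = i then y else M $ k))"
    using assms(1) tl[of M] m(1) t unfolding upd coord_vec_comb[OF assms(2,3)] alternating_def by blast
next
  fix M :: "((real, 'k) vec, 'k) vec" and i j assume ij: "i \<noteq> j \<and> M $ i = M $ j"
  obtain l where l: "l < CARD('k)" "indices ! l = i" by (rule index_position)
  obtain m where m: "m < CARD('k)" "indices ! m = j" by (rule index_position)
  have "frame_rows c p M ! l = frame_rows c p M ! m"
    using l m ij by (simp add: frame_rows_def)
  moreover have "l < m \<or> m < l" using ij l m by (metis linorder_neqE_nat)
  moreover have *: "\<alpha> vs = 0" if "vs \<in> tangent_lists A CARD('k) p" "i < j" "j < CARD('k)" "vs ! i = vs ! j" for vs i j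
    using assms(1) that unfolding alternating_def by blast
  ultimately show "\<alpha> (frame_rows c p M) = 0"
    using *[OF frame_rows_in_tangent_lists[OF assms(2,3)], of l m M]
      *[OF frame_rows_in_tangent_lists[OF assms(2,3)], of m l M] l m by auto
qed

lemma top_form_frame_rows:
  assumes "alternating A CARD('k) p \<alpha>" "c \<in> A" "p \<in> chart_dom c"
  shows "\<alpha> (frame_rows c p M) = det M * \<alpha> (frame c p)"
  unfolding frame_eq_frame_rows
  by (rule alternating_rows_eq_det[OF alternating_rows_frame_rows[OF assms]])

lemma tangent_list_eq_frame_rows:
  assumes "c \<in> A" "p \<in> chart_dom c" "vs \<in> tangent_lists A CARD('k) p"
  shows "\<exists>M. vs = frame_rows c p M"
proof -
  \<comment> \<open>The position of an index in the sorted list, which inverts the enumeration of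
    the indices.\<close>
  define m where "m i = (SOME m. m < CARD('k) \<and> indices ! m = i)" for i :: 'k
  have m: "m i < CARD('k)" "indices ! m i = i" for i
    using someI_ex[of "\<lambda>m. m < CARD('k) \<and> indices ! m = i"] index_position[of i] unfolding m_def by blast+
  have ml: "m (indices ! l) = l" if "l < CARD('k)" for l
    using m[of "indices ! l"] that nth_eq_iff_index_eq[of indices "m (indices ! l)" l] by simp
  have "vs = frame_rows c p (\<chi> i. (vs ! m i) c)"
  proof (rule nth_equalityI)
    show "length vs = length (frame_rows c p (\<chi> i. (vs ! m i) c))"
      using assms(3) by (simp add: frame_rows_def tangent_lists_def)
    fix l assume "l < length vs"
    then have l: "l < CARD('k)" "vs ! l \<in> tangent_space A p"
      using assms(3) by (auto simp: tangent_lists_def)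
    then show "vs ! l = frame_rows c p (\<chi> i. (vs ! m i) c) ! l"
      using ml by (simp add: frame_rows_def coord_vec_inverse[OF assms(1,2)])
  qed
  then show ?thesis by blast
qed

text \<open>Both forms are the determinant of the coordinate matrix times their value on the frame.
  This supplies the factor that \<open>ratio\<close> describes.\<close>

lemma top_forms_proportional:
  assumes "alternating A CARD('k) p \<alpha>" "alternating A CARD('k) p \<beta>"
    and "c \<in> A" "p \<in> chart_dom c" "\<beta> (frame c p) \<noteq> 0"
  shows "\<alpha> vs = \<alpha> (frame c p) / \<beta> (frame c p) * \<beta> vs"
proof (cases "vs \<in> tangent_lists A CARD('k) p")
  case True
  then obtain M where "vs = frame_rows c p M"
    using tangent_list_eq_frame_rows assms(3,4) by blast
  then show ?thesis
    using top_form_frame_rows[OF assms(1,3,4)] top_form_frame_rows[OF assms(2,3,4)] assms(5) by simp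
next
  case False
  then show ?thesis using assms(1,2) unfolding alternating_def by simp
qed

lemma top_form_frame_nonzero:
  assumes "alternating A CARD('k) p \<alpha>" "c \<in> A" "p \<in> chart_dom c" "\<alpha> vs \<noteq> 0"
  shows "\<alpha> (frame c p) \<noteq> 0"
proof
  assume z: "\<alpha> (frame c p) = 0"
  have "vs \<in> tangent_lists A CARD('k) p"
    using assms(1,4) unfolding alternating_def by blast
  then obtain M where "vs = frame_rows c p M"
    using tangent_list_eq_frame_rows assms(2,3) by blast
  then show False using top_form_frame_rows[OF assms(1-3)] z assms(4) by simp
qed

lemma component_coord_frame: "component A c \<eta> coord_frame x = \<eta> (chart_inv c x) (frame c (chart_inv c x))"
  by (simp add: component_def)

text \<open>The tangent map takes the frame of \<open>c\<close> to a list whose coordinates in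
  \<open>d\<close> form the Jacobian. The resulting law is what the change of variables formula asks
  of the densities.\<close>

lemma component_pullback:
  assumes \<mu>: "\<And>p. alternating A CARD('k) p (\<mu> p)" and F: "differentiable_map A F"
    and inv: "pullback A CARD('k) F \<mu> = \<mu>"
    and c: "c \<in> A" "p \<in> chart_dom c" and d: "d \<in> A" "F p \<in> chart_dom d"
  shows "component A c \<mu> coord_frame (coords c p) =
    det (matrix (map_deriv c d F p)) * component A d \<mu> coord_frame (coords d (F p))"
proof -
  let ?J = "matrix (map_deriv c d F p)"
  have lin: "linear (map_deriv c d F p)" by (rule linear_map_deriv[OF F c(1) d(1) c(2) d(2)])
  \<comment> \<open>\<open>matrix\<close> stores the images of basis vectors as columns while
    \<open>frame_rows\<close> reads rows; the determinant is unaffected by the transpose.\<close>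
  have J: "map_deriv c d F p (axis i 1) = transpose ?J $ i" for i
    by (simp add: matrix_def transpose_def vec_eq_iff)
  have tl: "frame c p \<in> tangent_lists A CARD('k) p"
    by (rule frame_in_tangent_lists[OF c])
  have "tangent_map A F p (coord_vec A c p (axis i 1)) = coord_vec A d (F p) (transpose ?J $ i)" for i
    using tangent_map_eq_coord_vec[OF F c d coord_vec_in_tangent_space[OF c]] coord_vec_apply[OF c] J by simp
  then have map: "map (tangent_map A F p) (frame c p) = frame_rows d (F p) (transpose ?J)"
    by (simp add: coord_frame_def frame_rows_def)
  have "\<mu> p (frame c p) = pullback A CARD('k) F \<mu> p (frame c p)" by (simp add: inv)
  also have "\<dots> = \<mu> (F p) (map (tangent_map A F p) (frame c p))"
    using tl by (simp only: pullback_def if_True)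
  also have "\<dots> = det ?J * \<mu> (F p) (frame d (F p))"
    unfolding map using top_form_frame_rows[OF \<mu> d] by (simp add: det_transpose)
  finally show ?thesis
    using inv_coords c d by (simp add: component_coord_frame)
qed

end

section \<open>Hamiltonian flows\<close>

lemma frechet_derivative_Pair_snd:
  assumes "G differentiable (at (t, x))"
  shows "((\<lambda>y. G (t, y)) has_derivative (\<lambda>v. frechet_derivative G (at (t, x)) (0, v))) (at x)"
proof -
  have "((\<lambda>y. (t, y)) has_derivative (\<lambda>v. (0, v))) (at x)"
    by (auto intro!: derivative_eq_intros)
  from has_derivative_compose[OF this, of G] show ?thesis
    using assms by (simp add: frechet_derivative_works)
qed

lemma frechet_derivative_Pair_fst:
  assumes "G differentiable (at (t, x))"
  shows "((\<lambda>s. G (s, x)) has_vector_derivative frechet_derivative G (at (t, x)) (1, 0)) (at t)"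
proof -
  have "((\<lambda>s. (s, x)) has_vector_derivative (1, 0)) (at t)"
    by (auto intro!: derivative_eq_intros simp: has_vector_derivative_def)
  from has_vector_derivative_compose_curve[OF _ this, of G] assms show ?thesis by simp
qed

section \<open>The Liouville form and Hamiltonian vector fields\<close>

locale symplectic_manifold = coordinate_manifold A
  for A :: "('a::{t2_space,second_countable_topology}, real ^ 'k::{finite,wellorder}) chart set" +
  fixes \<omega> :: "('a, (real, 'k) vec) form" and n :: nat
  assumes compact_space: "compact (UNIV :: 'a set)"
    and dimension: "CARD('k) = 2 * n"
    and symplectic: "symplectic_form A \<omega>"
begin

lemma alternating_omega: "alternating A 2 p (\<omega> p)"
  and smooth_component_omega: "c \<in> A \<Longrightarrow> smooth_on (component A c \<omega> [a, b]) (chart_img c)"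
  using symplectic unfolding symplectic_form_def smooth_form_def by simp_all

lemma closed_omega:
  "c \<in> A \<Longrightarrow> x \<in> chart_img c \<Longrightarrow>
      frechet_derivative (component A c \<omega> [v, w]) (at x) u
     - frechet_derivative (component A c \<omega> [u, w]) (at x) v
     + frechet_derivative (component A c \<omega> [u, v]) (at x) w = 0"
  using symplectic unfolding symplectic_form_def closed_2form_def by blast

lemma bilinear_omega:
  "c \<in> A \<Longrightarrow> p \<in> chart_dom c \<Longrightarrow> bilinear (\<lambda>a b. \<omega> p [coord_vec A c p a, coord_vec A c p b])"
  by (rule bilinear_2form[OF alternating_omega])

lemma omega_self: "u \<in> tangent_space A p \<Longrightarrow> \<omega> p [u, u] = 0"
  using alternating_2D(3)[OF alternating_omega] .

lemma nondegenerate_omega: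
  assumes c: "c \<in> A" "p \<in> chart_dom c" and z: "\<And>b. \<omega> p [coord_vec A c p a, coord_vec A c p b] = 0"
  shows "a = 0"
proof -
  have "\<omega> p [coord_vec A c p a, v] = 0" if "v \<in> tangent_space A p" for v
    using z[of "v c"] coord_vec_inverse[OF c that] by simp
  then have "coord_vec A c p a = (\<lambda>_. 0)"
    using symplectic coord_vec_in_tangent_space[OF c]
    unfolding symplectic_form_def nondegenerate_def by blast
  then show ?thesis using coord_vec_apply[OF c, of a] by simp
qed

abbreviation liouville :: "('a, (real, 'k) vec) form" where
  "liouville \<equiv> wedge_power A \<omega> n"

lemma alternating_liouville: "alternating A CARD('k) p (liouville p)"
  using alternating_wedge_power[where \<omega> = \<omega> and n = n and p = p, OF alternating_omega] dimension by simp

text \<open>Nondegeneracy gives a symplectic basis at \<open>p\<close>, on which the permutation sum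
  is positive. A top form that is nonzero on some list is nonzero on the frame.\<close>

lemma liouville_frame_nonzero:
  assumes c: "c \<in> A" "p \<in> chart_dom c"
  shows "liouville p (frame c p) \<noteq> 0"
proof -
  let ?B = "\<lambda>a b. \<omega> p [coord_vec A c p a, coord_vec A c p b]"
  have "\<exists>v::nat \<Rightarrow> (real, 'k) vec. \<forall>i<2 * n. \<forall>j<2 * n. ?B (v i) (v j) = standard_symplectic i j"
    using dimension
    by (intro symplectic_basis_exists bilinear_omega[OF c] omega_self coord_vec_in_tangent_space[OF c]
        nondegenerate_omega[OF c]) auto
  then obtain v :: "nat \<Rightarrow> (real, 'k) vec" where
    v: "\<And>i j. i < 2 * n \<Longrightarrow> j < 2 * n \<Longrightarrow> ?B (v i) (v j) = standard_symplectic i j"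
    by blast
  let ?es = "map v [0..<2 * n]"
  have x: "coords c p \<in> chart_img c" "chart_inv c (coords c p) = p"
    using coords_in_img inv_coords c by auto
  have "0 < (\<Sum>\<sigma> | \<sigma> permutes {..<2 * n}. pfaffian_term n (\<lambda>i j. component A c \<omega> [?es ! i, ?es ! j] (coords c p)) \<sigma>)"
  proof (rule pfaffian_sum_pos)
    have e: "component A c \<omega> [?es ! i, ?es ! j] (coords c p) = standard_symplectic i j"
      if "i < 2 * n" "j < 2 * n" for i j
      using v that x(2) by (simp add: component_def)
    show "component A c \<omega> [?es ! a, ?es ! b] (coords c p) = - component A c \<omega> [?es ! b, ?es ! a] (coords c p)"
      if "a < 2 * n" "b < 2 * n" for a b
      unfolding e[OF that] e[OF that(2,1)] by (auto simp: standard_symplectic_def)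
    show "component A c \<omega> [?es ! (2 * i), ?es ! (2 * i + 1)] (coords c p) = 1" if "i < n" for i
      using e[of "2 * i" "2 * i + 1"] that by (simp add: standard_symplectic_def)
    show "a div 2 = b div 2" if "a < 2 * n" "b < 2 * n" "component A c \<omega> [?es ! a, ?es ! b] (coords c p) \<noteq> 0" for a b
      using that(3) unfolding e[OF that(1,2)] by (auto simp: standard_symplectic_def split: if_splits)
  qed
  then have "component A c liouville ?es (coords c p) \<noteq> 0"
    using component_wedge_power[OF c(1) x(1), of ?es n \<omega>] by simp
  then show ?thesis
    using top_form_frame_nonzero[OF alternating_liouville c] x(2) by (auto simp: component_def)
qed

text \<open>Unique existence for the description in \<open>ham_field\<close>: an injective linear
  map of a finite-dimensional space into itself is onto.\<close>

lemma ham_field_works: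
  assumes f: "smooth_fun A f"
  shows "ham_field A \<omega> f p \<in> tangent_space A p"
    and "v \<in> tangent_space A p \<Longrightarrow> \<omega> p [ham_field A \<omega> f p, v] = differential A f p v"
proof -
  obtain c where c: "c \<in> A" "p \<in> chart_dom c" by (rule chart_exists)
  note t = coord_vec_in_tangent_space[OF c]
  let ?B = "\<lambda>a b. \<omega> p [coord_vec A c p a, coord_vec A c p b]"
  note bil = bilinear_omega[OF c]
  \<comment> \<open>\<open>L a\<close> represents the functional \<open>?B a\<close> by the inner
    product; nondegeneracy is the injectivity of \<open>L\<close>.\<close>
  define L where "L a = (\<Sum>i\<in>Basis. ?B a i *\<^sub>R i)" for a
  have L: "L a \<bullet> b = ?B a b" for a b
  proof -
    have "?B a b = ?B a (\<Sum>i\<in>Basis. (b \<bullet> i) *\<^sub>R i)" by (simp add: euclidean_representation)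
    also have "\<dots> = (\<Sum>i\<in>Basis. (b \<bullet> i) * ?B a i)"
    proof -
      have lin: "linear (?B a)" using bil unfolding bilinear_def by blast
      show ?thesis by (simp add: linear_sum[OF lin] linear_cmul[OF lin])
    qed
    finally show ?thesis by (simp add: L_def inner_sum_right inner_commute[of _ b] mult.commute)
  qed
  have "linear L"
  proof (rule linearI)
    show "L (x + y) = L x + L y" for x y
      by (rule vector_eq_rdot[THEN iffD1]) (simp add: L inner_add_left bilinear_ladd[OF bil])
    show "L (r *\<^sub>R x) = r *\<^sub>R L x" for r x
      by (rule vector_eq_rdot[THEN iffD1]) (simp add: L bilinear_lmul[OF bil])
  qed
  moreover have "inj L"
    unfolding linear_injective_0[OF \<open>linear L\<close>]
  proof (intro allI impI)
    fix a assume "L a = 0"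
    then have "?B a b = 0" for b using L[of a b] by simp
    then show "a = 0" by (rule nondegenerate_omega[OF c])
  qed
  ultimately have "surj L" using linear_inj_imp_surj by blast
  let ?D = "frechet_derivative (f \<circ> chart_inv c) (at (coords c p))"
  have "(f \<circ> chart_inv c) differentiable (at (coords c p))"
    using f c coords_in_img smooth_on_differentiable unfolding smooth_fun_def by blast
  then have D: "linear ?D"
    by (rule linear_frechet_derivative)
  obtain a where a: "L a = (\<Sum>i\<in>Basis. ?D i *\<^sub>R i)"
    using surjD[OF \<open>surj L\<close>, of "\<Sum>i\<in>Basis. ?D i *\<^sub>R i"] by (elim exE) (rule that, simp)
  have "?B a b = ?D b" for b
  proof -
    have "?D b = ?D (\<Sum>i\<in>Basis. (b \<bullet> i) *\<^sub>R i)" by (simp add: euclidean_representation)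
    also have "\<dots> = (\<Sum>i\<in>Basis. (b \<bullet> i) * ?D i)"
      using D by (simp add: linear_sum linear_cmul)
    also have "\<dots> = L a \<bullet> b" by (simp add: a inner_sum_right inner_commute[of _ b] mult.commute)
    finally show ?thesis using L by simp
  qed
  then have ex: "\<omega> p [coord_vec A c p a, v] = differential A f p v" if "v \<in> tangent_space A p" for v
    using differential_in_chart[OF f c that] coord_vec_inverse[OF c that] by metis
  have "\<exists>!u. u \<in> tangent_space A p \<and> (\<forall>v\<in>tangent_space A p. \<omega> p [u, v] = differential A f p v)"
  proof (rule ex1I)
    show "coord_vec A c p a \<in> tangent_space A p \<and>
      (\<forall>v\<in>tangent_space A p. \<omega> p [coord_vec A c p a, v] = differential A f p v)"
      using t ex by blast
    fix u assume u: "u \<in> tangent_space A p \<and> (\<forall>v\<in>tangent_space A p. \<omega> p [u, v] = differential A f p v)"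
    have "?B (u c - a) b = 0" for b
      using u ex[OF t] t coord_vec_inverse[OF c] by (simp add: bilinear_lsub[OF bil])
    then have "u c - a = 0" by (rule nondegenerate_omega[OF c])
    then show "u = coord_vec A c p a" using coord_vec_inverse[OF c] u by auto
  qed
  from theI'[OF this] show "ham_field A \<omega> f p \<in> tangent_space A p"
    "v \<in> tangent_space A p \<Longrightarrow> \<omega> p [ham_field A \<omega> f p, v] = differential A f p v"
    unfolding ham_field_def by blast+
qed

end

section \<open>Flows in coordinates\<close>

context manifold
begin

text \<open>Time and position form one variable, so that time and space derivatives are derivatives
  of a single smooth map in the directions \<open>(1, 0)\<close> and \<open>(0, v)\<close>, and
  these commute.\<close>

definition flow_coords where
  "flow_coords \<phi> c d = (\<lambda>(t, x). coords d (\<phi> t (chart_inv c x)))"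

definition flow_domain where
  "flow_domain \<phi> c d = {(t, x). x \<in> chart_img c \<and> \<phi> t (chart_inv c x) \<in> chart_dom d}"

context
  fixes X \<phi>
  assumes flow: "is_flow A X \<phi>"
begin

lemma open_flow_domain:
  assumes "c \<in> A" "d \<in> A"
  shows "open (flow_domain \<phi> c d)"
proof -
  have "continuous_on (UNIV \<times> chart_img c) (\<lambda>z. (fst z, chart_inv c (snd z)))"
    using cont_inv[OF assms(1)]
    by (intro continuous_intros continuous_on_compose2[of "chart_img c" "chart_inv c" _ snd]) auto
  moreover have cont: "continuous_on UNIV (\<lambda>(t, p). \<phi> t p)"
    using flow unfolding is_flow_def by blast
  ultimately have "continuous_on (UNIV \<times> chart_img c) (\<lambda>z. (\<lambda>(t, p). \<phi> t p) (fst z, chart_inv c (snd z)))"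
    using continuous_on_compose2[OF cont, of _ "\<lambda>z. (fst z, chart_inv c (snd z))"] by blast
  then have "open ((UNIV \<times> chart_img c) \<inter> (\<lambda>z. (\<lambda>(t, p). \<phi> t p) (fst z, chart_inv c (snd z))) -` chart_dom d)"
    using open_img[OF assms(1)] open_dom[OF assms(2)] by (intro continuous_open_preimage open_Times) auto
  moreover have "(UNIV \<times> chart_img c) \<inter> (\<lambda>z. (\<lambda>(t, p). \<phi> t p) (fst z, chart_inv c (snd z))) -` chart_dom d = flow_domain \<phi> c d"
    by (auto simp: flow_domain_def)
  ultimately show ?thesis by simp
qed

lemma flow_coords_Ck: "c \<in> A \<Longrightarrow> d \<in> A \<Longrightarrow> Ck_on k (flow_coords \<phi> c d) (flow_domain \<phi> c d)"
  using flow unfolding is_flow_def smooth_on_def flow_coords_def flow_domain_def by blast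

lemma flow_zero: "\<phi> 0 p = p"
  and flow_add: "\<phi> (s + t) p = \<phi> s (\<phi> t p)"
  using flow unfolding is_flow_def by blast+

lemma differentiable_map_flow: "differentiable_map A (\<phi> t)"
  unfolding differentiable_map_def
proof (intro conjI ballI impI)
  have "continuous_on UNIV (\<lambda>(t, p). \<phi> t p)"
    using flow unfolding is_flow_def by blast
  then have "continuous_on UNIV (\<lambda>p. (\<lambda>(t, p). \<phi> t p) (t, p))"
    by (rule continuous_on_compose2) (auto intro!: continuous_intros)
  then show "continuous_on UNIV (\<phi> t)" by simp
  fix c d p assume c: "c \<in> A" "d \<in> A" "p \<in> chart_dom c" "\<phi> t p \<in> chart_dom d"
  then have "(t, coords c p) \<in> flow_domain \<phi> c d"
    using inv_coords coords_in_img by (simp add: flow_domain_def)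
  then have "flow_coords \<phi> c d differentiable (at (t, coords c p))"
    using flow_coords_Ck[OF c(1,2), of "Suc 0"] by simp
  from frechet_derivative_Pair_snd[OF this]
  show "(coords d \<circ> \<phi> t \<circ> chart_inv c) differentiable (at (coords c p))"
    unfolding differentiable_def by (auto simp: flow_coords_def o_def)
qed

lemma map_deriv_flow:
  assumes "c \<in> A" "d \<in> A" "p \<in> chart_dom c" "\<phi> t p \<in> chart_dom d"
  shows "map_deriv c d (\<phi> t) p v = frechet_derivative (flow_coords \<phi> c d) (at (t, coords c p)) (0, v)"
proof -
  have "(t, coords c p) \<in> flow_domain \<phi> c d"
    using assms inv_coords coords_in_img by (simp add: flow_domain_def)
  then have "flow_coords \<phi> c d differentiable (at (t, coords c p))"
    using flow_coords_Ck[OF assms(1,2), of "Suc 0"] by simp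
  from frechet_derivative_at[OF frechet_derivative_Pair_snd[OF this]]
  have "(\<lambda>v. frechet_derivative (flow_coords \<phi> c d) (at (t, coords c p)) (0, v)) =
    frechet_derivative (\<lambda>y. flow_coords \<phi> c d (t, y)) (at (coords c p))" .
  then show ?thesis
    unfolding map_deriv_def by (simp add: flow_coords_def o_def fun_eq_iff)
qed

lemma flow_time_derivative:
  assumes "c \<in> A" "d \<in> A" "(t, x) \<in> flow_domain \<phi> c d"
  shows "frechet_derivative (flow_coords \<phi> c d) (at (t, x)) (1, 0) = X (\<phi> t (chart_inv c x)) d"
proof -
  have "flow_coords \<phi> c d differentiable (at (t, x))"
    using flow_coords_Ck[OF assms(1,2), of "Suc 0"] assms(3) by simp
  from frechet_derivative_Pair_fst[OF this]
  have "((\<lambda>s. coords d (\<phi> s (chart_inv c x))) has_vector_derivative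
      frechet_derivative (flow_coords \<phi> c d) (at (t, x)) (1, 0)) (at t)"
    by (simp add: flow_coords_def)
  moreover have "((\<lambda>s. coords d (\<phi> s (chart_inv c x))) has_vector_derivative X (\<phi> t (chart_inv c x)) d) (at t)"
    using flow assms unfolding is_flow_def flow_domain_def by blast
  ultimately show ?thesis by (rule vector_derivative_unique_at)
qed

text \<open>The field is the time derivative of the flow at time 0, so no smooth dependence of the inverse
  matrix of \<open>\<omega>\<close> on the point is needed.\<close>

lemma field_differentiable:
  assumes "d \<in> A" "y \<in> chart_img d"
  shows "(\<lambda>y. X (chart_inv d y) d) differentiable (at y)"
proof -
  let ?\<Phi> = "flow_coords \<phi> d d"
  have in_dom: "(0, y) \<in> flow_domain \<phi> d d" if "y \<in> chart_img d" for y
    using that inv_in_dom[OF assms(1)] by (simp add: flow_domain_def flow_zero)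
  have "(\<lambda>z. frechet_derivative ?\<Phi> (at z) (1, 0)) differentiable (at (0, y))"
    using flow_coords_Ck[OF assms(1,1), of "Suc (Suc 0)"] in_dom[OF assms(2)] by simp
  from frechet_derivative_Pair_snd[OF this]
  have "(\<lambda>y. frechet_derivative ?\<Phi> (at (0, y)) (1, 0)) differentiable (at y)"
    unfolding differentiable_def by blast
  then show ?thesis
    by (rule differentiable_cong_open[OF open_img[OF assms(1)] assms(2), rotated])
      (use in_dom flow_time_derivative[OF assms(1,1)] in \<open>simp add: flow_zero\<close>)
qed

text \<open>The linearised flow equation. The time derivative is moved past the space derivative,
  the time derivative of the flow is the field along the flow, and the chain rule gives the
  right-hand side.\<close>

lemma flow_variational_equation:
  assumes "c \<in> A" "d \<in> A" "(t, x) \<in> flow_domain \<phi> c d"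
  shows "((\<lambda>s. frechet_derivative (flow_coords \<phi> c d) (at (s, x)) (0, a)) has_vector_derivative
     frechet_derivative (\<lambda>y. X (chart_inv d y) d) (at (flow_coords \<phi> c d (t, x)))
       (frechet_derivative (flow_coords \<phi> c d) (at (t, x)) (0, a))) (at t)"
proof -
  let ?\<Phi> = "flow_coords \<phi> c d" and ?S = "flow_domain \<phi> c d"
  let ?X = "\<lambda>y. X (chart_inv d y) d"
  note C2 = flow_coords_Ck[OF assms(1,2), of "Suc (Suc 0)"]
  have "(\<lambda>z. frechet_derivative ?\<Phi> (at z) (0, a)) differentiable (at (t, x))"
    using C2 assms(3) by simp
  from frechet_derivative_Pair_fst[OF this]
  have "((\<lambda>s. frechet_derivative ?\<Phi> (at (s, x)) (0, a)) has_vector_derivative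
     frechet_derivative (\<lambda>z. frechet_derivative ?\<Phi> (at z) (0, a)) (at (t, x)) (1, 0)) (at t)" .
  also have "frechet_derivative (\<lambda>z. frechet_derivative ?\<Phi> (at z) (0, a)) (at (t, x)) (1, 0) =
     frechet_derivative (\<lambda>z. frechet_derivative ?\<Phi> (at z) (1, 0)) (at (t, x)) (0, a)"
    by (rule frechet_derivative_commute[OF open_flow_domain[OF assms(1,2)] assms(3) C2])
  also have "frechet_derivative (\<lambda>z. frechet_derivative ?\<Phi> (at z) (1, 0)) (at (t, x)) =
     frechet_derivative (\<lambda>z. ?X (?\<Phi> z)) (at (t, x))"
  proof (rule frechet_derivative_cong_open[OF open_flow_domain[OF assms(1,2)] assms(3)])
    fix z assume z: "z \<in> ?S"
    then show "frechet_derivative ?\<Phi> (at z) (1, 0) = ?X (?\<Phi> z)"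
      using flow_time_derivative[OF assms(1,2), of "fst z" "snd z"] inv_coords[OF assms(2)]
      by (auto simp: flow_domain_def flow_coords_def)
  qed
  also have "frechet_derivative (\<lambda>z. ?X (?\<Phi> z)) (at (t, x)) (0, a) =
     frechet_derivative ?X (at (?\<Phi> (t, x))) (frechet_derivative ?\<Phi> (at (t, x)) (0, a))"
  proof -
    have "?\<Phi> differentiable (at (t, x))" using C2 assms(3) by simp
    moreover have "?\<Phi> (t, x) \<in> chart_img d"
      using assms(3) coords_in_img[OF assms(2)] by (simp add: flow_domain_def flow_coords_def)
    then have "?X differentiable (at (?\<Phi> (t, x)))" by (rule field_differentiable[OF assms(2)])
    ultimately have "((\<lambda>z. ?X (?\<Phi> z)) has_derivative
       (\<lambda>v. frechet_derivative ?X (at (?\<Phi> (t, x))) (frechet_derivative ?\<Phi> (at (t, x)) v))) (at (t, x))"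
      unfolding frechet_derivative_works by (rule has_derivative_compose)
    from frechet_derivative_at[OF this, symmetric] show ?thesis by simp
  qed
  finally show ?thesis .
qed

end

end

section \<open>Invariance of the symplectic form\<close>

context symplectic_manifold
begin

context
  fixes f \<phi>
  assumes f: "smooth_fun A f" and flow: "is_flow A (ham_field A \<omega> f) \<phi>"
begin

lemma hamilton_equation:
  assumes "d \<in> A" "y \<in> chart_img d"
  shows "component A d \<omega> [ham_field A \<omega> f (chart_inv d y) d, v] y =
     frechet_derivative (f \<circ> chart_inv d) (at y) v"
proof -
  have p: "chart_inv d y \<in> chart_dom d" "coords d (chart_inv d y) = y"
    using inv_in_dom coords_inv assms by auto
  show ?thesis
    using ham_field_works[OF f, where p = "chart_inv d y"] coord_vec_inverse[OF assms(1) p(1)]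
      differential_in_chart[OF f assms(1) p(1)] coord_vec_in_tangent_space[OF assms(1) p(1)]
      coord_vec_apply[OF assms(1) p(1)] p(2)
    by (simp add: component_def)
qed

text \<open>Hamilton's equation is differentiated along \<open>w\<close> with \<open>v\<close>
  constant. The left side gives a term from the field and one from the base point of \<omega>, the
  right side the Hessian of \<open>f\<close> in the chart.\<close>

lemma hamilton_equation_derivative:
  assumes d: "d \<in> A" "y \<in> chart_img d"
  defines "X \<equiv> \<lambda>y. ham_field A \<omega> f (chart_inv d y) d"
  shows "component A d \<omega> [frechet_derivative X (at y) w, v] y +
      frechet_derivative (component A d \<omega> [X y, v]) (at y) w =
    frechet_derivative (\<lambda>z. frechet_derivative (f \<circ> chart_inv d) (at z) v) (at y) w"
proof -
  let ?D = "\<lambda>z. frechet_derivative (f \<circ> chart_inv d) (at z) v"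
  note S = open_img[OF d(1)]
  have bil: "bilinear (\<lambda>a b. component A d \<omega> [a, b] x)" if "x \<in> chart_img d" for x
    using bilinear_omega[OF d(1) inv_in_dom[OF d(1) that]] by (simp add: component_def)
  have line: "((\<lambda>s. y + s *\<^sub>R w) has_vector_derivative w) (at 0)"
    by (auto intro!: derivative_eq_intros)
  have X: "((\<lambda>s. X (y + s *\<^sub>R w)) has_vector_derivative frechet_derivative X (at y) w) (at 0)"
    using has_vector_derivative_compose_curve[of X "\<lambda>s. y + s *\<^sub>R w" 0 w] line
      field_differentiable[OF flow d] by (simp add: X_def)
  have "((\<lambda>s. component A d \<omega> [X (y + s *\<^sub>R w), v] (y + s *\<^sub>R w)) has_real_derivative
     component A d \<omega> [frechet_derivative X (at y) w, v] (y + 0 *\<^sub>R w) +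
     component A d \<omega> [X (y + 0 *\<^sub>R w), 0] (y + 0 *\<^sub>R w) +
     frechet_derivative (component A d \<omega> [X (y + 0 *\<^sub>R w), v]) (at (y + 0 *\<^sub>R w)) w) (at 0)"
    by (rule has_real_derivative_bilinear_along_curve[where \<Omega> = "\<lambda>x a b. component A d \<omega> [a, b] x"
        and W = "\<lambda>_. v" and W' = 0, OF S _ bil _ line X])
      (use d smooth_on_differentiable[OF smooth_component_omega[OF d(1)]] in auto)
  moreover have "component A d \<omega> [X y, 0] y = 0"
    using bilinear_rzero[OF bil[OF d(2)]] by simp
  ultimately have 1: "((\<lambda>s. component A d \<omega> [X (y + s *\<^sub>R w), v] (y + s *\<^sub>R w)) has_real_derivative
     component A d \<omega> [frechet_derivative X (at y) w, v] y +
     frechet_derivative (component A d \<omega> [X y, v]) (at y) w) (at 0)"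
    by simp
  have "?D differentiable (at y)"
    using f d smooth_on_differentiable[OF smooth_on_derivative] unfolding smooth_fun_def by blast
  then have 2: "((\<lambda>s. ?D (y + s *\<^sub>R w)) has_real_derivative frechet_derivative ?D (at y) w) (at 0)"
    using has_vector_derivative_compose_curve[of ?D "\<lambda>s. y + s *\<^sub>R w" 0 w] line
    by (simp add: has_real_derivative_iff_has_vector_derivative)
  have "((\<lambda>s. y + s *\<^sub>R w) \<longlongrightarrow> y + 0 *\<^sub>R w) (nhds 0)"
    by (intro tendsto_intros) (simp add: filterlim_ident)
  then have ev: "eventually (\<lambda>s. y + s *\<^sub>R w \<in> chart_img d) (nhds 0)"
    using S d(2) by (auto dest: topological_tendstoD)
  have ev': "eventually (\<lambda>s. component A d \<omega> [X (y + s *\<^sub>R w), v] (y + s *\<^sub>R w) = ?D (y + s *\<^sub>R w)) (nhds 0)"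
    using ev by eventually_elim (simp add: X_def hamilton_equation[OF d(1)])
  have "((\<lambda>s. ?D (y + s *\<^sub>R w)) has_real_derivative component A d \<omega> [frechet_derivative X (at y) w, v] y +
     frechet_derivative (component A d \<omega> [X y, v]) (at y) w) (at 0)"
    by (rule iffD1[OF DERIV_cong_ev[OF refl ev' refl] 1])
  then show ?thesis using 2 by (rule DERIV_unique)
qed

text \<open>This is the Lie derivative of \<omega> along the Hamiltonian field. Both vectors are
  transported by the linearised flow \<open>U\<close>, so the product rule gives one term for each
  of them and one for the base point.\<close>

lemma ham_flow_omega_derivative:
  assumes u: "u \<in> tangent_space A p" and w: "w \<in> tangent_space A p"
  shows "((\<lambda>s. \<omega> (\<phi> s p) [tangent_map A (\<phi> s) p u, tangent_map A (\<phi> s) p w]) has_real_derivative 0) (at t)"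
proof -
  obtain c where c: "c \<in> A" "p \<in> chart_dom c" by (rule chart_exists)
  \<comment> \<open>The orbit may leave every chart around \<open>p\<close>, but the derivative at
    \<open>t\<close> needs only a chart around the point reached at time \<open>t\<close>.\<close>
  obtain d where d: "d \<in> A" "\<phi> t p \<in> chart_dom d" by (rule chart_exists)
  define x where "x = coords c p"
  define \<Phi> where "\<Phi> = flow_coords \<phi> c d"
  define U where "U a s = frechet_derivative \<Phi> (at (s, x)) (0, a)" for a s
  define X where "X = (\<lambda>y. ham_field A \<omega> f (chart_inv d y) d)"
  define y where "y = \<Phi> (t, x)"
  have dom_iff: "(s, x) \<in> flow_domain \<phi> c d \<longleftrightarrow> \<phi> s p \<in> chart_dom d" for s
    using c coords_in_img inv_coords by (simp add: flow_domain_def x_def)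
  have tx: "(t, x) \<in> flow_domain \<phi> c d" using d dom_iff by simp
  have y: "y \<in> chart_img d" "chart_inv d y = \<phi> t p"
    using d c coords_in_img inv_coords by (auto simp: y_def \<Phi>_def flow_coords_def x_def)
  have bil: "bilinear (\<lambda>a b. component A d \<omega> [a, b] x)" if "x \<in> chart_img d" for x
    using bilinear_omega[OF d(1) inv_in_dom[OF d(1) that]] by (simp add: component_def)
  have U': "(U a has_vector_derivative frechet_derivative X (at y) (U a t)) (at t)" for a
    unfolding U_def X_def y_def \<Phi>_def by (rule flow_variational_equation[OF flow c(1) d(1) tx])
  have "\<Phi> differentiable (at (t, x))"
    using flow_coords_Ck[OF flow c(1) d(1), of "Suc 0"] tx by (simp add: \<Phi>_def)
  from frechet_derivative_Pair_fst[OF this]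
  have \<Phi>': "((\<lambda>s. \<Phi> (s, x)) has_vector_derivative X y) (at t)"
    using flow_time_derivative[OF flow c(1) d(1) tx] y(2) inv_coords[OF c] by (simp add: \<Phi>_def X_def x_def)
  let ?U = "U (u c) t" and ?W = "U (w c) t"
  have "((\<lambda>s. component A d \<omega> [U (u c) s, U (w c) s] (\<Phi> (s, x))) has_real_derivative
     component A d \<omega> [frechet_derivative X (at y) ?U, ?W] y +
     component A d \<omega> [?U, frechet_derivative X (at y) ?W] y +
     frechet_derivative (component A d \<omega> [?U, ?W]) (at y) (X y)) (at t)"
    using has_real_derivative_bilinear_along_curve[where \<Omega> = "\<lambda>x a b. component A d \<omega> [a, b] x",
        OF open_img[OF d(1)] _ bil _ \<Phi>' U'[of "u c"] U'[of "w c"]]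
      y(1) smooth_on_differentiable[OF smooth_component_omega[OF d(1)]] by (simp add: y_def)
  \<comment> \<open>By the differentiated Hamilton equation the first two terms are two Hessians in
    exchanged arguments, with opposite signs, and two derivatives of \<omega> paired with the field.
    The Hessians cancel; the rest is the exterior derivative of \<omega> on \<open>X y\<close>,
    \<open>?U\<close>, \<open>?W\<close>.\<close>
  moreover have "component A d \<omega> [frechet_derivative X (at y) ?U, ?W] y +
     component A d \<omega> [?U, frechet_derivative X (at y) ?W] y +
     frechet_derivative (component A d \<omega> [?U, ?W]) (at y) (X y) = 0"
  proof -
    have anti: "component A d \<omega> [a, b] y = - component A d \<omega> [b, a] y" for a b
    proof -
      have "component A d \<omega> [e, e] y = 0" for e
        using omega_self[OF coord_vec_in_tangent_space[OF d(1) inv_in_dom[OF d(1) y(1)]]] by (simp add: component_def)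
      from this[of "a + b"] this[of a] this[of b] show ?thesis
        using bilinear_ladd[OF bil[OF y(1)]] bilinear_radd[OF bil[OF y(1)]] by simp
    qed
    have "Ck_on (Suc (Suc 0)) (f \<circ> chart_inv d) (chart_img d)"
      using f d(1) unfolding smooth_fun_def smooth_on_def by blast
    from frechet_derivative_commute[OF open_img[OF d(1)] y(1) this, of ?U ?W]
    show ?thesis
      using hamilton_equation_derivative[OF d(1) y(1), of ?U ?W] hamilton_equation_derivative[OF d(1) y(1), of ?W ?U]
        closed_omega[OF d(1) y(1), of ?U ?W "X y"] anti[of ?U "frechet_derivative X (at y) ?W"]
      unfolding X_def by linarith
  qed
  ultimately have deriv: "((\<lambda>s. component A d \<omega> [U (u c) s, U (w c) s] (\<Phi> (s, x))) has_real_derivative 0) (at t)"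
    by simp
  have "open ((\<lambda>s. (s, x)) -` flow_domain \<phi> c d)"
    by (intro open_vimage open_flow_domain[OF flow c(1) d(1)]) (auto intro!: continuous_intros)
  then have "eventually (\<lambda>s. s \<in> (\<lambda>s. (s, x)) -` flow_domain \<phi> c d) (nhds t)"
    using tx by (intro eventually_nhds_in_open) auto
  then have ev: "eventually (\<lambda>s. component A d \<omega> [U (u c) s, U (w c) s] (\<Phi> (s, x)) =
      \<omega> (\<phi> s p) [tangent_map A (\<phi> s) p u, tangent_map A (\<phi> s) p w]) (nhds t)"
  proof eventually_elim
    fix s assume "s \<in> (\<lambda>s. (s, x)) -` flow_domain \<phi> c d"
    then have s: "\<phi> s p \<in> chart_dom d" using dom_iff by simp
    have "tangent_map A (\<phi> s) p v = coord_vec A d (\<phi> s p) (U (v c) s)" if "v \<in> tangent_space A p" for v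
      using tangent_map_eq_coord_vec[OF differentiable_map_flow[OF flow] c d(1) s that]
        map_deriv_flow[OF flow c(1) d(1) c(2) s] by (simp add: U_def \<Phi>_def x_def)
    moreover have "chart_inv d (\<Phi> (s, x)) = \<phi> s p"
      using s inv_coords c d(1) by (simp add: \<Phi>_def flow_coords_def x_def)
    ultimately show "component A d \<omega> [U (u c) s, U (w c) s] (\<Phi> (s, x)) =
      \<omega> (\<phi> s p) [tangent_map A (\<phi> s) p u, tangent_map A (\<phi> s) p w]"
      using u w by (simp add: component_def)
  qed
  show ?thesis by (rule iffD1[OF DERIV_cong_ev[OF refl ev refl] deriv])
qed

lemma ham_flow_preserves_omega: "pullback A 2 (\<phi> t) \<omega> = \<omega>"
proof (intro ext)
  fix p vs
  show "pullback A 2 (\<phi> t) \<omega> p vs = \<omega> p vs"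
  proof (cases "vs \<in> tangent_lists A 2 p")
    case True
    then obtain u w where uw: "vs = [u, w]" "u \<in> tangent_space A p" "w \<in> tangent_space A p"
      by (auto simp: tangent_lists_def numeral_2_eq_2 length_Suc_conv)
    have id: "\<phi> 0 = id" using flow_zero[OF flow] by (simp add: fun_eq_iff)
    have "\<omega> (\<phi> t p) [tangent_map A (\<phi> t) p u, tangent_map A (\<phi> t) p w] =
      \<omega> (\<phi> 0 p) [tangent_map A (\<phi> 0) p u, tangent_map A (\<phi> 0) p w]"
      using DERIV_isconst_all ham_flow_omega_derivative[OF uw(2,3)] by blast
    then show ?thesis
      using True uw by (simp add: id tangent_map_id pullback_def)
  next
    case False
    then show ?thesis using alternating_omega[of p] unfolding alternating_def pullback_def by auto
  qed
qed

end

text \<open>The claims about \<open>inv F\<close> are carried through the induction, so that the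
  generator \<open>inverse\<close> follows by exchanging the two maps. For a flow the inverse is the
  flow at the opposite time.\<close>

lemma ham_group_symplectic:
  assumes "F \<in> ham_group A \<omega>"
  shows "bij F \<and> differentiable_map A F \<and> differentiable_map A (inv F) \<and>
     pullback A 2 F \<omega> = \<omega> \<and> pullback A 2 (inv F) \<omega> = \<omega>"
  using assms
proof induction
  case (flow f \<phi> t)
  have comp: "\<phi> s (\<phi> (- s) p) = p" for s p
    using flow_add[OF flow(2), of s "- s" p] flow_zero[OF flow(2)] by simp
  have "inv (\<phi> t) = \<phi> (- t)"
    by (rule inv_equality) (use comp[of t] comp[of "- t"] in auto)
  moreover have "bij (\<phi> t)"
    by (rule o_bij[of "\<phi> (- t)"]) (use comp[of t] comp[of "- t"] in \<open>auto simp: fun_eq_iff\<close>)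
  ultimately show ?case
    using differentiable_map_flow[OF flow(2)] ham_flow_preserves_omega[OF flow] by simp
next
  case identity
  then show ?case
    using differentiable_map_id pullback_id[of 2 \<omega>, OF alternating_omega] bij_id inv_id by metis
next
  case (comp F G)
  then have inv: "inv (F \<circ> G) = inv G \<circ> inv F" by (intro o_inv_distrib) auto
  have "bij (F \<circ> G)" using comp.IH bij_comp by blast
  moreover have "differentiable_map A (F \<circ> G)" "differentiable_map A (inv G \<circ> inv F)"
    using comp.IH differentiable_map_comp by blast+
  moreover have "pullback A 2 (F \<circ> G) \<omega> = \<omega>"
    using comp.IH pullback_comp[of F G 2 \<omega>] by metis
  moreover have "pullback A 2 (inv G \<circ> inv F) \<omega> = \<omega>"
    using comp.IH pullback_comp[of "inv G" "inv F" 2 \<omega>] by metis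
  ultimately show ?case unfolding inv by blast
next
  case (inverse F)
  then show ?case by (simp add: inv_inv_eq bij_imp_bij_inv)
qed

end

section \<open>The measure of a volume form\<close>

lemma set_nn_integral_eq_integral:
  fixes h :: "'b::euclidean_space \<Rightarrow> real"
  assumes "h absolutely_integrable_on S" "\<And>x. x \<in> S \<Longrightarrow> 0 \<le> h x"
    and "(\<lambda>x. indicator S x *\<^sub>R h x) \<in> borel_measurable borel"
  shows "(\<integral>\<^sup>+ x\<in>S. ennreal (h x) \<partial>lborel) = ennreal (integral S h)"
proof -
  have "(\<integral>\<^sup>+ x\<in>S. ennreal (h x) \<partial>lborel) = (\<integral>\<^sup>+ x. ennreal (indicator S x *\<^sub>R h x) \<partial>lborel)"
    by (intro nn_integral_cong) (simp add: indicator_def)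
  also have "\<dots> = (\<integral>\<^sup>+ x. ennreal (indicator S x *\<^sub>R h x) \<partial>lebesgue)"
    by (simp add: nn_integral_completion)
  also have "\<dots> = ennreal (LINT x:S | lebesgue. h x)"
    using assms(1,2) unfolding set_lebesgue_integral_def set_integrable_def
    by (intro nn_integral_eq_integral) (auto simp: indicator_def)
  also have "(LINT x:S | lebesgue. h x) = integral S h"
    using assms(1) by (rule set_lebesgue_integral_eq_integral(2))
  finally show ?thesis .
qed

lemma absolutely_integrable_on_if_nn_integral_finite:
  fixes h :: "'b::euclidean_space \<Rightarrow> real"
  assumes "(\<integral>\<^sup>+ x\<in>S. ennreal (h x) \<partial>lborel) < \<infinity>" "\<And>x. x \<in> S \<Longrightarrow> 0 \<le> h x"
    and "(\<lambda>x. indicator S x *\<^sub>R h x) \<in> borel_measurable borel"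
  shows "h absolutely_integrable_on S"
proof -
  have "(\<integral>\<^sup>+ x. ennreal (norm (indicator S x *\<^sub>R h x)) \<partial>lebesgue) = (\<integral>\<^sup>+ x\<in>S. ennreal (h x) \<partial>lborel)"
    unfolding nn_integral_completion
    using assms(2) by (intro nn_integral_cong) (simp add: indicator_def)
  then show ?thesis
    unfolding set_integrable_def integrable_iff_bounded
    using assms(1,3) by (auto intro: measurable_completion)
qed

text \<open>If one side is absolutely integrable, so is the other, with the same integral. If
  neither is, both integrals are infinite, as the functions are nonnegative and measurable.\<close>

lemma nn_integral_change_of_variables:
  fixes T :: "real ^ 'm::{finite,wellorder} \<Rightarrow> real ^ 'm::_" and g h :: "real ^ 'm::_ \<Rightarrow> real"
  assumes S: "S \<in> sets borel"
    and der: "\<And>x. x \<in> S \<Longrightarrow> (T has_derivative T' x) (at x)"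
    and inj: "inj_on T S"
    and g: "\<And>y. y \<in> T ` S \<Longrightarrow> 0 \<le> g y" "(\<lambda>y. indicator (T ` S) y *\<^sub>R g y) \<in> borel_measurable borel"
    and h: "\<And>x. x \<in> S \<Longrightarrow> h x = \<bar>det (matrix (T' x))\<bar> * g (T x)"
      "(\<lambda>x. indicator S x *\<^sub>R h x) \<in> borel_measurable borel"
  shows "(\<integral>\<^sup>+ y\<in>T ` S. ennreal (g y) \<partial>lborel) = (\<integral>\<^sup>+ x\<in>S. ennreal (h x) \<partial>lborel)"
proof -
  have h0: "0 \<le> h x" if "x \<in> S" for x using that g(1) h(1) by simp
  have L: "S \<in> sets lebesgue" using S by simp
  \<comment> \<open>The theorem on absolutely integrable functions has vectors as values; a real
    function passes through it as a vector of length one.\<close>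
  let ?gv = "\<lambda>y. vec (g y) :: real ^ 1"
  have "h absolutely_integrable_on S \<and> integral S h = b \<longleftrightarrow>
      g absolutely_integrable_on (T ` S) \<and> integral (T ` S) g = b" for b
  proof -
    have "(\<lambda>x. \<bar>det (matrix (T' x))\<bar> *\<^sub>R ?gv (T x)) absolutely_integrable_on S \<and>
        integral S (\<lambda>x. \<bar>det (matrix (T' x))\<bar> *\<^sub>R ?gv (T x)) = vec b
      \<longleftrightarrow> ?gv absolutely_integrable_on (T ` S) \<and> integral (T ` S) ?gv = vec b"
      by (rule has_absolute_integral_change_of_variables[OF L _ inj]) (use der has_derivative_at_withinI in blast)
    moreover have "(\<lambda>x. \<bar>det (matrix (T' x))\<bar> *\<^sub>R ?gv (T x)) absolutely_integrable_on S \<longleftrightarrow>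
       (\<lambda>x. (vec (h x) :: real ^ 1)) absolutely_integrable_on S"
      by (rule set_integrable_cong) (auto simp: h(1) vec_eq_iff)
    moreover have "integral S (\<lambda>x. \<bar>det (matrix (T' x))\<bar> *\<^sub>R ?gv (T x)) = integral S (\<lambda>x. vec (h x) :: real ^ 1)"
      by (rule integral_cong) (auto simp: h(1) vec_eq_iff)
    ultimately show ?thesis
      by (simp add: absolutely_integrable_on_1_iff integral_on_1_eq vec_eq_iff)
  qed
  then have iff: "h absolutely_integrable_on S \<longleftrightarrow> g absolutely_integrable_on (T ` S)"
    and eq: "h absolutely_integrable_on S \<Longrightarrow> integral S h = integral (T ` S) g"
    by blast+
  show ?thesis
  proof (cases "h absolutely_integrable_on S")
    case True
    then show ?thesis
      using set_nn_integral_eq_integral[OF True h0 h(2)] set_nn_integral_eq_integral[OF _ g] iff eq by simp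
  next
    case False
    then have "\<not> (\<integral>\<^sup>+ x\<in>S. ennreal (h x) \<partial>lborel) < \<infinity>" "\<not> (\<integral>\<^sup>+ y\<in>T ` S. ennreal (g y) \<partial>lborel) < \<infinity>"
      using absolutely_integrable_on_if_nn_integral_finite[OF _ h0 h(2)]
        absolutely_integrable_on_if_nn_integral_finite[OF _ g] iff by blast+
    then show ?thesis by (simp add: less_top[symmetric])
  qed
qed

text \<open>A Borel set is split into its part in one member of the cover and the rest, which the
  other members cover. This finite additivity works for infinite measures too.\<close>

lemma measure_eqI_open_cover:
  fixes M N :: "'b::topological_space measure"
  assumes sets: "sets M = sets borel" "sets N = sets borel"
    and \<U>: "finite \<U>" "\<Union>\<U> = UNIV" "\<And>U. U \<in> \<U> \<Longrightarrow> open U"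
    and eq: "\<And>U B. U \<in> \<U> \<Longrightarrow> B \<in> sets borel \<Longrightarrow> B \<subseteq> U \<Longrightarrow> emeasure M B = emeasure N B"
  shows "M = N"
proof (rule measure_eqI)
  have "emeasure M B = emeasure N B" if "finite \<V>" "\<V> \<subseteq> \<U>" "B \<in> sets borel" "B \<subseteq> \<Union>\<V>" for \<V> B
    using that
  proof (induction \<V> arbitrary: B rule: finite_induct)
    case empty
    then show ?case by simp
  next
    case (insert U \<V>)
    have U: "U \<in> sets borel" using insert.prems \<U>(3) by auto
    have B: "B = (B \<inter> U) \<union> (B - U)" by blast
    have "emeasure M (B - U) = emeasure N (B - U)"
      using insert.prems U by (intro insert.IH) auto
    moreover have "emeasure M (B \<inter> U) = emeasure N (B \<inter> U)"
      using insert.prems U by (intro eq) auto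
    moreover have "emeasure M B = emeasure M (B \<inter> U) + emeasure M (B - U)"
      using insert.prems U sets by (subst B, intro plus_emeasure[symmetric]) auto
    moreover have "emeasure N B = emeasure N (B \<inter> U) + emeasure N (B - U)"
      using insert.prems U sets by (subst B, intro plus_emeasure[symmetric]) auto
    ultimately show ?case by simp
  qed
  then show "emeasure M B = emeasure N B" if "B \<in> sets M" for B
    using that sets \<U>(1,2) by auto
qed (simp add: sets)

section \<open>Gluing the chart densities into one measure\<close>

context coordinate_manifold
begin

context
  fixes \<mu> :: "('a, (real, 'k) vec) form"
  assumes volume: "volume_form A CARD('k) \<mu>"
    and compact_mfd: "compact (UNIV :: 'a set)"
begin

lemma alternating_volume: "alternating A CARD('k) p (\<mu> p)"
  using volume unfolding volume_form_def smooth_form_def by blast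

lemma volume_frame_nonzero: "c \<in> A \<Longrightarrow> p \<in> chart_dom c \<Longrightarrow> \<mu> p (frame c p) \<noteq> 0"
  using top_form_frame_nonzero[OF alternating_volume] volume unfolding volume_form_def by blast

definition chart_density where
  "chart_density c x = \<bar>component A c \<mu> coord_frame x\<bar>"

definition chart_mass where
  "chart_mass c B = (\<integral>\<^sup>+ x\<in>coords c ` B. ennreal (chart_density c x) \<partial>lborel)"

lemma length_coord_frame: "length (coord_frame :: (real, 'k) vec list) = CARD('k)"
  by (simp add: coord_frame_def)

lemma continuous_chart_density:
  assumes "c \<in> A"
  shows "continuous_on (chart_img c) (chart_density c)"
proof -
  have "smooth_on (component A c \<mu> coord_frame) (chart_img c)"
    using volume assms length_coord_frame unfolding volume_form_def smooth_form_def by blast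
  then show ?thesis
    unfolding chart_density_def by (intro continuous_on_rabs smooth_on_continuous)
qed

lemma chart_density_pos: "c \<in> A \<Longrightarrow> x \<in> chart_img c \<Longrightarrow> 0 < chart_density c x"
  using volume_frame_nonzero inv_in_dom by (simp add: chart_density_def component_coord_frame)

lemma measurable_chart_inv:
  "c \<in> A \<Longrightarrow> chart_inv c \<in> borel_measurable (restrict_space borel (chart_img c))"
  by (rule borel_measurable_continuous_on_restrict[OF cont_inv])

text \<open>The image under the coordinate map is treated as a preimage under the continuous inverse
  chart.\<close>

lemma coords_image_borel:
  assumes "c \<in> A" "B \<in> sets borel" "B \<subseteq> chart_dom c"
  shows "coords c ` B \<in> sets borel"
proof -
  have "chart_inv c -` B \<inter> chart_img c \<in> sets (restrict_space borel (chart_img c))"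
    using measurable_sets[OF measurable_chart_inv[OF assms(1)] assms(2)] by (simp add: space_restrict_space)
  then have "chart_inv c -` B \<inter> chart_img c \<in> sets borel"
    using open_img[OF assms(1)] by (auto simp: sets_restrict_space)
  moreover have "coords c ` (chart_dom c \<inter> B) = chart_inv c -` B \<inter> chart_img c"
    unfolding chart_inv_vimage[OF assms(1)] by blast
  ultimately show ?thesis using assms(3) by (simp add: Int_absorb1)
qed

lemma chart_density_indicator_measurable:
  assumes "c \<in> A" "S \<in> sets borel" "S \<subseteq> chart_img c"
  shows "(\<lambda>x. indicator S x *\<^sub>R chart_density c x) \<in> borel_measurable borel"
  by (rule borel_measurable_continuous_on_indicator[OF assms(2)])
    (rule continuous_on_subset[OF continuous_chart_density[OF assms(1)] assms(3)])

text \<open>In coordinates \<open>F\<close> becomes \<open>?T\<close>, and the invariance of \<mu>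
  says that the densities differ by the absolute Jacobian determinant. With the identity for
  \<open>F\<close> this is independence of the chart, with a Hamiltonian diffeomorphism the
  invariance of the measure.\<close>

lemma chart_mass_invariant:
  assumes F: "differentiable_map A F" "inj F" "pullback A CARD('k) F \<mu> = \<mu>"
    and c: "c \<in> A" "B \<subseteq> chart_dom c" "B \<in> sets borel"
    and d: "d \<in> A" "F ` B \<subseteq> chart_dom d" "F ` B \<in> sets borel"
  shows "chart_mass d (F ` B) = chart_mass c B"
proof -
  let ?T = "coords d \<circ> F \<circ> chart_inv c" and ?S = "coords c ` B"
  have ic: "chart_inv c (coords c p) = p" if "p \<in> B" for p
    using inv_coords[OF c(1)] c(2) that by blast
  have di: "chart_inv d (coords d (F p)) = F p" if "p \<in> B" for p
    using inv_coords[OF d(1)] d(2) that by blast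
  have img: "?T ` ?S = coords d ` F ` B"
  proof -
    have "?T (coords c p) = coords d (F p)" if "p \<in> B" for p
      using ic[OF that] by simp
    then show ?thesis unfolding image_image by (rule image_cong[OF refl])
  qed
  have sub: "coords e ` B \<subseteq> chart_img e" if "B \<subseteq> chart_dom e" for e B
    using that by (auto simp: chart_img_def)
  have "chart_mass d (F ` B) = (\<integral>\<^sup>+ y\<in>?T ` ?S. ennreal (chart_density d y) \<partial>lborel)"
    unfolding chart_mass_def img ..
  also have "\<dots> = (\<integral>\<^sup>+ x\<in>?S. ennreal (chart_density c x) \<partial>lborel)"
  proof (rule nn_integral_change_of_variables[where T' = "\<lambda>x. map_deriv c d F (chart_inv c x)"])
    show "?S \<in> sets borel" by (rule coords_image_borel[OF c(1,3,2)])
    show "(?T has_derivative map_deriv c d F (chart_inv c x)) (at x)" if "x \<in> ?S" for x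
    proof -
      obtain p where p: "p \<in> B" "x = coords c p" using \<open>x \<in> ?S\<close> by blast
      then have "chart_inv c x = p" using ic by simp
      then show ?thesis
        using map_deriv_works[OF F(1) c(1) d(1), of p] p c d by auto
    qed
    show "inj_on ?T ?S"
    proof (rule inj_onI)
      fix x y assume "x \<in> ?S" "y \<in> ?S" and e: "?T x = ?T y"
      then obtain p q where p: "p \<in> B" "x = coords c p" and q: "q \<in> B" "y = coords c q" by blast
      have "coords d (F p) = coords d (F q)"
        using e p q ic by simp
      then have "F p = F q" using di p q by metis
      then show "x = y" using F(2) p q by (simp add: inj_eq)
    qed
    show "(\<lambda>y. indicator (?T ` ?S) y *\<^sub>R chart_density d y) \<in> borel_measurable borel"
      unfolding img by (intro chart_density_indicator_measurable d coords_image_borel sub)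
    show "(\<lambda>x. indicator ?S x *\<^sub>R chart_density c x) \<in> borel_measurable borel"
      by (intro chart_density_indicator_measurable c coords_image_borel sub)
    show "chart_density c x = \<bar>det (matrix (map_deriv c d F (chart_inv c x)))\<bar> * chart_density d (?T x)"
      if "x \<in> ?S" for x
    proof -
      obtain p where p: "p \<in> B" "x = coords c p" using \<open>x \<in> ?S\<close> by blast
      then have "chart_inv c x = p" using ic by simp
      then show ?thesis
        using component_pullback[OF alternating_volume F(1,3) c(1) _ d(1), of p] p c(2) d(2)
        by (simp add: chart_density_def abs_mult subset_iff image_subset_iff)
    qed
  qed (simp add: chart_density_def)
  finally show ?thesis unfolding chart_mass_def .
qed

lemma chart_mass_eq:
  assumes "c \<in> A" "d \<in> A" "B \<subseteq> chart_dom c" "B \<subseteq> chart_dom d" "B \<in> sets borel"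
  shows "chart_mass d B = chart_mass c B"
  using chart_mass_invariant[OF differentiable_map_id _ pullback_id[OF alternating_volume], of c B d] assms
  by simp

text \<open>The density of one chart is pushed forward to a measure on all Borel sets of the
  manifold, so that pieces from several charts can be added.\<close>

definition chart_measure where
  "chart_measure c =
     distr (density (restrict_space lborel (chart_img c)) (\<lambda>x. ennreal (chart_density c x))) borel (chart_inv c)"

lemma emeasure_chart_measure:
  assumes "c \<in> A" "B \<in> sets borel"
  shows "emeasure (chart_measure c) B = chart_mass c (chart_dom c \<inter> B)"
proof -
  let ?R = "restrict_space lborel (chart_img c)"
  let ?P = "chart_inv c -` B \<inter> chart_img c"
  have sR: "sets ?R = sets (restrict_space borel (chart_img c))" by (rule sets_restrict_space_cong) simp
  have m: "chart_inv c \<in> measurable (density ?R (\<lambda>x. ennreal (chart_density c x))) borel"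
    using measurable_chart_inv[OF assms(1)] by (simp add: measurable_cong_sets[OF sR refl])
  have "chart_density c \<in> borel_measurable (restrict_space borel (chart_img c))"
    by (rule borel_measurable_continuous_on_restrict[OF continuous_chart_density[OF assms(1)]])
  then have dm: "(\<lambda>x. ennreal (chart_density c x)) \<in> borel_measurable ?R"
    by (simp add: measurable_cong_sets[OF sR refl])
  have P: "?P \<in> sets ?R"
    using measurable_sets[OF measurable_chart_inv[OF assms(1)] assms(2)] sR by (simp add: space_restrict_space)
  have "emeasure (chart_measure c) B = emeasure (density ?R (\<lambda>x. ennreal (chart_density c x))) ?P"
    unfolding chart_measure_def by (subst emeasure_distr[OF m assms(2)]) (simp add: space_restrict_space)
  also have "\<dots> = (\<integral>\<^sup>+ x. ennreal (chart_density c x) * indicator ?P x \<partial>?R)"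
    by (rule emeasure_density[OF dm P])
  also have "\<dots> = (\<integral>\<^sup>+ x. ennreal (chart_density c x) * indicator ?P x * indicator (chart_img c) x \<partial>lborel)"
    by (rule nn_integral_restrict_space) (simp add: open_img[OF assms(1)])
  also have "\<dots> = chart_mass c (chart_dom c \<inter> B)"
    unfolding chart_mass_def chart_inv_vimage[OF assms(1)]
    by (intro nn_integral_cong) (auto simp: indicator_def)
  finally show ?thesis .
qed

lemma sets_chart_measure: "sets (chart_measure c) = sets borel"
  by (simp add: chart_measure_def)

lemma finite_chart_cover:
  obtains C where "finite C" "C \<subseteq> A" "(\<Union>c\<in>C. chart_dom c) = UNIV"
proof -
  have "UNIV \<subseteq> (\<Union>c\<in>A. chart_dom c)" using atlas unfolding smooth_atlas_def by blast
  from compactE_image[OF compact_mfd open_dom this] show ?thesis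
    using that by (metis UNIV_eq_I top.extremum_uniqueI)
qed

definition is_vol_measure where
  "is_vol_measure m \<longleftrightarrow> sets m = sets borel \<and>
     (\<forall>c\<in>A. \<forall>B\<in>sets borel. B \<subseteq> chart_dom c \<longrightarrow> emeasure m B = chart_mass c B)"

lemma is_vol_measureD:
  assumes "is_vol_measure m"
  shows "sets m = sets borel"
    and "c \<in> A \<Longrightarrow> B \<in> sets borel \<Longrightarrow> B \<subseteq> chart_dom c \<Longrightarrow> emeasure m B = chart_mass c B"
  using assms unfolding is_vol_measure_def by simp_all

text \<open>The domains of a finite chart cover are made disjoint and each piece is measured in its
  own chart. Independence of the chart lets every piece be measured in any given chart
  \<open>c\<close> instead.\<close>

lemma is_vol_measure_exists: "\<exists>m. is_vol_measure m"
proof -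
  obtain C where C: "finite C" "C \<subseteq> A" "(\<Union>c\<in>C. chart_dom c) = UNIV" by (rule finite_chart_cover)
  obtain cs :: "nat \<Rightarrow> ('a, (real, 'k) vec) chart" and N where cs: "C = cs ` {..<N}"
    using C(1) unfolding finite_conv_nat_seg_image by (auto simp: lessThan_def)
  have csA: "cs i \<in> A" if "i < N" for i using that C(2) cs by auto
  \<comment> \<open>\<open>D i\<close> consists of the points whose first chart in the enumeration
    is the one with number \<open>i\<close>.\<close>
  define D where "D i = chart_dom (cs i) - (\<Union>j<i. chart_dom (cs j))" for i
  have D_borel: "D i \<in> sets borel" if "i < N" for i
    unfolding D_def using that csA open_dom by (intro sets.Diff sets.finite_UN borel_open) auto
  have D_disj: "disjoint_family_on D {..<N}"
  proof -
    have "D i \<inter> D j = {}" if "i < j" for i j using that by (auto simp: D_def)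
    then show ?thesis unfolding disjoint_family_on_def by (metis Int_commute linorder_neqE_nat)
  qed
  have D_cover: "(\<Union>i<N. D i) = UNIV"
  proof (intro equalityI subsetI UNIV_I)
    fix p
    have ex: "\<exists>i. i < N \<and> p \<in> chart_dom (cs i)" using C(3) cs by auto
    define i where "i = (LEAST i. i < N \<and> p \<in> chart_dom (cs i))"
    have "i < N \<and> p \<in> chart_dom (cs i)" unfolding i_def by (rule LeastI_ex[OF ex])
    moreover have "p \<notin> chart_dom (cs j)" if "j < i" for j
      using not_less_Least[of j "\<lambda>i. i < N \<and> p \<in> chart_dom (cs i)"] that calculation by (auto simp: i_def)
    ultimately show "p \<in> (\<Union>i<N. D i)" by (auto simp: D_def)
  qed
  define M where "M B = (\<Sum>i<N. emeasure (chart_measure (cs i)) (B \<inter> D i))" for B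
  define m where "m = measure_of UNIV (sets borel) M"
  have sm: "sets m = sets borel"
    unfolding m_def using sets.sigma_sets_eq[of borel] by (simp add: sets_measure_of)
  have M: "emeasure m B = M B" if "B \<in> sets borel" for B
  proof (rule emeasure_measure_of[OF m_def])
    show "positive (sets m) M" by (simp add: positive_def M_def)
    show "countably_additive (sets m) M"
    proof (rule countably_additiveI)
      fix E :: "nat \<Rightarrow> 'a set"
      assume E: "range E \<subseteq> sets m" "disjoint_family E"
      have "(\<Sum>k. emeasure (chart_measure (cs i)) (E k \<inter> D i)) = emeasure (chart_measure (cs i)) (\<Union>(range E) \<inter> D i)"
        if "i < N" for i
      proof -
        have "(\<Sum>k. emeasure (chart_measure (cs i)) (E k \<inter> D i)) = emeasure (chart_measure (cs i)) (\<Union>k. E k \<inter> D i)"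
          using E D_borel[OF that] unfolding sm
          by (intro suminf_emeasure) (auto simp: sets_chart_measure disjoint_family_on_def)
        then show ?thesis by (simp only: UN_simps)
      qed
      then show "(\<Sum>k. M (E k)) = M (\<Union>(range E))"
        unfolding M_def by (subst suminf_sum) (auto intro: summableI)
    qed
  qed (use that sm in auto)
  have "is_vol_measure m"
    unfolding is_vol_measure_def
  proof (intro conjI ballI impI)
    fix c B assume c: "c \<in> A" and B: "B \<in> sets borel" "B \<subseteq> chart_dom c"
    have "emeasure m B = (\<Sum>i<N. emeasure (chart_measure c) (B \<inter> D i))"
      unfolding M[OF B(1)] M_def
    proof (rule sum.cong)
      fix i assume "i \<in> {..<N}"
      then have i: "i < N" by simp
      have b: "B \<inter> D i \<in> sets borel" using B D_borel[OF i] by simp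
      have s: "B \<inter> D i \<subseteq> chart_dom (cs i)" "B \<inter> D i \<subseteq> chart_dom c" using B by (auto simp: D_def)
      show "emeasure (chart_measure (cs i)) (B \<inter> D i) = emeasure (chart_measure c) (B \<inter> D i)"
        using emeasure_chart_measure[OF csA[OF i] b] emeasure_chart_measure[OF c b]
          chart_mass_eq[OF c csA[OF i] s(2,1) b] s by (simp only: Int_absorb1)
    qed simp
    also have "\<dots> = emeasure (chart_measure c) (\<Union>i<N. B \<inter> D i)"
      using B D_borel D_disj
      by (intro sum_emeasure) (fastforce simp: sets_chart_measure disjoint_family_on_def)+
    also have "(\<Union>i<N. B \<inter> D i) = B" using D_cover by auto
    also have "emeasure (chart_measure c) B = chart_mass c B"
      using emeasure_chart_measure[OF c B(1)] B(2) by (simp only: Int_absorb1)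
    finally show "emeasure m B = chart_mass c B" .
  qed (rule sm)
  then show ?thesis by blast
qed

lemma is_vol_measure_unique:
  assumes "is_vol_measure m" "is_vol_measure m'"
  shows "m = m'"
proof -
  obtain C where C: "finite C" "C \<subseteq> A" "(\<Union>c\<in>C. chart_dom c) = UNIV" by (rule finite_chart_cover)
  show ?thesis
  proof (rule measure_eqI_open_cover)
    show "sets m = sets borel" "sets m' = sets borel"
      using is_vol_measureD(1) assms by simp_all
    show "finite (chart_dom ` C)" "\<Union>(chart_dom ` C) = UNIV" using C by blast+
    show "open U" if "U \<in> chart_dom ` C" for U using that open_dom C(2) by blast
    fix U B assume "U \<in> chart_dom ` C" and B: "B \<in> sets borel" "B \<subseteq> U"
    then obtain c where "c \<in> A" "U = chart_dom c" using C(2) by blast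
    then show "emeasure m B = emeasure m' B"
      using is_vol_measureD(2)[OF assms(1), of c B] is_vol_measureD(2)[OF assms(2), of c B] B by simp
  qed
qed

lemma is_vol_measure_vol_measure: "is_vol_measure (vol_measure A \<mu>)"
proof -
  have "vol_measure A \<mu> = (THE m. is_vol_measure m)"
    unfolding vol_measure_def is_vol_measure_def chart_mass_def chart_density_def ..
  moreover have "\<exists>!m. is_vol_measure m"
    using is_vol_measure_exists is_vol_measure_unique by blast
  ultimately show ?thesis by (simp only: theI')
qed

lemma sets_vol_measure: "sets (vol_measure A \<mu>) = sets borel"
  and emeasure_vol_measure:
    "c \<in> A \<Longrightarrow> B \<in> sets borel \<Longrightarrow> B \<subseteq> chart_dom c \<Longrightarrow> emeasure (vol_measure A \<mu>) B = chart_mass c B"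
  using is_vol_measureD[OF is_vol_measure_vol_measure] by simp_all

section \<open>Invariance, finiteness and positivity of the measure\<close>

text \<open>The finite open cover consists of the sets where \<open>p\<close> lies in one chart and
  \<open>F p\<close> in another; there the invariance of \<open>chart_mass\<close> applies directly.
  The preimage of \<open>B\<close> under \<open>inv F\<close> is its image under
  \<open>F\<close>.\<close>

lemma distr_vol_measure:
  assumes F: "bij F" "differentiable_map A F" "continuous_on UNIV (inv F)" "pullback A CARD('k) F \<mu> = \<mu>"
  shows "distr (vol_measure A \<mu>) borel (inv F) = vol_measure A \<mu>"
proof -
  let ?m = "vol_measure A \<mu>"
  obtain C where C: "finite C" "C \<subseteq> A" "(\<Union>c\<in>C. chart_dom c) = UNIV" by (rule finite_chart_cover)
  let ?\<U> = "{chart_dom c \<inter> F -` chart_dom d | c d. c \<in> C \<and> d \<in> C}"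
  have contF: "continuous_on UNIV F" using F(2) unfolding differentiable_map_def by blast
  have meas: "inv F \<in> measurable ?m borel"
    using borel_measurable_continuous_onI[OF F(3)] by (simp add: measurable_cong_sets[OF sets_vol_measure refl])
  have im: "inv F -` B = F ` B" for B
    using bij_vimage_eq_inv_image[OF bij_imp_bij_inv[OF F(1)], of B] inv_inv_eq[OF F(1)] by simp
  have FB: "F ` B \<in> sets borel" if "B \<in> sets borel" for B
    using measurable_sets[OF borel_measurable_continuous_onI[OF F(3)] that] im by simp
  have sp: "space ?m = UNIV"
    using sets_eq_imp_space_eq[OF sets_vol_measure] by simp
  show ?thesis
  proof (rule measure_eqI_open_cover)
    show "finite ?\<U>" using C(1) by (intro finite_image_set2) simp_all
    show "\<Union>?\<U> = UNIV"
    proof (intro equalityI subsetI UNIV_I)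
      fix p
      obtain c d where "c \<in> C" "p \<in> chart_dom c" "d \<in> C" "F p \<in> chart_dom d" using C(3) by blast
      then show "p \<in> \<Union>?\<U>" by blast
    qed
    show "open U" if U: "U \<in> ?\<U>" for U
    proof -
      obtain c d where cd: "c \<in> C" "d \<in> C" "U = chart_dom c \<inter> F -` chart_dom d"
        using U by blast
      have "open (chart_dom c)" "open (chart_dom d)" using open_dom cd C(2) by blast+
      moreover from this have "open (F -` chart_dom d)"
        using contF by (simp add: continuous_on_open_vimage)
      ultimately show ?thesis unfolding cd(3) by blast
    qed
    fix U B assume "U \<in> ?\<U>" and B: "B \<in> sets borel" "B \<subseteq> U"
    from \<open>U \<in> ?\<U>\<close> obtain c d where "c \<in> C" "d \<in> C" "U = chart_dom c \<inter> F -` chart_dom d"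
      by blast
    then have cd: "c \<in> A" "d \<in> A" "B \<subseteq> chart_dom c" "F ` B \<subseteq> chart_dom d" using B(2) C(2) by blast+
    have "emeasure (distr ?m borel (inv F)) B = emeasure ?m (F ` B)"
      using emeasure_distr[OF meas B(1)] by (simp add: sp im)
    also have "\<dots> = chart_mass d (F ` B)" using cd FB[OF B(1)] by (intro emeasure_vol_measure) auto
    also have "\<dots> = chart_mass c B"
      using cd B(1) FB[OF B(1)] F bij_is_inj by (intro chart_mass_invariant) auto
    also have "\<dots> = emeasure ?m B" using cd B by (intro emeasure_vol_measure[symmetric]) auto
    finally show "emeasure (distr ?m borel (inv F)) B = emeasure ?m B" .
  qed (simp_all add: sets_vol_measure)
qed

text \<open>A coordinate ball whose closure stays in the chart image has bounded density, hence
  finite mass. By compactness finitely many such balls cover the manifold.\<close>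

lemma finite_vol_measure: "emeasure (vol_measure A \<mu>) UNIV < \<infinity>"
proof -
  let ?m = "vol_measure A \<mu>"
  have "\<exists>V. open V \<and> p \<in> V \<and> emeasure ?m V < \<infinity>" for p
  proof -
    obtain c where c: "c \<in> A" "p \<in> chart_dom c" by (rule chart_exists)
    obtain r where r: "r > 0" "cball (coords c p) r \<subseteq> chart_img c"
      using open_contains_cball[of "chart_img c"] open_img[OF c(1)] coords_in_img[OF c] by blast
    let ?K = "cball (coords c p) r" and ?O = "ball (coords c p) r"
    let ?V = "chart_inv c ` ?O"
    have OK: "?O \<subseteq> chart_img c" using r ball_subset_cball by blast
    have V: "?V = chart_dom c \<inter> coords c -` ?O"
    proof (intro equalityI subsetI)
      fix q assume "q \<in> chart_dom c \<inter> coords c -` ?O"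
      then show "q \<in> ?V"
        using inv_coords[OF c(1), of q] by (intro image_eqI[of _ _ "coords c q"]) auto
    next
      fix q assume "q \<in> ?V"
      then obtain x where x: "x \<in> ?O" "q = chart_inv c x" by blast
      then have "x \<in> chart_img c" using OK by blast
      then show "q \<in> chart_dom c \<inter> coords c -` ?O"
        using x inv_in_dom[OF c(1)] coords_inv[OF c(1)] by simp
    qed
    have oV: "open ?V"
      unfolding V using continuous_open_preimage[OF cont_coords open_dom] c by blast
    have "coords c (chart_inv c x) = x" if "x \<in> ?O" for x
      using OK coords_inv[OF c(1)] that by blast
    then have "coords c ` ?V = (\<lambda>x. x) ` ?O"
      unfolding image_image by (rule image_cong[OF refl])
    then have cV: "coords c ` ?V = ?O" by simp
    have "continuous_on ?K (chart_density c)"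
      using continuous_on_subset[OF continuous_chart_density[OF c(1)] r(2)] .
    then have "bounded (chart_density c ` ?K)"
      by (intro compact_imp_bounded compact_continuous_image) auto
    then obtain b where "\<forall>y\<in>chart_density c ` ?K. norm y \<le> b"
      unfolding bounded_iff by blast
    then have b: "chart_density c x \<le> b" if "x \<in> ?K" for x
    proof -
      have "norm (chart_density c x) \<le> b" using \<open>\<forall>y\<in>_. norm y \<le> b\<close> that by blast
      then show ?thesis unfolding real_norm_def by linarith
    qed
    have "emeasure ?m ?V = chart_mass c ?V"
      using oV V by (intro emeasure_vol_measure[OF c(1)]) auto
    also have "\<dots> \<le> (\<integral>\<^sup>+ x. ennreal b * indicator ?O x \<partial>lborel)"
      unfolding chart_mass_def cV using b
      by (intro nn_integral_mono) (simp add: indicator_def ennreal_leI)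
    also have "\<dots> = ennreal b * emeasure lborel ?O"
      by (rule nn_integral_cmult_indicator) simp
    also have "\<dots> < \<infinity>"
      using emeasure_bounded_finite[OF bounded_ball, of "coords c p" r] by (simp add: ennreal_mult_less_top)
    finally have "emeasure ?m ?V < \<infinity>" .
    moreover have "p \<in> ?V" using V c r by simp
    ultimately show ?thesis using oV by blast
  qed
  then obtain V where V: "\<And>p. open (V p)" "\<And>p. p \<in> V p" "\<And>p. emeasure ?m (V p) < \<infinity>" by metis
  have "UNIV \<subseteq> (\<Union>p\<in>UNIV. V p)" using V(2) by blast
  obtain P where P: "finite P" "UNIV \<subseteq> (\<Union>p\<in>P. V p)"
    by (rule compactE_image[OF compact_mfd V(1) \<open>UNIV \<subseteq> (\<Union>p\<in>UNIV. V p)\<close>])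
  have "emeasure ?m UNIV \<le> emeasure ?m (\<Union>p\<in>P. V p)"
    using V(1) by (intro emeasure_mono P) (auto simp: sets_vol_measure intro!: borel_open open_UN)
  also have "\<dots> \<le> (\<Sum>p\<in>P. emeasure ?m (V p))"
    using V(1) by (intro emeasure_subadditive_finite P) (auto simp: sets_vol_measure)
  also have "\<dots> < \<infinity>" using V(3) P(1) by (simp add: less_top[symmetric])
  finally show ?thesis .
qed

text \<open>The density is positive in each chart, so mass zero would make a nonempty open set of
  coordinates negligible. For continuous functions this turns vanishing almost everywhere into
  vanishing everywhere.\<close>

lemma vol_measure_open_pos:
  assumes "open V" "V \<noteq> {}"
  shows "emeasure (vol_measure A \<mu>) V \<noteq> 0"
proof
  assume z: "emeasure (vol_measure A \<mu>) V = 0"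
  obtain p where p: "p \<in> V" using assms(2) by blast
  obtain c where c: "c \<in> A" "p \<in> chart_dom c" by (rule chart_exists)
  let ?W = "chart_dom c \<inter> V" and ?O = "coords c ` (chart_dom c \<inter> V)"
  have O: "open ?O" "coords c p \<in> ?O" "?O \<subseteq> chart_img c"
    using open_coords_image[OF c(1) assms(1)] c p coords_in_img[OF c(1)] by auto
  have "emeasure (vol_measure A \<mu>) ?W \<le> emeasure (vol_measure A \<mu>) V"
    using assms by (intro emeasure_mono) (auto simp: sets_vol_measure)
  then have "chart_mass c ?W = 0"
    using z emeasure_vol_measure[OF c(1), of ?W] assms(1) open_dom[OF c(1)] by (auto simp: open_Int)
  then have i0: "(\<integral>\<^sup>+ x\<in>?O. ennreal (chart_density c x) \<partial>lborel) = 0" by (simp add: chart_mass_def)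
  have m: "(\<lambda>x. ennreal (indicator ?O x *\<^sub>R chart_density c x)) \<in> borel_measurable lborel"
    using chart_density_indicator_measurable[OF c(1) _ O(3)] O(1) by simp
  have e: "(\<lambda>x. ennreal (chart_density c x) * indicator ?O x) = (\<lambda>x. ennreal (indicator ?O x *\<^sub>R chart_density c x))"
    by (auto simp: indicator_def)
  have "AE x in lborel. ennreal (indicator ?O x *\<^sub>R chart_density c x) = 0"
    using i0 m unfolding e by (simp add: nn_integral_0_iff_AE)
  then have "AE x in lborel. x \<notin> ?O"
    by eventually_elim (use chart_density_pos[OF c(1)] O(3) in \<open>force simp: indicator_def split: if_splits\<close>)
  then have "?O \<in> null_sets lborel"
    using O(1) by (subst (asm) AE_iff_null_sets[symmetric]) auto
  then have "negligible ?O"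
    unfolding negligible_iff_null_sets by (rule null_sets_completionI)
  then show False using open_not_negligible[OF O(1)] O(2) by blast
qed

end

end

section \<open>Smooth functions and forms\<close>

lemma smooth_on_iter_deriv: "smooth_on f S \<Longrightarrow> smooth_on (iter_deriv f vs) S"
  by (induction vs) (auto intro: smooth_on_derivative)

lemma iter_deriv_add_scaled:
  fixes f g :: "'b::real_normed_vector \<Rightarrow> real"
  assumes "open S" "smooth_on f S" "smooth_on g S" "x \<in> S"
  shows "iter_deriv (\<lambda>x. f x + t * g x) vs x = iter_deriv f vs x + t * iter_deriv g vs x"
  using assms(4)
proof (induction vs arbitrary: x)
  case Nil
  then show ?case by simp
next
  case (Cons v vs)
  have df: "iter_deriv f vs differentiable (at x)" "iter_deriv g vs differentiable (at x)"
    using assms(2,3) Cons.prems by (auto intro: smooth_on_differentiable smooth_on_iter_deriv)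
  have "frechet_derivative (iter_deriv (\<lambda>x. f x + t * g x) vs) (at x) =
     frechet_derivative (\<lambda>x. iter_deriv f vs x + t * iter_deriv g vs x) (at x)"
    by (rule frechet_derivative_cong_open[OF assms(1) Cons.prems Cons.IH])
  also have "((\<lambda>x. iter_deriv f vs x + t * iter_deriv g vs x) has_derivative
     (\<lambda>v. frechet_derivative (iter_deriv f vs) (at x) v + t * frechet_derivative (iter_deriv g vs) (at x) v)) (at x)"
    using df by (intro has_derivative_add has_derivative_mult_right) (auto simp: frechet_derivative_works)
  from frechet_derivative_at[OF this, symmetric]
  have "frechet_derivative (\<lambda>x. iter_deriv f vs x + t * iter_deriv g vs x) (at x) =
     (\<lambda>v. frechet_derivative (iter_deriv f vs) (at x) v + t * frechet_derivative (iter_deriv g vs) (at x) v)" .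
  finally show ?case by simp
qed

text \<open>On a compact set the gap below \<open>e\<close> is bounded away from zero and
  \<open>b\<close> is bounded. The lemma keeps perturbed densities nowhere zero, and inside a given
  neighbourhood of the smooth topology.\<close>

lemma eventually_at_0_less_on_compact:
  fixes a b :: "'b::topological_space \<Rightarrow> real"
  assumes K: "compact K" and a: "continuous_on K a" and b: "continuous_on K b"
    and less: "\<And>x. x \<in> K \<Longrightarrow> a x < e"
  shows "\<forall>\<^sub>F t in at 0. \<forall>x\<in>K. a x + \<bar>t * b x\<bar> < e"
proof (cases "K = {}")
  case False
  obtain x1 where x1: "x1 \<in> K" "\<And>x. x \<in> K \<Longrightarrow> a x \<le> a x1"
    using continuous_attains_sup[OF K False a] by blast
  have "continuous_on K (\<lambda>x. \<bar>b x\<bar>)" using b by (rule continuous_on_rabs)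
  from continuous_attains_sup[OF K False this]
  obtain x2 where x2: "x2 \<in> K" "\<And>x. x \<in> K \<Longrightarrow> \<bar>b x\<bar> \<le> \<bar>b x2\<bar>" by blast
  have "((\<lambda>t. \<bar>t\<bar> * \<bar>b x2\<bar>) \<longlongrightarrow> \<bar>0\<bar> * \<bar>b x2\<bar>) (at 0)" by (intro tendsto_intros)
  moreover have "\<bar>0\<bar> * \<bar>b x2\<bar> < e - a x1" using less[OF x1(1)] by simp
  ultimately have "\<forall>\<^sub>F t in at 0. \<bar>t\<bar> * \<bar>b x2\<bar> < e - a x1" by (rule order_tendstoD)
  then show ?thesis
  proof eventually_elim
    fix t assume t: "\<bar>t\<bar> * \<bar>b x2\<bar> < e - a x1"
    show "\<forall>x\<in>K. a x + \<bar>t * b x\<bar> < e"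
    proof
      fix x assume x: "x \<in> K"
      have "\<bar>t * b x\<bar> \<le> \<bar>t\<bar> * \<bar>b x2\<bar>"
        using x2(2)[OF x] by (simp add: abs_mult mult_left_mono)
      then show "a x + \<bar>t * b x\<bar> < e" using t x1(2)[OF x] by linarith
    qed
  qed
qed simp

lemma flat_0_less: "0 < x \<Longrightarrow> x < y \<Longrightarrow> flat 0 x < flat 0 y"
  by (simp add: flat_def divide_inverse)

context manifold
begin

lemma smooth_fun_const: "smooth_fun A (\<lambda>_. r)"
  unfolding smooth_fun_def by (simp add: o_def smooth_on_const)

lemma smooth_fun_add: "smooth_fun A f \<Longrightarrow> smooth_fun A g \<Longrightarrow> smooth_fun A (\<lambda>p. f p + g p)"
  unfolding smooth_fun_def using open_img by (auto simp: o_def intro!: smooth_on_add)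

lemma smooth_fun_mult: "smooth_fun A f \<Longrightarrow> smooth_fun A g \<Longrightarrow> smooth_fun A (\<lambda>p. f p * g p)"
  unfolding smooth_fun_def using open_img by (auto simp: o_def intro!: smooth_on_mult)

lemma smooth_fun_power: "smooth_fun A f \<Longrightarrow> smooth_fun A (\<lambda>p. f p ^ k)"
  by (induction k) (auto intro: smooth_fun_const smooth_fun_mult)

lemma smooth_fun_sum: "(\<And>i. i \<in> I \<Longrightarrow> smooth_fun A (f i)) \<Longrightarrow> smooth_fun A (\<lambda>p. \<Sum>i\<in>I. f i p)"
  by (induction I rule: infinite_finite_induct) (auto intro: smooth_fun_const smooth_fun_add)

lemma smooth_fun_continuous:
  assumes "smooth_fun A f"
  shows "continuous_on UNIV f"
proof -
  have "continuous_on (chart_dom c) f" if c: "c \<in> A" for c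
  proof -
    have "continuous_on (chart_img c) (f \<circ> chart_inv c)"
      using assms c smooth_on_continuous unfolding smooth_fun_def by blast
    then have "continuous_on (chart_dom c) (\<lambda>p. (f \<circ> chart_inv c) (coords c p))"
      by (rule continuous_on_compose2[OF _ cont_coords[OF c]]) (auto simp: coords_in_img[OF c])
    then show ?thesis
      by (rule continuous_on_eq) (simp add: inv_coords[OF c])
  qed
  then have "continuous_on (\<Union>c\<in>A. chart_dom c) f"
    by (intro continuous_on_open_UN open_dom) auto
  then show ?thesis using atlas unfolding smooth_atlas_def by simp
qed

lemma smooth_form_scaled:
  assumes "smooth_fun A f" "smooth_form A k \<eta>"
  shows "smooth_form A k (\<lambda>p vs. f p * \<eta> p vs)"
  unfolding smooth_form_def
proof (intro conjI allI ballI impI)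
  fix p
  have "alternating A k p (\<eta> p)" using assms(2) unfolding smooth_form_def by blast
  then show "alternating A k p (\<lambda>vs. f p * \<eta> p vs)"
    unfolding alternating_def by (simp add: algebra_simps)
next
  fix c and es :: "'e list" assume c: "c \<in> A" and es: "length es = k"
  have "smooth_on (f \<circ> chart_inv c) (chart_img c)" "smooth_on (component A c \<eta> es) (chart_img c)"
    using assms c es unfolding smooth_fun_def smooth_form_def by blast+
  from smooth_on_mult[OF open_img[OF c] this] show "smooth_on (component A c (\<lambda>p vs. f p * \<eta> p vs) es) (chart_img c)"
    by (simp add: component_def[abs_def] o_def)
qed

lemma smooth_form_add_scaled:
  assumes "smooth_form A k \<nu>" "smooth_form A k \<xi>"
  shows "smooth_form A k (\<lambda>p vs. \<nu> p vs + t * \<xi> p vs)"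
  unfolding smooth_form_def
proof (intro conjI allI ballI impI)
  fix p
  have "alternating A k p (\<nu> p)" "alternating A k p (\<xi> p)"
    using assms unfolding smooth_form_def by blast+
  then show "alternating A k p (\<lambda>vs. \<nu> p vs + t * \<xi> p vs)"
    unfolding alternating_def by (simp add: algebra_simps)
next
  fix c and es :: "'e list" assume c: "c \<in> A" and "length es = k"
  then have "smooth_on (\<lambda>x. component A c \<nu> es x + t * component A c \<xi> es x) (chart_img c)"
    using assms open_img[OF c] unfolding smooth_form_def
    by (intro smooth_on_add smooth_on_mult smooth_on_const) auto
  then show "smooth_on (component A c (\<lambda>p vs. \<nu> p vs + t * \<xi> p vs) es) (chart_img c)"
    by (simp add: component_def[abs_def])
qed

text \<open>The witness is the bump function \<open>exp (- 1 / (r\<^sup>2 - |x - x\<^sub>0|\<^sup>2))\<close> of a chart, extended by zero.\<close>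

lemma smooth_fun_infinite_range: "\<exists>f. smooth_fun A f \<and> infinite (range f)"
proof -
  obtain p0 :: 'a where "p0 \<in> UNIV" by blast
  obtain c where c: "c \<in> A" "p0 \<in> chart_dom c" by (rule chart_exists)
  define x0 where "x0 = coords c p0"
  obtain r where r: "r > 0" "cball x0 r \<subseteq> chart_img c"
    using open_contains_cball[of "chart_img c"] open_img[OF c(1)] coords_in_img[OF c] x0_def by blast
  define s where "s x = r\<^sup>2 - (x - x0) \<bullet> (x - x0)" for x
  define f where "f p = (if p \<in> chart_dom c then flat 0 (s (coords c p)) else 0)" for p
  define K where "K = chart_inv c ` cball x0 r"
  have "compact K"
    unfolding K_def using cont_inv[OF c(1)] r(2)
    by (intro compact_continuous_image compact_cball) (rule continuous_on_subset)
  \<comment> \<open>The Hausdorff property makes the compact \<open>K\<close> closed, so smoothness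
    outside \<open>K\<close> is that of zero on an open set.\<close>
  then have K: "open (- K)" by (simp add: compact_imp_closed open_closed)
  have fK: "f p = 0" if "p \<notin> K" for p
  proof (cases "p \<in> chart_dom c")
    case True
    then have "coords c p \<notin> cball x0 r"
      using that inv_coords[OF c(1) True] unfolding K_def by (metis imageI)
    then have "r < norm (coords c p - x0)" by (simp add: dist_norm norm_minus_commute)
    then have "r\<^sup>2 \<le> (norm (coords c p - x0))\<^sup>2" using r(1) by (intro power_mono) auto
    then have "\<not> 0 < s (coords c p)" by (simp add: s_def power2_norm_eq_inner)
    then show ?thesis by (simp add: f_def flat_def)
  qed (simp add: f_def)
  have "smooth_fun A f"
    unfolding smooth_fun_def
  proof
    fix d assume d: "d \<in> A"
    let ?O1 = "coords d ` (chart_dom d \<inter> chart_dom c)" and ?O2 = "coords d ` (chart_dom d \<inter> - K)"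
    have O: "open ?O1" "open ?O2" using open_coords_image[OF d] open_dom[OF c(1)] K by blast+
    \<comment> \<open>\<open>K\<close> lies inside the domain of \<open>c\<close>, so the region of
      the formula and the region of zero values overlap and cover the manifold.\<close>
    have "chart_inv d x \<in> chart_dom c \<or> chart_inv d x \<in> - K" for x
      using inv_in_dom[OF c(1)] r(2) by (auto simp: K_def)
    then have un: "?O1 \<union> ?O2 = chart_img d"
      unfolding chart_inv_vimage[OF d] by blast
    have "smooth_on (\<lambda>x. r\<^sup>2 + (- 1) * (((coords c \<circ> chart_inv d) x + (- x0)) \<bullet> ((coords c \<circ> chart_inv d) x + (- x0)))) ?O1"
      using smooth_transition[OF d c(1)] O(1)
      by (intro smooth_on_add smooth_on_mult smooth_on_inner smooth_on_const)
    then have "smooth_on (\<lambda>x. s (coords c (chart_inv d x))) ?O1"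
      by (simp add: s_def)
    then have "smooth_on (\<lambda>x. flat 0 (s (coords c (chart_inv d x)))) ?O1"
      using Ck_on_flat[OF O(1)] unfolding smooth_on_def by blast
    then have 1: "smooth_on (f \<circ> chart_inv d) ?O1"
    proof (rule smooth_on_cong[OF O(1), rotated])
      fix x assume "x \<in> ?O1"
      then show "flat 0 (s (coords c (chart_inv d x))) = (f \<circ> chart_inv d) x"
        unfolding chart_inv_vimage[OF d] by (simp add: f_def)
    qed
    have 2: "smooth_on (f \<circ> chart_inv d) ?O2"
    proof (rule smooth_on_cong[OF O(2) _ smooth_on_const[of 0]])
      fix x assume "x \<in> ?O2"
      then show "0 = (f \<circ> chart_inv d) x"
        unfolding chart_inv_vimage[OF d] by (simp add: fK)
    qed
    show "smooth_on (f \<circ> chart_inv d) (chart_img d)"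
      using smooth_on_Un[OF O 1 2] un by simp
  qed
  moreover have "infinite (range f)"
  proof -
    \<comment> \<open>The values strictly decrease along a ray from the centre; a direction
      \<open>e\<close> exists because the model space has positive dimension.\<close>
    obtain e :: 'e where e: "e \<in> Basis" using nonempty_Basis by blast
    have val: "f (chart_inv c (x0 + a *\<^sub>R e)) = flat 0 (r\<^sup>2 - a\<^sup>2)" if "0 \<le> a" "a < r" for a
    proof -
      have "x0 + a *\<^sub>R e \<in> cball x0 r" using that e by (simp add: dist_norm)
      then have "x0 + a *\<^sub>R e \<in> chart_img c" using r(2) by blast
      then show ?thesis
        using inv_in_dom[OF c(1)] coords_inv[OF c(1)] e by (simp add: f_def s_def power2_eq_square)
    qed
    have "inj_on (\<lambda>a. f (chart_inv c (x0 + a *\<^sub>R e))) {0..<r}"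
    proof (rule linorder_inj_onI)
      fix a b assume "a < b" and ab: "a \<in> {0..<r}" "b \<in> {0..<r}"
      then have "a\<^sup>2 < b\<^sup>2" "b\<^sup>2 < r\<^sup>2" by (auto intro!: power_strict_mono)
      then show "f (chart_inv c (x0 + a *\<^sub>R e)) \<noteq> f (chart_inv c (x0 + b *\<^sub>R e))"
        using flat_0_less[of "r\<^sup>2 - b\<^sup>2" "r\<^sup>2 - a\<^sup>2"] val ab by simp
    qed auto
    then have "infinite ((\<lambda>a. f (chart_inv c (x0 + a *\<^sub>R e))) ` {0..<r})"
      using r(1) by (simp add: finite_image_iff)
    then show ?thesis by (rule infinite_super[rotated]) blast
  qed
  ultimately show ?thesis by blast
qed

end

section \<open>Densities as multiples of the Liouville form\<close>

context symplectic_manifold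
begin

lemma smooth_form_liouville: "smooth_form A (2 * n) liouville"
  using symplectic smooth_form_wedge_power unfolding symplectic_form_def by blast

lemma volume_form_liouville: "volume_form A CARD('k) liouville"
  unfolding volume_form_def
proof (intro conjI allI)
  show "smooth_form A CARD('k) liouville" using smooth_form_liouville dimension by simp
  fix p
  obtain c where "c \<in> A" "p \<in> chart_dom c" by (rule chart_exists)
  then show "\<exists>vs. liouville p vs \<noteq> 0" using liouville_frame_nonzero by blast
qed

abbreviation liouville_measure :: "'a measure" where
  "liouville_measure \<equiv> vol_measure A liouville"

lemmas sets_liouville_measure = sets_vol_measure[OF volume_form_liouville compact_space]

lemma space_liouville_measure: "space liouville_measure = UNIV"
  using sets_eq_imp_space_eq[OF sets_liouville_measure] by simp

abbreviation theta :: "('a, (real, 'k) vec) form \<Rightarrow> 'a \<Rightarrow> real" where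
  "theta \<nu> \<equiv> ratio \<nu> liouville"

lemma theta_eqI:
  assumes "\<And>p vs. \<nu> p vs = \<theta> p * liouville p vs"
  shows "theta \<nu> = \<theta>"
  unfolding ratio_def
proof (rule the_equality)
  show "\<forall>p vs. \<nu> p vs = \<theta> p * liouville p vs" using assms by blast
  fix \<theta>' assume *: "\<forall>p vs. \<nu> p vs = \<theta>' p * liouville p vs"
  show "\<theta>' = \<theta>"
  proof
    fix p
    obtain c where c: "c \<in> A" "p \<in> chart_dom c" by (rule chart_exists)
    have "\<theta>' p * liouville p (frame c p) = \<theta> p * liouville p (frame c p)"
      using assms * by metis
    then show "\<theta>' p = \<theta> p" using liouville_frame_nonzero[OF c] by simp
  qed
qed

text \<open>Existence for the description in \<open>ratio\<close>: at each point the Liouville form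
  spans the forms of top degree, and the factor is read off on the frame of the chosen
  chart.\<close>

lemma theta_works:
  assumes "smooth_form A (2 * n) \<nu>"
  shows "\<nu> p vs = theta \<nu> p * liouville p vs"
proof -
  define \<theta> where "\<theta> p = \<nu> p (frame (chart_at A p) p) / liouville p (frame (chart_at A p) p)" for p
  have "alternating A CARD('k) p (\<nu> p)" for p
    using assms dimension unfolding smooth_form_def by simp
  then have *: "\<nu> p vs = \<theta> p * liouville p vs" for p vs
    unfolding \<theta>_def using chart_at_in
    by (intro top_forms_proportional alternating_liouville liouville_frame_nonzero)
  show ?thesis unfolding theta_eqI[of \<nu> \<theta>, OF *] by (rule *)
qed

lemma theta_scaled: "theta (\<lambda>p vs. f p * liouville p vs) = f"
  by (rule theta_eqI) simp

lemma theta_add_scaled: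
  assumes "smooth_form A (2 * n) \<nu>" "smooth_form A (2 * n) \<xi>"
  shows "theta (\<lambda>p vs. \<nu> p vs + t * \<xi> p vs) = (\<lambda>p. theta \<nu> p + t * theta \<xi> p)"
  by (rule theta_eqI) (metis theta_works[OF assms(1)] theta_works[OF assms(2)] distrib_right mult.assoc)

lemma theta_comb:
  assumes "smooth_form A (2 * n) \<nu>" "smooth_form A (2 * n) \<xi>"
  shows "theta (\<lambda>p vs. a * \<nu> p vs + b * \<xi> p vs) = (\<lambda>p. a * theta \<nu> p + b * theta \<xi> p)"
  by (rule theta_eqI) (metis theta_works[OF assms(1)] theta_works[OF assms(2)] distrib_right mult.assoc)

lemma component_eq_theta:
  assumes "smooth_form A (2 * n) \<nu>"
  shows "component A c \<nu> es x = theta \<nu> (chart_inv c x) * component A c liouville es x"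
  unfolding component_def by (rule theta_works[OF assms])

lemma component_liouville_nonzero:
  "c \<in> A \<Longrightarrow> x \<in> chart_img c \<Longrightarrow> component A c liouville coord_frame x \<noteq> 0"
  using liouville_frame_nonzero inv_in_dom by (simp add: component_coord_frame)

lemma smooth_fun_theta:
  assumes "smooth_form A (2 * n) \<nu>"
  shows "smooth_fun A (theta \<nu>)"
  unfolding smooth_fun_def
proof
  fix c assume c: "c \<in> A"
  have len: "length (coord_frame :: (real, 'k) vec list) = 2 * n" by (simp add: coord_frame_def dimension)
  have "smooth_on (\<lambda>x. component A c \<nu> coord_frame x * inverse (component A c liouville coord_frame x)) (chart_img c)"
    using assms smooth_form_liouville c len open_img[OF c] component_liouville_nonzero[OF c]
    unfolding smooth_form_def by (intro smooth_on_mult smooth_on_inverse) auto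
  then show "smooth_on (theta \<nu> \<circ> chart_inv c) (chart_img c)"
    by (rule smooth_on_cong[OF open_img[OF c], rotated])
      (simp add: component_eq_theta[OF assms] component_liouville_nonzero[OF c])
qed

section \<open>Casimirs\<close>

lemma liouville_measure_invariant:
  assumes "G \<in> ham_group A \<omega>"
  shows "distr liouville_measure borel G = liouville_measure"
proof -
  note G = ham_group_symplectic[OF assms]
  have "pullback A CARD('k) (inv G) liouville = liouville"
    using wedge_power_pullback[of "inv G" \<omega> n] G dimension by simp
  moreover have "inv (inv G) = G" using G by (simp add: inv_inv_eq)
  moreover have "continuous_on UNIV G" using G unfolding differentiable_map_def by blast
  ultimately show ?thesis
    using distr_vol_measure[OF volume_form_liouville compact_space, of "inv G"] G bij_imp_bij_inv by metis
qed

text \<open>Invariance of the measure treats integrable functions. Applied to \<open>inv G\<close>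
  and \<open>u \<circ> G\<close>, it yields the converse, so integrability passes in both
  directions.\<close>

lemma integrable_ham_invariant:
  fixes u :: "'a \<Rightarrow> real"
  assumes "G \<in> ham_group A \<omega>"
  shows "integrable liouville_measure (u \<circ> G) \<longleftrightarrow> integrable liouville_measure u"
    and "(LINT p|liouville_measure. (u \<circ> G) p) = (LINT p|liouville_measure. u p)"
proof -
  have imp: "integrable liouville_measure (u \<circ> G) \<and>
      (LINT p|liouville_measure. (u \<circ> G) p) = (LINT p|liouville_measure. u p)"
    if "G \<in> ham_group A \<omega>" "integrable liouville_measure u" for G and u :: "'a \<Rightarrow> real"
  proof -
    have "continuous_on UNIV G"
      using ham_group_symplectic[OF that(1)] unfolding differentiable_map_def by blast
    then have G: "G \<in> measurable liouville_measure borel"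
      using borel_measurable_continuous_onI by (simp add: measurable_cong_sets[OF sets_liouville_measure refl])
    have u: "u \<in> borel_measurable borel"
      using borel_measurable_integrable[OF that(2)] by (simp add: measurable_cong_sets[OF sets_liouville_measure refl])
    show ?thesis
      using integrable_distr_eq[OF G u] integral_distr[OF G u] that(2)
      unfolding liouville_measure_invariant[OF that(1)] by (simp add: o_def)
  qed
  have inv: "inv G \<in> ham_group A \<omega>" "u \<circ> G \<circ> inv G = u"
    using assms ham_group_symplectic[OF assms] by (auto intro: ham_group.inverse simp: fun_eq_iff bij_inv_eq_iff surj_f_inv_f bij_is_surj)
  show iff: "integrable liouville_measure (u \<circ> G) \<longleftrightarrow> integrable liouville_measure u"
    using imp[OF assms, of u] imp[OF inv(1), of "u \<circ> G"] inv(2) by auto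
  show "(LINT p|liouville_measure. (u \<circ> G) p) = (LINT p|liouville_measure. u p)"
  proof (cases "integrable liouville_measure u")
    case True
    then show ?thesis using imp[OF assms] by blast
  next
    \<comment> \<open>Neither function is integrable, and both integrals have the default value
      zero.\<close>
    case False
    then show ?thesis
      using iff not_integrable_integral_eq[of liouville_measure u]
        not_integrable_integral_eq[of liouville_measure "u \<circ> G"] by metis
  qed
qed

lemma theta_pullback:
  assumes "smooth_form A (2 * n) \<nu>" "G \<in> ham_group A \<omega>"
  shows "theta (pullback A (2 * n) G \<nu>) = theta \<nu> \<circ> G"
proof (rule theta_eqI)
  fix p vs
  have inv: "pullback A (2 * n) G liouville = liouville"
    using wedge_power_pullback ham_group_symplectic[OF assms(2)] by blast
  have "pullback A (2 * n) G \<nu> p vs = theta \<nu> (G p) * pullback A (2 * n) G liouville p vs"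
    unfolding pullback_def using theta_works[OF assms(1)] by simp
  then show "pullback A (2 * n) G \<nu> p vs = (theta \<nu> \<circ> G) p * liouville p vs"
    by (simp add: inv)
qed

lemma symplectic_leaf_theta:
  assumes "\<nu> \<in> Dens A \<omega> n" "\<nu>' \<in> symplectic_leaf A \<omega> n \<nu>"
  obtains G where "G \<in> ham_group A \<omega>" "theta \<nu>' = theta \<nu> \<circ> G"
proof -
  obtain F where F: "F \<in> ham_group A \<omega>" "\<nu>' = pullback A (2 * n) (inv F) \<nu>"
    using assms(2) unfolding symplectic_leaf_def by blast
  have "smooth_form A (2 * n) \<nu>"
    using assms(1) unfolding Dens_def volume_form_def by blast
  then show ?thesis
    using that theta_pullback[OF _ ham_group.inverse[OF F(1)]] ham_group.inverse[OF F(1)] F(2) by blast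
qed

theorem casimir_C_functional: "casimir A \<omega> n (C_functional A \<omega> n h)"
  unfolding casimir_def
proof (intro ballI)
  fix \<nu> \<nu>' assume "\<nu> \<in> Dens A \<omega> n" "\<nu>' \<in> symplectic_leaf A \<omega> n \<nu>"
  then obtain G where "G \<in> ham_group A \<omega>" "theta \<nu>' = theta \<nu> \<circ> G" by (rule symplectic_leaf_theta)
  then show "C_functional A \<omega> n h \<nu>' = C_functional A \<omega> n h \<nu>"
    using integrable_ham_invariant(2)[of G "\<lambda>p. h (theta \<nu> p)"] by (simp add: C_functional_def o_def)
qed

text \<open>Convergence is itself constant on leaves: the value zero that stands for a divergent
  integral is never mixed with genuine integrals on one leaf.\<close>

theorem casimir_C_integrable: "casimir A \<omega> n (C_integrable A \<omega> n h)"
  unfolding casimir_def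
proof (intro ballI)
  fix \<nu> \<nu>' assume "\<nu> \<in> Dens A \<omega> n" "\<nu>' \<in> symplectic_leaf A \<omega> n \<nu>"
  then obtain G where "G \<in> ham_group A \<omega>" "theta \<nu>' = theta \<nu> \<circ> G" by (rule symplectic_leaf_theta)
  then show "C_integrable A \<omega> n h \<nu>' = C_integrable A \<omega> n h \<nu>"
    using integrable_ham_invariant(1)[of G "\<lambda>p. h (theta \<nu> p)"] by (simp add: C_integrable_def o_def)
qed

end

section \<open>Functional independence\<close>

context symplectic_manifold
begin

lemma integrable_smooth_fun:
  assumes "smooth_fun A f"
  shows "integrable liouville_measure f"
proof -
  interpret finite_measure liouville_measure
    using finite_vol_measure[OF volume_form_liouville compact_space]
    by (intro finite_measureI) (simp add: space_liouville_measure)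
  have cont: "continuous_on UNIV f" by (rule smooth_fun_continuous[OF assms])
  have "bounded (range f)"
    using compact_continuous_image[OF cont compact_space] compact_imp_bounded by blast
  then obtain b where b: "\<And>p. norm (f p) \<le> b" unfolding bounded_iff by blast
  have "f \<in> borel_measurable liouville_measure"
    using borel_measurable_continuous_onI[OF cont] by (simp add: measurable_cong_sets[OF sets_liouville_measure refl])
  then show ?thesis using b by (intro integrable_const_bound[of _ b]) auto
qed

abbreviation I :: "('a \<Rightarrow> real) \<Rightarrow> real" where
  "I f \<equiv> integral\<^sup>L liouville_measure f"

lemma I_add_scaled:
  "smooth_fun A f \<Longrightarrow> smooth_fun A g \<Longrightarrow> I (\<lambda>p. f p + r * g p) = I f + r * I g"
  by (simp add: integrable_smooth_fun)

lemma I_one_nonzero: "I (\<lambda>_. 1) \<noteq> 0"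
proof -
  have "emeasure liouville_measure UNIV \<noteq> 0"
    using vol_measure_open_pos[OF volume_form_liouville compact_space, of UNIV] by simp
  then show ?thesis
    using finite_vol_measure[OF volume_form_liouville compact_space]
    by (simp add: space_liouville_measure measure_def enn2real_eq_0_iff)
qed

text \<open>Tangent vectors to the normalised densities have integral zero; subtracting the mean
  turns any smooth function into the factor of such a vector.\<close>

lemma subtract_mean:
  assumes f: "smooth_fun A f"
  obtains m where "smooth_fun A (\<lambda>p. f p - m)" "I (\<lambda>p. f p - m) = 0"
proof
  let ?m = "I f / I (\<lambda>_. 1)"
  show "smooth_fun A (\<lambda>p. f p - ?m)"
    using smooth_fun_add[OF f smooth_fun_const[of "- ?m"]] by (simp only: add_uminus_conv_diff)
  have "I (\<lambda>p. f p + (- ?m) * 1) = I f + (- ?m) * I (\<lambda>_. 1)"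
    by (rule I_add_scaled[OF f smooth_fun_const])
  also have "\<dots> = 0" using I_one_nonzero by simp
  finally show "I (\<lambda>p. f p - ?m) = 0" by (simp only: mult_1_right add_uminus_conv_diff)
qed

lemma I_square_zero:
  assumes f: "smooth_fun A f" and z: "I (\<lambda>p. f p * f p) = 0"
  shows "f p = 0"
proof (rule ccontr)
  assume p: "f p \<noteq> 0"
  have "AE p in liouville_measure. f p * f p = 0"
    using integral_nonneg_eq_0_iff_AE[OF integrable_smooth_fun[OF smooth_fun_mult[OF f f]]] z by simp
  then have ae: "AE p in liouville_measure. p \<notin> {p. f p \<noteq> 0}" by simp
  have "open (f -` (- {0}))"
    using smooth_fun_continuous[OF f] by (intro open_vimage) auto
  moreover have "f -` (- {0}) = {p. f p \<noteq> 0}" by auto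
  ultimately have O: "open {p. f p \<noteq> 0}" by simp
  then have "{p. f p \<noteq> 0} \<in> sets liouville_measure" by (simp add: sets_liouville_measure)
  from iffD2[OF AE_iff_null_sets[OF this] ae]
  have "emeasure liouville_measure {p. f p \<noteq> 0} = 0" by (rule null_setsD1)
  then show False
    using vol_measure_open_pos[OF volume_form_liouville compact_space O] p by blast
qed

section \<open>Normalised densities, their tangent vectors and topology\<close>

lemma Dens_iff:
  "\<nu> \<in> Dens A \<omega> n \<longleftrightarrow> smooth_form A (2 * n) \<nu> \<and> (\<forall>p. theta \<nu> p \<noteq> 0) \<and> I (theta \<nu>) = 1"
proof (cases "smooth_form A (2 * n) \<nu>")
  case True
  have "(\<exists>vs. \<nu> p vs \<noteq> 0) \<longleftrightarrow> theta \<nu> p \<noteq> 0" for p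
  proof -
    obtain c where "c \<in> A" "p \<in> chart_dom c" by (rule chart_exists)
    then have "\<exists>vs. liouville p vs \<noteq> 0" using liouville_frame_nonzero by blast
    moreover have "\<nu> p vs \<noteq> 0 \<longleftrightarrow> theta \<nu> p \<noteq> 0 \<and> liouville p vs \<noteq> 0" for vs
      by (subst theta_works[OF True]) simp
    ultimately show ?thesis by blast
  qed
  then show ?thesis
    using True unfolding Dens_def volume_form_def form_integral_def mem_Collect_eq by blast
qed (simp add: Dens_def volume_form_def)

lemma dens_tangent_iff:
  "\<xi> \<in> dens_tangent A \<omega> n \<longleftrightarrow> smooth_form A (2 * n) \<xi> \<and> I (theta \<xi>) = 0"
  unfolding dens_tangent_def form_integral_def by blast

lemma scaled_liouville_in_dens_tangent:
  "smooth_fun A f \<Longrightarrow> I f = 0 \<Longrightarrow> (\<lambda>p vs. f p * liouville p vs) \<in> dens_tangent A \<omega> n"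
  by (simp add: dens_tangent_iff theta_scaled smooth_form_scaled smooth_form_liouville)

abbreviation perturb :: "('a, (real, 'k) vec) form \<Rightarrow> ('a, (real, 'k) vec) form \<Rightarrow> real \<Rightarrow> ('a, (real, 'k) vec) form" where
  "perturb \<nu> \<xi> t \<equiv> (\<lambda>p vs. \<nu> p vs + t * \<xi> p vs)"

lemma eventually_perturb_in_Dens:
  assumes \<nu>: "\<nu> \<in> Dens A \<omega> n" and \<xi>: "\<xi> \<in> dens_tangent A \<omega> n"
  shows "\<forall>\<^sub>F t in at 0. perturb \<nu> \<xi> t \<in> Dens A \<omega> n"
proof -
  have s: "smooth_form A (2 * n) \<nu>" "smooth_form A (2 * n) \<xi>"
    using \<nu> \<xi> by (simp_all add: Dens_iff dens_tangent_iff)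
  \<comment> \<open>A perturbation smaller than the absolute value of \<open>theta \<nu>\<close> at
    every point cannot produce a zero.\<close>
  have "\<forall>\<^sub>F t in at 0. \<forall>p\<in>UNIV. - \<bar>theta \<nu> p\<bar> + \<bar>t * theta \<xi> p\<bar> < 0"
  proof (rule eventually_at_0_less_on_compact[OF compact_space])
    show "continuous_on UNIV (\<lambda>p. - \<bar>theta \<nu> p\<bar>)"
      by (intro continuous_on_minus continuous_on_rabs smooth_fun_continuous[OF smooth_fun_theta[OF s(1)]])
    show "continuous_on UNIV (theta \<xi>)"
      by (rule smooth_fun_continuous[OF smooth_fun_theta[OF s(2)]])
    show "- \<bar>theta \<nu> p\<bar> < 0" for p using \<nu> by (simp add: Dens_iff)
  qed
  then show ?thesis
  proof eventually_elim
    fix t assume t: "\<forall>p\<in>UNIV. - \<bar>theta \<nu> p\<bar> + \<bar>t * theta \<xi> p\<bar> < 0"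
    have "theta \<nu> p + t * theta \<xi> p \<noteq> 0" for p
      using t[rule_format, of p] by (auto simp: add_eq_0_iff)
    moreover have "I (\<lambda>p. theta \<nu> p + t * theta \<xi> p) = 1"
      using \<nu> \<xi> I_add_scaled[OF smooth_fun_theta[OF s(1)] smooth_fun_theta[OF s(2)]]
      by (simp add: Dens_iff dens_tangent_iff)
    ultimately show "perturb \<nu> \<xi> t \<in> Dens A \<omega> n"
      by (simp add: Dens_iff theta_add_scaled[OF s] smooth_form_add_scaled[OF s])
  qed
qed

definition subbasic where
  "subbasic \<nu>0 c es vs K \<epsilon> =
     {\<nu>\<in>Dens A \<omega> n. \<forall>x\<in>K. \<bar>iter_deriv (component A c \<nu> es) vs x - iter_deriv (component A c \<nu>0 es) vs x\<bar> < \<epsilon>}"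

lemma dens_topology_eq:
  "dens_topology A \<omega> n = topology_generated_by {subbasic \<nu>0 c es vs K \<epsilon> | \<nu>0 c es vs K \<epsilon>.
     \<nu>0 \<in> Dens A \<omega> n \<and> c \<in> A \<and> length es = 2 * n \<and> compact K \<and> K \<subseteq> chart_img c \<and> 0 < \<epsilon>}"
  unfolding dens_topology_def subbasic_def by (rule refl)

lemma openin_subbasic:
  assumes "\<nu>0 \<in> Dens A \<omega> n" "c \<in> A" "length es = 2 * n" "compact K" "K \<subseteq> chart_img c" "0 < \<epsilon>"
  shows "openin (dens_topology A \<omega> n) (subbasic \<nu>0 c es vs K \<epsilon>)"
  unfolding dens_topology_eq
  by (rule topology_generated_by_Basis, rule CollectI, rule exI[of _ \<nu>0], rule exI[of _ c],
      rule exI[of _ es], rule exI[of _ vs], rule exI[of _ K], rule exI[of _ \<epsilon>])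
    (intro conjI refl assms)

lemma topspace_dens_topology: "topspace (dens_topology A \<omega> n) = Dens A \<omega> n"
proof (intro equalityI subsetI)
  fix \<nu> assume "\<nu> \<in> topspace (dens_topology A \<omega> n)"
  then show "\<nu> \<in> Dens A \<omega> n"
    unfolding dens_topology_eq topology_generated_by_topspace by (elim UnionE CollectE exE conjE) (simp add: subbasic_def)
next
  fix \<nu> assume \<nu>: "\<nu> \<in> Dens A \<omega> n"
  obtain c where c: "c \<in> A" using chart_at_in(1) by blast
  \<comment> \<open>With the empty compact set the subbasic condition is void, so this open set
    contains every normalised density.\<close>
  have "openin (dens_topology A \<omega> n) (subbasic \<nu> c (replicate (2 * n) 0) [] {} 1)"
    by (rule openin_subbasic) (use \<nu> c in auto)
  moreover have "\<nu> \<in> subbasic \<nu> c (replicate (2 * n) 0) [] {} 1" using \<nu> by (simp add: subbasic_def)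
  ultimately show "\<nu> \<in> topspace (dens_topology A \<omega> n)" using openin_subset by blast
qed

text \<open>Straight lines are continuous at zero in the smooth topology. On a subbasic set all
  iterated derivatives are affine in \<open>t\<close>, and compactness of \<open>K\<close> gives
  uniformity.\<close>

lemma eventually_perturb_in_open:
  assumes "openin (dens_topology A \<omega> n) T" and \<nu>: "\<nu> \<in> T" and \<xi>: "\<xi> \<in> dens_tangent A \<omega> n"
  shows "\<forall>\<^sub>F t in at 0. perturb \<nu> \<xi> t \<in> T"
proof -
  have "generate_topology_on {subbasic \<nu>0 c es vs K \<epsilon> | \<nu>0 c es vs K \<epsilon>.
     \<nu>0 \<in> Dens A \<omega> n \<and> c \<in> A \<and> length es = 2 * n \<and> compact K \<and> K \<subseteq> chart_img c \<and> 0 < \<epsilon>} T"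
    using assms(1) unfolding dens_topology_eq openin_topology_generated_by_iff .
  then show ?thesis
    using \<nu>
  proof (induction T)
    case Empty
    then show ?case by simp
  next
    case (Int S T)
    then have "\<forall>\<^sub>F t in at 0. perturb \<nu> \<xi> t \<in> S \<and> perturb \<nu> \<xi> t \<in> T"
      by (intro eventually_conj) simp_all
    then show ?case by simp
  next
    case (UN \<K>)
    then obtain S where S: "S \<in> \<K>" "\<nu> \<in> S" by blast
    then have "\<forall>\<^sub>F t in at 0. perturb \<nu> \<xi> t \<in> S" using UN.IH by blast
    then show ?case by (rule eventually_mono) (use S in blast)
  next
    case (Basis S)
    then obtain \<nu>0 c es vs K \<epsilon> where S: "S = subbasic \<nu>0 c es vs K \<epsilon>" "\<nu>0 \<in> Dens A \<omega> n" "c \<in> A"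
      "length es = 2 * n" "compact K" "K \<subseteq> chart_img c" by blast
    have in_Dens: "\<nu> \<in> Dens A \<omega> n" using Basis.prems S(1) by (simp add: subbasic_def)
    let ?c = "\<lambda>\<eta>. component A c \<eta> es"
    let ?a = "\<lambda>x. \<bar>iter_deriv (?c \<nu>) vs x - iter_deriv (?c \<nu>0) vs x\<bar>"
    have smooth: "smooth_on (?c \<eta>) (chart_img c)" if "smooth_form A (2 * n) \<eta>" for \<eta>
      using that S(3,4) unfolding smooth_form_def by blast
    have sm: "smooth_on (?c \<nu>) (chart_img c)" "smooth_on (?c \<nu>0) (chart_img c)" "smooth_on (?c \<xi>) (chart_img c)"
      using smooth in_Dens S(2) \<xi> unfolding Dens_iff dens_tangent_iff by blast+
    have cont: "continuous_on K (iter_deriv h vs)" if "smooth_on h (chart_img c)" for h :: "(real, 'k) vec \<Rightarrow> real"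
      using continuous_on_subset[OF smooth_on_continuous[OF smooth_on_iter_deriv[OF that]] S(6)] .
    have less: "?a x < \<epsilon>" if "x \<in> K" for x
      using Basis.prems that unfolding S(1) subbasic_def by blast
    have "continuous_on K ?a"
      using cont[OF sm(1)] cont[OF sm(2)] by (intro continuous_on_rabs continuous_on_diff)
    then have "\<forall>\<^sub>F t in at 0. \<forall>x\<in>K. ?a x + \<bar>t * iter_deriv (?c \<xi>) vs x\<bar> < \<epsilon>"
      by (rule eventually_at_0_less_on_compact[OF S(5) _ cont[OF sm(3)]]) (rule less)
    with eventually_perturb_in_Dens[OF in_Dens \<xi>] show ?case
    proof eventually_elim
      case (elim t)
      have "\<bar>iter_deriv (?c (perturb \<nu> \<xi> t)) vs x - iter_deriv (?c \<nu>0) vs x\<bar> < \<epsilon>" if x: "x \<in> K" for x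
      proof -
        have "?c (perturb \<nu> \<xi> t) = (\<lambda>x. ?c \<nu> x + t * ?c \<xi> x)" by (simp add: component_def[abs_def])
        moreover have "x \<in> chart_img c" using x S(6) by blast
        ultimately have "iter_deriv (?c (perturb \<nu> \<xi> t)) vs x = iter_deriv (?c \<nu>) vs x + t * iter_deriv (?c \<xi>) vs x"
          using iter_deriv_add_scaled[OF open_img[OF S(3)] sm(1,3)] by simp
        moreover have "?a x + \<bar>t * iter_deriv (?c \<xi>) vs x\<bar> < \<epsilon>" using elim(2) x by blast
        ultimately show ?thesis by linarith
      qed
      then show ?case using elim(1) by (simp add: S(1) subbasic_def)
    qed
  qed
qed

text \<open>Evaluation at \<open>p\<close> is visible to a subbasic set with no derivatives and a
  single point as compact set; the radius is rescaled by the nonzero component of the Liouville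
  form.\<close>

lemma openin_theta_near:
  assumes \<nu>0: "\<nu>0 \<in> Dens A \<omega> n" and "0 < \<delta>"
  shows "openin (dens_topology A \<omega> n) {\<nu> \<in> Dens A \<omega> n. \<bar>theta \<nu> p - theta \<nu>0 p\<bar> < \<delta>}"
proof -
  obtain c where c: "c \<in> A" "p \<in> chart_dom c" by (rule chart_exists)
  let ?x = "coords c p"
  let ?l = "component A c liouville coord_frame ?x"
  have x: "?x \<in> chart_img c" "chart_inv c ?x = p" using c coords_in_img inv_coords by auto
  have l: "?l \<noteq> 0" by (rule component_liouville_nonzero[OF c(1) x(1)])
  have "\<bar>component A c \<nu> coord_frame ?x - component A c \<nu>0 coord_frame ?x\<bar> < \<delta> * \<bar>?l\<bar> \<longleftrightarrow>
      \<bar>theta \<nu> p - theta \<nu>0 p\<bar> < \<delta>" if "\<nu> \<in> Dens A \<omega> n" for \<nu>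
  proof -
    have "component A c \<nu> coord_frame ?x - component A c \<nu>0 coord_frame ?x = (theta \<nu> p - theta \<nu>0 p) * ?l"
      using that \<nu>0 component_eq_theta[of \<nu> c coord_frame ?x] component_eq_theta[of \<nu>0 c coord_frame ?x] x(2)
      by (simp add: Dens_iff left_diff_distrib)
    then show ?thesis using l by (simp add: abs_mult)
  qed
  then have "{\<nu> \<in> Dens A \<omega> n. \<bar>theta \<nu> p - theta \<nu>0 p\<bar> < \<delta>} = subbasic \<nu>0 c coord_frame [] {?x} (\<delta> * \<bar>?l\<bar>)"
    unfolding subbasic_def by (intro Collect_cong conj_cong refl) simp
  moreover have "openin (dens_topology A \<omega> n) (subbasic \<nu>0 c coord_frame [] {?x} (\<delta> * \<bar>?l\<bar>))"
    using \<nu>0 c(1) x(1) l assms(2) by (intro openin_subbasic) (simp_all add: coord_frame_def dimension)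
  ultimately show ?thesis by simp
qed

lemma openin_theta_neq: "openin (dens_topology A \<omega> n) {\<nu> \<in> Dens A \<omega> n. theta \<nu> p \<noteq> theta \<nu> q}"
  unfolding openin_subopen[of _ "{\<nu> \<in> Dens A \<omega> n. theta \<nu> p \<noteq> theta \<nu> q}"]
proof (intro ballI)
  fix \<nu>0 assume "\<nu>0 \<in> {\<nu> \<in> Dens A \<omega> n. theta \<nu> p \<noteq> theta \<nu> q}"
  then have \<nu>0: "\<nu>0 \<in> Dens A \<omega> n" and ne: "theta \<nu>0 p \<noteq> theta \<nu>0 q" by auto
  define \<delta> where "\<delta> = \<bar>theta \<nu>0 p - theta \<nu>0 q\<bar> / 2"
  have d: "0 < \<delta>" using ne by (simp add: \<delta>_def)
  let ?T = "\<lambda>p. {\<nu> \<in> Dens A \<omega> n. \<bar>theta \<nu> p - theta \<nu>0 p\<bar> < \<delta>}"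
  have "openin (dens_topology A \<omega> n) (?T p \<inter> ?T q)"
    by (intro openin_Int openin_theta_near \<nu>0 d)
  moreover have "\<nu>0 \<in> ?T p \<inter> ?T q" using \<nu>0 d by simp
  moreover have "?T p \<inter> ?T q \<subseteq> {\<nu> \<in> Dens A \<omega> n. theta \<nu> p \<noteq> theta \<nu> q}"
  proof
    fix \<nu> assume "\<nu> \<in> ?T p \<inter> ?T q"
    then have "\<nu> \<in> Dens A \<omega> n" "\<bar>theta \<nu> p - theta \<nu>0 p\<bar> < \<delta>" "\<bar>theta \<nu> q - theta \<nu>0 q\<bar> < \<delta>" by auto
    moreover from this(2,3) have "theta \<nu> p \<noteq> theta \<nu> q" unfolding \<delta>_def by (simp add: abs_if split: if_splits)
    ultimately show "\<nu> \<in> {\<nu> \<in> Dens A \<omega> n. theta \<nu> p \<noteq> theta \<nu> q}" by blast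
  qed
  ultimately show "\<exists>T. openin (dens_topology A \<omega> n) T \<and> \<nu>0 \<in> T \<and> T \<subseteq> {\<nu> \<in> Dens A \<omega> n. theta \<nu> p \<noteq> theta \<nu> q}"
    by blast
qed

section \<open>Densities with many values\<close>

text \<open>The densities whose factor takes at least \<open>N\<close> values. A witnessing set of
  points is used because the condition is visibly open once the points are fixed.\<close>

definition separating :: "nat \<Rightarrow> ('a, (real, 'k) vec) form set" where
  "separating N = {\<nu> \<in> Dens A \<omega> n. \<exists>P. finite P \<and> card P = N \<and> inj_on (theta \<nu>) P}"

lemma openin_separating: "openin (dens_topology A \<omega> n) (separating N)"
proof -
  have all: "openin (dens_topology A \<omega> n) {\<nu> \<in> Dens A \<omega> n. \<forall>(p, q)\<in>R. theta \<nu> p \<noteq> theta \<nu> q}"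
    if "finite R" for R
    using that
  proof (induction R)
    case empty
    then show ?case using openin_topspace[of "dens_topology A \<omega> n"] by (simp add: topspace_dens_topology)
  next
    case (insert r R)
    have "{\<nu> \<in> Dens A \<omega> n. \<forall>(p, q)\<in>insert r R. theta \<nu> p \<noteq> theta \<nu> q} =
       {\<nu> \<in> Dens A \<omega> n. theta \<nu> (fst r) \<noteq> theta \<nu> (snd r)} \<inter> {\<nu> \<in> Dens A \<omega> n. \<forall>(p, q)\<in>R. theta \<nu> p \<noteq> theta \<nu> q}"
      by (auto simp: case_prod_beta)
    then show ?case using openin_Int[OF openin_theta_neq insert.IH] by simp
  qed
  have "openin (dens_topology A \<omega> n) {\<nu> \<in> Dens A \<omega> n. inj_on (theta \<nu>) P}" if "finite P" for P
  proof -
    have "{\<nu> \<in> Dens A \<omega> n. inj_on (theta \<nu>) P} =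
      {\<nu> \<in> Dens A \<omega> n. \<forall>(p, q)\<in>{(p, q) \<in> P \<times> P. p \<noteq> q}. theta \<nu> p \<noteq> theta \<nu> q}"
      unfolding inj_on_def by blast
    moreover have "finite {(p, q) \<in> P \<times> P. p \<noteq> q}"
      using that by (rule finite_subset[rotated, OF finite_cartesian_product]) (use that in auto)
    ultimately show ?thesis using all[of "{(p, q) \<in> P \<times> P. p \<noteq> q}"] by (simp only:)
  qed
  then have "openin (dens_topology A \<omega> n)
      (\<Union>P\<in>{P. finite P \<and> card P = N}. {\<nu> \<in> Dens A \<omega> n. inj_on (theta \<nu>) P})"
    by (intro openin_Union) auto
  moreover have "separating N = (\<Union>P\<in>{P. finite P \<and> card P = N}. {\<nu> \<in> Dens A \<omega> n. inj_on (theta \<nu>) P})"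
    unfolding separating_def by blast
  ultimately show ?thesis by simp
qed

text \<open>A function with infinitely many values, made tangent by subtracting its mean, separates
  \<open>N\<close> points. Small multiples of it move any density into the set without leaving a
  given neighbourhood.\<close>

lemma closure_of_separating: "dens_topology A \<omega> n closure_of separating N = Dens A \<omega> n"
proof (intro equalityI subsetI)
  fix \<nu> assume "\<nu> \<in> dens_topology A \<omega> n closure_of separating N"
  then show "\<nu> \<in> Dens A \<omega> n"
    using closure_of_subset_topspace[of "dens_topology A \<omega> n"] topspace_dens_topology by blast
next
  fix \<nu> assume \<nu>: "\<nu> \<in> Dens A \<omega> n"
  obtain f where f: "smooth_fun A f" "infinite (range f)" using smooth_fun_infinite_range by blast
  obtain B where B: "finite B" "card B = N" "B \<subseteq> range f" using infinite_arbitrarily_large[OF f(2)] by blast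
  then obtain P where P: "inj_on f P" "B = f ` P"
    using subset_image_inj[of B f UNIV] by auto
  have finP: "finite P" "card P = N" using B P by (auto simp: finite_image_iff card_image)
  obtain m where m: "smooth_fun A (\<lambda>p. f p - m)" "I (\<lambda>p. f p - m) = 0"
    by (rule subtract_mean[OF f(1)])
  define \<psi> where "\<psi> = (\<lambda>p. f p - m)"
  have \<psi>: "smooth_fun A \<psi>" "I \<psi> = 0" using m by (simp_all only: \<psi>_def)
  define \<xi> where "\<xi> = (\<lambda>p vs. \<psi> p * liouville p vs)"
  have \<xi>: "\<xi> \<in> dens_tangent A \<omega> n" "theta \<xi> = \<psi>"
    unfolding \<xi>_def using scaled_liouville_in_dens_tangent[OF \<psi>] theta_scaled by auto
  have th: "theta (perturb \<nu> \<xi> t) = (\<lambda>p. theta \<nu> p + t * \<psi> p)" for t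
    using theta_add_scaled[of \<nu> \<xi> t] \<nu> \<xi> by (simp add: Dens_iff dens_tangent_iff)
  have "\<forall>\<^sub>F t in at 0. \<forall>p\<in>P. \<forall>q\<in>P. p \<noteq> q \<longrightarrow> theta \<nu> p + t * \<psi> p \<noteq> theta \<nu> q + t * \<psi> q"
  proof (intro eventually_ball_finite[OF finP(1)] ballI)
    fix p q assume pq: "p \<in> P" "q \<in> P"
    show "\<forall>\<^sub>F t in at 0. p \<noteq> q \<longrightarrow> theta \<nu> p + t * \<psi> p \<noteq> theta \<nu> q + t * \<psi> q"
    proof (cases "p = q")
      case False
      then have ne: "\<psi> p - \<psi> q \<noteq> 0" using P(1) pq by (auto simp: \<psi>_def inj_on_def)
      \<comment> \<open>Each of the finitely many pairs of points rules out a single value of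
        \<open>t\<close>.\<close>
      have "\<forall>\<^sub>F t in at 0. t \<noteq> (theta \<nu> q - theta \<nu> p) / (\<psi> p - \<psi> q)"
        by (rule eventually_neq_at_within)
      then show ?thesis
        by eventually_elim (use ne in \<open>auto simp: field_simps\<close>)
    qed simp
  qed
  then have inj: "\<forall>\<^sub>F t in at 0. inj_on (theta (perturb \<nu> \<xi> t)) P"
    by (rule eventually_mono) (auto simp: th inj_on_def)
  show "\<nu> \<in> dens_topology A \<omega> n closure_of separating N"
    unfolding in_closure_of topspace_dens_topology
  proof (intro conjI allI impI \<nu>)
    fix T assume T: "\<nu> \<in> T \<and> openin (dens_topology A \<omega> n) T"
    then have "\<forall>\<^sub>F t in at 0. perturb \<nu> \<xi> t \<in> T"
      using eventually_perturb_in_open[OF _ _ \<xi>(1)] by blast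
    with inj eventually_perturb_in_Dens[OF \<nu> \<xi>(1)]
    have "\<forall>\<^sub>F t in at 0. perturb \<nu> \<xi> t \<in> separating N \<and> perturb \<nu> \<xi> t \<in> T"
      by eventually_elim (use finP in \<open>auto simp: separating_def\<close>)
    then have "\<exists>t. perturb \<nu> \<xi> t \<in> separating N \<and> perturb \<nu> \<xi> t \<in> T"
      by (rule eventually_happens'[OF at_neq_bot])
    then show "\<exists>y. y \<in> separating N \<and> y \<in> T" by blast
  qed
qed

section \<open>Differentials of the power functionals\<close>

definition power_differential :: "('a, (real, 'k) vec) form \<Rightarrow> nat \<Rightarrow> ('a, (real, 'k) vec) form \<Rightarrow> real" where
  "power_differential \<nu> j \<xi> = I (\<lambda>p. real (j + 2) * theta \<nu> p ^ (j + 1) * theta \<xi> p)"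

text \<open>Along a line the functional is, by the binomial theorem, a polynomial in
  \<open>t\<close> with integrals as coefficients. Its linear coefficient is the
  differential.\<close>

lemma has_dens_differential_power:
  assumes \<nu>: "\<nu> \<in> Dens A \<omega> n"
  shows "has_dens_differential A \<omega> n (C_functional A \<omega> n (\<lambda>x. x ^ (j + 2))) (power_differential \<nu> j) \<nu>"
  unfolding has_dens_differential_def
proof (intro conjI ballI allI)
  have s\<nu>: "smooth_form A (2 * n) \<nu>" using \<nu> by (simp add: Dens_iff)
  note \<theta> = smooth_fun_theta[OF s\<nu>]
  fix \<xi> assume "\<xi> \<in> dens_tangent A \<omega> n"
  then have s\<xi>: "smooth_form A (2 * n) \<xi>" by (simp add: dens_tangent_iff)
  note \<psi> = smooth_fun_theta[OF s\<xi>]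
  {
    fix \<zeta> a b assume "\<zeta> \<in> dens_tangent A \<omega> n"
    then have s\<zeta>: "smooth_form A (2 * n) \<zeta>" by (simp add: dens_tangent_iff)
    let ?g = "\<lambda>\<xi> p. real (j + 2) * theta \<nu> p ^ (j + 1) * theta \<xi> p"
    have "integrable liouville_measure (?g \<xi>)" if "smooth_form A (2 * n) \<xi>" for \<xi>
      by (intro integrable_smooth_fun smooth_fun_mult smooth_fun_power smooth_fun_const \<theta> smooth_fun_theta[OF that])
    from this[OF s\<xi>] this[OF s\<zeta>] have "I (\<lambda>p. a * ?g \<xi> p + b * ?g \<zeta> p) = a * I (?g \<xi>) + b * I (?g \<zeta>)" by simp
    moreover have "(\<lambda>p. a * ?g \<xi> p + b * ?g \<zeta> p) = ?g (\<lambda>p vs. a * \<xi> p vs + b * \<zeta> p vs)"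
      by (simp add: theta_comb[OF s\<xi> s\<zeta>] algebra_simps)
    ultimately show "power_differential \<nu> j (\<lambda>p vs. a * \<xi> p vs + b * \<zeta> p vs) =
      a * power_differential \<nu> j \<xi> + b * power_differential \<nu> j \<zeta>"
      unfolding power_differential_def by simp
  next
    define N where "N = j + 2"
    define g where "g k p = of_nat (N choose k) * (theta \<xi> p ^ k * theta \<nu> p ^ (N - k))" for k p
    have g: "integrable liouville_measure (g k)" for k
      unfolding g_def using \<theta> \<psi>
      by (intro integrable_smooth_fun smooth_fun_mult smooth_fun_power smooth_fun_const)
    have expand: "C_functional A \<omega> n (\<lambda>x. x ^ (j + 2)) (perturb \<nu> \<xi> t) = (\<Sum>k\<le>N. I (g k) * t ^ k)" for t
    proof -
      have "C_functional A \<omega> n (\<lambda>x. x ^ (j + 2)) (perturb \<nu> \<xi> t) = I (\<lambda>p. (t * theta \<xi> p + theta \<nu> p) ^ N)"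
        by (simp add: C_functional_def theta_add_scaled[OF s\<nu> s\<xi>] N_def add.commute)
      also have "(\<lambda>p. (t * theta \<xi> p + theta \<nu> p) ^ N) = (\<lambda>p. \<Sum>k\<le>N. g k p * t ^ k)"
        by (simp add: binomial_ring g_def power_mult_distrib mult_ac)
      also have "I \<dots> = (\<Sum>k\<le>N. I (g k) * t ^ k)" using g by (simp add: integral_sum)
      finally show ?thesis .
    qed
    have "((\<lambda>t. \<Sum>k\<le>N. I (g k) * t ^ k) has_real_derivative (\<Sum>k\<le>N. I (g k) * (real k * 0 ^ (k - 1)))) (at 0)"
      by (auto intro!: derivative_eq_intros simp: mult.commute)
    \<comment> \<open>At zero only \<open>k = 1\<close> survives: the factor \<open>real k\<close>
      removes \<open>k = 0\<close>, and \<open>0 ^ 0\<close> is one.\<close>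
    also have "(\<Sum>k\<le>N. I (g k) * (real k * 0 ^ (k - 1))) = (\<Sum>k\<le>N. if k = 1 then I (g 1) else 0)"
      by (intro sum.cong) (auto simp: power_0_left)
    also have "\<dots> = I (g 1)" by (simp add: N_def)
    also have "I (g 1) = power_differential \<nu> j \<xi>"
    proof -
      have "g 1 = (\<lambda>p. real (j + 2) * theta \<nu> p ^ (j + 1) * theta \<xi> p)"
        by (simp add: fun_eq_iff g_def N_def mult_ac)
      then show ?thesis unfolding power_differential_def by (rule arg_cong)
    qed
    finally show "((\<lambda>t. C_functional A \<omega> n (\<lambda>x. x ^ (j + 2)) (perturb \<nu> \<xi> t)) has_real_derivative
       power_differential \<nu> j \<xi>) (at 0)"
      unfolding expand .
  }
qed

text \<open>Testing a vanishing combination of the differentials against \<open>P(\<theta>)\<close> minus its mean, where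
  \<open>P\<close> is the corresponding combination of the derivatives, shows that \<open>P(\<theta>)\<close> is constant.\<close>

lemma power_differentials_independent:
  assumes \<nu>: "\<nu> \<in> separating (Suc N)" and J: "J \<subseteq> {..<N}"
    and zero: "\<And>\<xi>. \<xi> \<in> dens_tangent A \<omega> n \<Longrightarrow> (\<Sum>j\<in>J. a j * power_differential \<nu> j \<xi>) = 0"
    and j: "j \<in> J"
  shows "a j = 0"
proof (rule ccontr)
  assume "a j \<noteq> 0"
  have D: "\<nu> \<in> Dens A \<omega> n" using \<nu> by (simp add: separating_def)
  then have "smooth_form A (2 * n) \<nu>" by (simp add: Dens_iff)
  note \<theta> = smooth_fun_theta[OF this]
  \<comment> \<open>\<open>u\<close> represents the combination of differentials: its value on a
    tangent vector is the integral of \<open>u\<close> times the factor of that vector.\<close>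
  define u where "u p = (\<Sum>j\<in>J. a j * real (j + 2) * theta \<nu> p ^ (j + 1))" for p
  have u: "smooth_fun A u"
    unfolding u_def by (intro smooth_fun_sum smooth_fun_mult smooth_fun_power smooth_fun_const \<theta>)
  obtain m where m: "smooth_fun A (\<lambda>p. u p - m)" "I (\<lambda>p. u p - m) = 0"
    by (rule subtract_mean[OF u])
  define \<psi> where "\<psi> = (\<lambda>p. u p - m)"
  have \<psi>: "smooth_fun A \<psi>" "I \<psi> = 0" using m by (simp_all only: \<psi>_def)
  have "(\<Sum>j\<in>J. a j * power_differential \<nu> j (\<lambda>p vs. \<psi> p * liouville p vs)) = 0"
    by (rule zero[OF scaled_liouville_in_dens_tangent[OF \<psi>]])
  moreover have "(\<Sum>j\<in>J. a j * power_differential \<nu> j (\<lambda>p vs. \<psi> p * liouville p vs)) = I (\<lambda>p. u p * \<psi> p)"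
  proof -
    have i: "integrable liouville_measure (\<lambda>p. real (j + 2) * theta \<nu> p ^ (j + 1) * \<psi> p)" for j
      by (intro integrable_smooth_fun smooth_fun_mult smooth_fun_power smooth_fun_const \<theta> \<psi>)
    have "(\<lambda>p. u p * \<psi> p) = (\<lambda>p. \<Sum>j\<in>J. a j * (real (j + 2) * theta \<nu> p ^ (j + 1) * \<psi> p))"
      by (simp add: u_def sum_distrib_right mult.assoc)
    then have "I (\<lambda>p. u p * \<psi> p) = I (\<lambda>p. \<Sum>j\<in>J. a j * (real (j + 2) * theta \<nu> p ^ (j + 1) * \<psi> p))"
      by (rule arg_cong)
    also have "\<dots> = (\<Sum>j\<in>J. I (\<lambda>p. a j * (real (j + 2) * theta \<nu> p ^ (j + 1) * \<psi> p)))"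
      by (rule Bochner_Integration.integral_sum) (use i in simp)
    finally show ?thesis
      unfolding power_differential_def theta_scaled using i by simp
  qed
  ultimately have u0: "I (\<lambda>p. u p * \<psi> p) = 0" by simp
  \<comment> \<open>Replacing \<open>u\<close> by \<open>\<psi>\<close> changes the integral by
    \<open>m\<close> times the integral of \<open>\<psi>\<close>, which is zero, so the square of
    \<open>\<psi>\<close> has integral zero.\<close>
  have "(\<lambda>p. \<psi> p * \<psi> p) = (\<lambda>p. u p * \<psi> p + (- m) * \<psi> p)"
    by (simp add: \<psi>_def algebra_simps)
  then have "I (\<lambda>p. \<psi> p * \<psi> p) = 0"
    using I_add_scaled[OF smooth_fun_mult[OF u \<psi>(1)] \<psi>(1), of "- m"] u0 \<psi>(2) by simp
  then have "\<psi> p = 0" for p using I_square_zero[OF \<psi>(1)] by blast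
  then have um: "u p = m" for p by (simp add: \<psi>_def)
  \<comment> \<open>The coefficients of P minus the constant \<open>m\<close>; the derivative of the
    power \<open>k + 2\<close> sits at index \<open>k + 1\<close>.\<close>
  define c where "c i = (case i of 0 \<Rightarrow> - m | Suc k \<Rightarrow> if k \<in> J then a k * real (k + 2) else 0)" for i
  have "(\<Sum>i\<le>N. c i * x ^ i) = - m + (\<Sum>k\<in>J. a k * real (k + 2) * x ^ (k + 1))" for x
  proof -
    have "(\<Sum>i\<le>N. c i * x ^ i) = c 0 + (\<Sum>k<N. c (Suc k) * x ^ Suc k)"
      by (simp add: sum.atMost_shift)
    also have "(\<Sum>k<N. c (Suc k) * x ^ Suc k) = (\<Sum>k<N. if k \<in> J then a k * real (k + 2) * x ^ (k + 1) else 0)"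
      by (intro sum.cong) (auto simp: c_def)
    also have "\<dots> = (\<Sum>k\<in>{..<N} \<inter> J. a k * real (k + 2) * x ^ (k + 1))"
      by (rule sum.inter_restrict[symmetric]) simp
    also have "{..<N} \<inter> J = J" using J by blast
    finally show ?thesis by (simp add: c_def)
  qed
  then have root: "(\<Sum>i\<le>N. c i * theta \<nu> p ^ i) = 0" for p
    using um[of p] by (simp add: u_def)
  \<comment> \<open>A nonzero coefficient at an index up to \<open>N\<close> bounds the number of
    roots by \<open>N\<close>, against the \<open>Suc N\<close> values supplied by
    \<open>separating\<close>.\<close>
  have "c (Suc j) \<noteq> 0" using \<open>a j \<noteq> 0\<close> j by (simp add: c_def)
  moreover have "Suc j \<le> N" using j J by auto
  ultimately have fin: "finite {z. (\<Sum>i\<le>N. c i * z ^ i) = 0}" "card {z. (\<Sum>i\<le>N. c i * z ^ i) = 0} \<le> N"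
    using Transcendental.polyfun_rootbound[of c "Suc j" N] by simp_all
  obtain P where P: "finite P" "card P = Suc N" "inj_on (theta \<nu>) P"
    using \<nu> unfolding separating_def by blast
  have "Suc N = card (theta \<nu> ` P)" using P by (simp add: card_image)
  also have "\<dots> \<le> card {z. (\<Sum>i\<le>N. c i * z ^ i) = 0}"
    using root by (intro card_mono fin) auto
  also have "\<dots> \<le> N" by (rule fin)
  finally show False by simp
qed

theorem functionally_independent_powers:
  "functionally_independent A \<omega> n (\<lambda>j. C_functional A \<omega> n (\<lambda>x. x ^ (j + 2))) UNIV"
  unfolding functionally_independent_def
proof (intro allI impI)
  fix J :: "nat set" assume "finite J \<and> J \<subseteq> UNIV"
  then obtain N where N: "J \<subseteq> {..<N}" using finite_nat_iff_bounded by blast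
  show "\<exists>U. openin (dens_topology A \<omega> n) U \<and> dens_topology A \<omega> n closure_of U = Dens A \<omega> n \<and>
     (\<forall>\<nu>\<in>U. \<exists>D. (\<forall>j\<in>J. has_dens_differential A \<omega> n (C_functional A \<omega> n (\<lambda>x. x ^ (j + 2))) (D j) \<nu>) \<and>
        (\<forall>a. (\<forall>\<xi>\<in>dens_tangent A \<omega> n. (\<Sum>j\<in>J. a j * D j \<xi>) = 0) \<longrightarrow> (\<forall>j\<in>J. a j = 0)))"
  proof (intro exI[of _ "separating (Suc N)"] conjI ballI openin_separating closure_of_separating)
    fix \<nu> assume \<nu>: "\<nu> \<in> separating (Suc N)"
    then have "\<nu> \<in> Dens A \<omega> n" by (simp add: separating_def)
    then show "\<exists>D. (\<forall>j\<in>J. has_dens_differential A \<omega> n (C_functional A \<omega> n (\<lambda>x. x ^ (j + 2))) (D j) \<nu>) \<and>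
        (\<forall>a. (\<forall>\<xi>\<in>dens_tangent A \<omega> n. (\<Sum>j\<in>J. a j * D j \<xi>) = 0) \<longrightarrow> (\<forall>j\<in>J. a j = 0))"
      using has_dens_differential_power power_differentials_independent[OF \<nu> N]
      by (intro exI[of _ "power_differential \<nu>"]) blast
  qed
qed

end

theorem mainTheorem1:
  fixes A :: "('a::{t2_space,second_countable_topology}, real ^ 'k::{finite,wellorder}) chart set"
    and \<omega> :: "('a, real ^ 'k::_) form"
    and n :: nat
  assumes "smooth_atlas A"
    and "compact (UNIV :: 'a set)"
    and "CARD('k) = 2 * n"
    and "symplectic_form A \<omega>"
  shows "(\<forall>h :: real \<Rightarrow> real.
            casimir A \<omega> n (C_functional A \<omega> n h) \<and> casimir A \<omega> n (C_integrable A \<omega> n h)) \<and>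
         (\<exists>H :: nat \<Rightarrow> real \<Rightarrow> real.
            functionally_independent A \<omega> n (\<lambda>i. C_functional A \<omega> n (H i)) UNIV)"
proof -
  interpret symplectic_manifold A \<omega> n
    using assms by unfold_locales
  show ?thesis
    by (intro conjI allI exI[of _ "\<lambda>j x. x ^ (j + 2)"] casimir_C_functional casimir_C_integrable
        functionally_independent_powers)
qed

end
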